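(* For all $n\geq 1$, the orbifold $\mathcal{A}(n)^{Sp(2n)}$ has a minimal strong generating set $\{j^0, j^2, \dots, j^{2n-2}\}$, where $j^{2m}=\frac12\sum_{i=1}^n\big(:e^i\,\partial^{2m}f^i:+:\partial^{2m}e^i\, f^i:\big)$, and is therefore a $\mathcal{W}$-algebra of type $\mathcal{W}(2,4,\dots,2n)$.
   Context: The rank $n$ symplectic fermion algebra $\mathcal{A}(n)$ is the vertex (super)algebra over $\mathbb{C}$ freely generated by odd elements $e^i,f^i$, $i=1,\dots,n$, with operator product expansions $e^i(z)f^j(w)\sim\delta_{i,j}(z-w)^{-2}$, $f^j(z)e^i(w)\sim-\delta_{i,j}(z-w)^{-2}$, $e^i(z)e^j(w)\sim 0$, $f^i(z)f^j(w)\sim 0$. Its conformal vector is $L=-\sum_i :e^if^i:$ (central charge $-2n$), for which $e^i,f^i$ are primary of weight one. Its full automorphism group is $Sp(2n)$, acting linearly on the generators, which span a copy of the standard module $\mathbb{C}^{2n}$ with symplectic basis $\{e^i,f^i\}$. For a group $G$ of automorphisms, $\mathcal{V}^G$ is the subalgebra of $G$-invariants. A subset $\{a_i\}$ of a vertex algebra strongly generates it if the algebra is spanned by the iterated Wick products $:\partial^{k_1}a_{i_1}\cdots\partial^{k_t}a_{i_t}:$ with $k_1,\dots,k_t\geq 0$. A strong generating set is minimal if no proper subset of it is a strong generating set. A vertex algebra is of type $\mathcal{W}(d_1,\dots,d_r)$ if it has a minimal strong generating set consisting of $r$ elements, one in each of the conformal weights $d_1,\dots,d_r$. The element $j^{2m}$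 has weight $2m+2$. *)

theory Defs
  imports "HOL-Library.Groups_Big_Fun" "Jordan_Normal_Form.Matrix"
begin

text \<open>
  Vertex superalgebras over the complex numbers.  The underlying vector space is the whole type
  \<open>'v\<close> with scalar multiplication \<open>scl V\<close>; \<open>par V False\<close> and \<open>par V True\<close> are the even and the odd
  part, and \<open>nprod V a m b\<close> is the \<open>m\<close>-th product \<open>a\<^sub>(\<^sub>m\<^sub>)b\<close>, that is,
  \<open>Y(a,z)b = \<Sum>\<^sub>m a\<^sub>(\<^sub>m\<^sub>)b z\<close> to the power \<open>-m-1\<close>.
\<close>

record 'v vertex_data =
  scl :: "complex \<Rightarrow> 'v \<Rightarrow> 'v"
  par :: "bool \<Rightarrow> 'v set"
  vac :: 'v
  nprod :: "'v \<Rightarrow> int \<Rightarrow> 'v \<Rightarrow> 'v"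

definition koszul :: "bool \<Rightarrow> bool \<Rightarrow> complex" where
  "koszul p q = (if p \<and> q then -1 else 1)"

text \<open>
  The last axiom is the Borcherds identity
  \<open>\<Sum>\<^sub>j (m choose j) (a\<^sub>(\<^sub>n\<^sub>+\<^sub>j\<^sub>) b)\<^sub>(\<^sub>m\<^sub>+\<^sub>k\<^sub>-\<^sub>j\<^sub>) c =
   \<Sum>\<^sub>j (-1)\<^sup>j (n choose j) (a\<^sub>(\<^sub>m\<^sub>+\<^sub>n\<^sub>-\<^sub>j\<^sub>) (b\<^sub>(\<^sub>k\<^sub>+\<^sub>j\<^sub>) c) - (-1)\<^sup>n (-1)\<^sup>p\<^sup>q b\<^sub>(\<^sub>n\<^sub>+\<^sub>k\<^sub>-\<^sub>j\<^sub>) (a\<^sub>(\<^sub>m\<^sub>+\<^sub>j\<^sub>) c))\<close>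
  for \<open>a\<close>, \<open>b\<close> of parity \<open>p\<close>, \<open>q\<close> and all integers \<open>m\<close>, \<open>n\<close>, \<open>k\<close>.  By truncation both
  sums over \<open>j \<ge> 0\<close> have only finitely many nonzero terms, so \<open>Sum_any\<close> (which would be 0 for
  infinite support) is the intended sum.
\<close>

locale vertex_superalgebra = vector_space "scl V"
  for V :: "('v::ab_group_add) vertex_data" +
  assumes par_subspace: "module.subspace (scl V) (par V p)"
    and par_decomp: "\<exists>!uw. fst uw \<in> par V False \<and> snd uw \<in> par V True \<and> v = fst uw + snd uw"
    and vac_even: "vac V \<in> par V False"
    and nprod_par: "a \<in> par V p \<Longrightarrow> b \<in> par V q \<Longrightarrow> nprod V a m b \<in> par V (p \<noteq> q)"
    and nprod_linear_left: "Vector_Spaces.linear (scl V) (scl V) (\<lambda>a. nprod V a m b)"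
    and nprod_linear_right: "Vector_Spaces.linear (scl V) (scl V) (\<lambda>b. nprod V a m b)"
    and truncation: "\<exists>N. \<forall>m\<ge>N. nprod V a m b = 0"
    and vac_left: "nprod V (vac V) m a = (if m = -1 then a else 0)"
    and creation: "nprod V a (-1) (vac V) = a"
    and vac_right: "m \<ge> 0 \<Longrightarrow> nprod V a m (vac V) = 0"
    and borcherds:
      "a \<in> par V p \<Longrightarrow> b \<in> par V q \<Longrightarrow>
        Sum_any (\<lambda>j::nat. scl V (of_int m gchoose j)
            (nprod V (nprod V a (n + int j) b) (m + k - int j) c))
      = Sum_any (\<lambda>j::nat. scl V ((-1) ^ j * (of_int n gchoose j))
            (nprod V a (m + n - int j) (nprod V b (k + int j) c)
             - scl V ((-1) powi n * koszul p q)
                 (nprod V b (n + k - int j) (nprod V a (m + int j) c))))"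

definition deriv_op :: "'v vertex_data \<Rightarrow> 'v \<Rightarrow> 'v" where
  "deriv_op V a = nprod V a (-2) (vac V)"

definition wick :: "'v vertex_data \<Rightarrow> 'v \<Rightarrow> 'v \<Rightarrow> 'v" where
  "wick V a b = nprod V a (-1) b"

text \<open>The iterated Wick product is right-nested; the empty one is the vacuum.  The final factor
  \<open>vac V\<close> is harmless since \<open>wick V a (vac V) = a\<close>.\<close>

definition wick_monomial :: "'v vertex_data \<Rightarrow> ('v \<times> nat) list \<Rightarrow> 'v" where
  "wick_monomial V w = foldr (\<lambda>(a, k). wick V ((deriv_op V ^^ k) a)) w (vac V)"

definition vertex_subalgebra :: "('v::ab_group_add) vertex_data \<Rightarrow> 'v set \<Rightarrow> bool" where
  "vertex_subalgebra V U \<longleftrightarrow> module.subspace (scl V) U \<and> vac V \<in> U \<and>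
     (\<forall>a\<in>U. \<forall>b\<in>U. \<forall>m. nprod V a m b \<in> U)"

text \<open>In the following definitions \<open>U\<close> is meant to be a vertex subalgebra of \<open>V\<close>.\<close>

definition strongly_generates :: "('v::ab_group_add) vertex_data \<Rightarrow> 'v set \<Rightarrow> 'v set \<Rightarrow> bool" where
  "strongly_generates V U S \<longleftrightarrow> S \<subseteq> U \<and>
     module.span (scl V) {wick_monomial V w | w. fst ` set w \<subseteq> S} = U"

definition minimal_strong_generating_set ::
    "('v::ab_group_add) vertex_data \<Rightarrow> 'v set \<Rightarrow> 'v set \<Rightarrow> bool" where
  "minimal_strong_generating_set V U S \<longleftrightarrow>
     strongly_generates V U S \<and> (\<forall>S'. S' \<subset> S \<longrightarrow> \<not> strongly_generates V U S')"

text \<open>\<open>L\<^sub>(\<^sub>1\<^sub>)\<close> is the Virasoro operator \<open>L\<^sub>0\<close>.\<close>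

definition has_conformal_weight :: "'v vertex_data \<Rightarrow> 'v \<Rightarrow> nat \<Rightarrow> 'v \<Rightarrow> bool" where
  "has_conformal_weight V L d v \<longleftrightarrow> nprod V L 1 v = scl V (of_nat d) v"

definition of_type_W ::
    "('v::ab_group_add) vertex_data \<Rightarrow> 'v \<Rightarrow> 'v set \<Rightarrow> nat list \<Rightarrow> bool" where
  "of_type_W V L U ds \<longleftrightarrow> (\<exists>as. distinct as \<and> length as = length ds \<and>
     minimal_strong_generating_set V U (set as) \<and>
     (\<forall>i < length ds. has_conformal_weight V L (ds ! i) (as ! i)))"

definition vertex_automorphism :: "('v::ab_group_add) vertex_data \<Rightarrow> ('v \<Rightarrow> 'v) \<Rightarrow> bool" where
  "vertex_automorphism V g \<longleftrightarrow> Vector_Spaces.linear (scl V) (scl V) g \<and> bij g \<and>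
     (\<forall>p. g ` par V p \<subseteq> par V p) \<and> g (vac V) = vac V \<and>
     (\<forall>a m b. g (nprod V a m b) = nprod V (g a) m (g b))"

definition orbifold :: "'v vertex_data \<Rightarrow> ('v \<Rightarrow> 'v) set \<Rightarrow> 'v set" where
  "orbifold V G = {v. \<forall>g\<in>G. g v = v}"

lemma orbifold_vertex_subalgebra:
  assumes "vertex_superalgebra V" and G: "\<And>g. g \<in> G \<Longrightarrow> vertex_automorphism V g"
  shows "vertex_subalgebra V (orbifold V G)"
proof -
  interpret vertex_superalgebra V by fact
  have hom: "module_hom (scl V) (scl V) g" if "g \<in> G" for g
    using G[OF that] by (simp add: vertex_automorphism_def linear_iff_module_hom)
  have "module.subspace (scl V) (orbifold V G)"
    unfolding subspace_def orbifold_def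
    by (simp add: module_hom.add[OF hom] module_hom.scale[OF hom] module_hom.zero[OF hom]) metis
  moreover have "g (vac V) = vac V" "g (nprod V a m b) = nprod V (g a) m (g b)"
    if "g \<in> G" for g a m b
    using G[OF that] by (simp_all add: vertex_automorphism_def)
  ultimately show ?thesis
    by (simp add: vertex_subalgebra_def orbifold_def) metis
qed

text \<open>
  \<open>V\<close> is freely generated by homogeneous elements \<open>x 0, \<dots>, x (N-1)\<close> if the ordered Wick monomials
  in their derivatives form a basis.  A word lists the factors as pairs (generator index, number
  of derivatives); a derivative of an odd generator may occur at most once.
\<close>

definition ordered_words :: "'v vertex_data \<Rightarrow> nat \<Rightarrow> (nat \<Rightarrow> 'v) \<Rightarrow> (nat \<times> nat) list set" where
  "ordered_words V N x = {w. (\<forall>(i, k) \<in> set w. i < N) \<and>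
     sorted_wrt (\<lambda>(i, k) (j, l). i < j \<or> i = j \<and> (if x i \<in> par V True then k > l else k \<ge> l)) w}"

definition freely_generated :: "('v::ab_group_add) vertex_data \<Rightarrow> nat \<Rightarrow> (nat \<Rightarrow> 'v) \<Rightarrow> bool" where
  "freely_generated V N x \<longleftrightarrow>
     (let mon = (\<lambda>w. wick_monomial V (map (\<lambda>(i, k). (x i, k)) w)); W = ordered_words V N x in
      inj_on mon W \<and> \<not> module.dependent (scl V) (mon ` W) \<and> module.span (scl V) (mon ` W) = UNIV)"

text \<open>\<open>a(z)b(w) \<sim> c (z-w)\<^sup>-\<^sup>2\<close>, since the coefficient of the pole of order \<open>m+1\<close> is \<open>a\<^sub>(\<^sub>m\<^sub>)b\<close>.\<close>

definition ope_double_pole ::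
    "('v::ab_group_add) vertex_data \<Rightarrow> 'v \<Rightarrow> 'v \<Rightarrow> complex \<Rightarrow> bool" where
  "ope_double_pole V a b c \<longleftrightarrow>
     (\<forall>m\<ge>0. nprod V a m b = (if m = 1 then scl V c (vac V) else 0))"

text \<open>The generators are indexed from 0: \<open>e 0, \<dots>, e (n-1), f 0, \<dots>, f (n-1)\<close>, in this order.\<close>

definition sf_gen :: "nat \<Rightarrow> (nat \<Rightarrow> 'v) \<Rightarrow> (nat \<Rightarrow> 'v) \<Rightarrow> nat \<Rightarrow> 'v" where
  "sf_gen n e f a = (if a < n then e a else f (a - n))"

locale symplectic_fermion_algebra = vertex_superalgebra V
  for V :: "('v::ab_group_add) vertex_data" +
  fixes n :: nat and e f :: "nat \<Rightarrow> 'v"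
  assumes e_odd: "i < n \<Longrightarrow> e i \<in> par V True"
    and f_odd: "i < n \<Longrightarrow> f i \<in> par V True"
    and ope_ef: "i < n \<Longrightarrow> j < n \<Longrightarrow> ope_double_pole V (e i) (f j) (if i = j then 1 else 0)"
    and ope_fe: "i < n \<Longrightarrow> j < n \<Longrightarrow> ope_double_pole V (f j) (e i) (if i = j then -1 else 0)"
    and ope_ee: "i < n \<Longrightarrow> j < n \<Longrightarrow> ope_double_pole V (e i) (e j) 0"
    and ope_ff: "i < n \<Longrightarrow> j < n \<Longrightarrow> ope_double_pole V (f i) (f j) 0"
    and free: "freely_generated V (2 * n) (sf_gen n e f)"

definition sf_conformal ::
    "('v::ab_group_add) vertex_data \<Rightarrow> nat \<Rightarrow> (nat \<Rightarrow> 'v) \<Rightarrow> (nat \<Rightarrow> 'v) \<Rightarrow> 'v" where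
  "sf_conformal V n e f = - (\<Sum>i<n. wick V (e i) (f i))"

definition sf_j ::
    "('v::ab_group_add) vertex_data \<Rightarrow> nat \<Rightarrow> (nat \<Rightarrow> 'v) \<Rightarrow> (nat \<Rightarrow> 'v) \<Rightarrow> nat \<Rightarrow> 'v" where
  "sf_j V n e f k = scl V (1/2) (\<Sum>i<n.
     wick V (e i) ((deriv_op V ^^ k) (f i)) + wick V ((deriv_op V ^^ k) (e i)) (f i))"

definition symp_form :: "nat \<Rightarrow> complex mat" where
  "symp_form n = four_block_mat (0\<^sub>m n n) (1\<^sub>m n) (- 1\<^sub>m n) (0\<^sub>m n n)"

definition Sp :: "nat \<Rightarrow> complex mat set" where
  "Sp n = {M \<in> carrier_mat (2 * n) (2 * n). M\<^sup>T * symp_form n * M = symp_form n}"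

text \<open>The image of the symplectic group of \<open>2n \<times> 2n\<close> matrices in the automorphism group: the
  automorphisms acting on the span of the generators by a symplectic matrix.  Such an automorphism
  is determined by its matrix, and every symplectic matrix occurs.\<close>

definition Sp_automorphisms ::
    "('v::ab_group_add) vertex_data \<Rightarrow> nat \<Rightarrow> (nat \<Rightarrow> 'v) \<Rightarrow> (nat \<Rightarrow> 'v) \<Rightarrow> ('v \<Rightarrow> 'v) set" where
  "Sp_automorphisms V n e f = {g. vertex_automorphism V g \<and> (\<exists>M \<in> Sp n. \<forall>b < 2 * n.
     g (sf_gen n e f b) = (\<Sum>a < 2 * n. scl V (M $$ (a, b)) (sf_gen n e f a)))}"

end

theory Submission
  imports Defs "Jordan_Normal_Form.Determinant" "HOL-Computational_Algebra.Formal_Laurent_Series"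
begin

text \<open>
  The algebra is an exterior algebra on the creation modes of the generators, on which \<open>Sp(2n)\<close>
  acts by algebra automorphisms.  For an invariant, the quadratic Casimir of \<open>gl\<^sub>2\<^sub>n\<close> agrees with
  its transpose by the symplectic form; if the invariant is harmonic, this equates a sum of squares
  with minus the degree.  Hence there are no harmonic invariants of positive degree, and the
  invariants are spanned by products of the quadratic ones \<open>q\<^sub>k\<^sub>l\<close>, the symmetrized
  \<open>\<Sum>\<^sub>i \<partial>\<^sup>ke\<^sub>i \<partial>\<^sup>lf\<^sub>i\<close>.

  The Wick product with \<open>q\<^sub>k\<^sub>l\<close> is the exterior multiplication by \<open>q\<^sub>k\<^sub>l\<close> plus a derivation that maps
  quadratic invariants to quadratic invariants.  Therefore, modulo Wick products of invariants of
  lower weight and derivatives, every invariant is a multiple of some \<open>q\<^sub>0\<^sub>,\<^sub>2\<^sub>m = 2 j\<^sup>2\<^sup>m\<close>, and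
  \<open>q\<^sub>0\<^sub>,\<^sub>2\<^sub>k q\<^sub>0\<^sub>0\<^sup>i\<close> is a nonzero multiple of \<open>q\<^sub>0\<^sub>,\<^sub>2\<^sub>k\<^sub>+\<^sub>2 q\<^sub>0\<^sub>0\<^sup>i\<^sup>-\<^sup>1\<close>.  Since \<open>q\<^sub>0\<^sub>,\<^sub>2\<^sub>k q\<^sub>0\<^sub>0\<^sup>n = 0\<close>, iteration shows that
  \<open>j\<^sup>2\<^sup>m\<close> decouples for all \<open>m \<ge> n\<close>.

  For minimality, twist \<open>e\<^sub>i(z)\<close> and \<open>f\<^sub>i(z)\<close> by \<open>exp (\<lambda>\<^sub>i z)\<close> and \<open>exp (-\<lambda>\<^sub>i z)\<close>.  The resulting vacuum
  functional is multiplicative on Wick products with the \<open>j\<^sup>2\<^sup>k\<close>, vanishes on Wick products with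
  their proper derivatives, and takes at \<open>j\<^sup>2\<^sup>k\<close> a nonzero multiple of the power sum of the
  \<open>\<lambda>\<^sub>i\<close> of degree \<open>2k+2\<close>.  If the nonzero \<open>\<lambda>\<^sub>i\<close> are suitable roots of unity, it separates \<open>j\<^sup>2\<^sup>m\<close>
  from all Wick monomials of the same weight in the other generators.
\<close>

section \<open>Calculus in vertex superalgebras\<close>

text \<open>The orbifold is defined by a group, while the harmonic argument needs the Lie algebra.
  So transvections are constructed as automorphisms from the monomial basis. Their action is
  polynomial in the parameter, and on an invariant the linear coefficient must vanish. Positivity
  comes from a Hermitian form with orthonormal monomials, for which creation and annihilation
  operators are adjoint. The twist hides an obstacle: multiplying the two-point function by exp (c
  (z - w)) would create a simple pole and destroy the operator products. The kernel used is the
  w-derivative of exp (c (z - w)) / (z - w), in which the simple pole cancels; this amounts to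
  twisting a primitive of one of two partner fields. The power sums are read off from its regular
  part at z = w. The number n enters from two sides. For decoupling, 2n is the number of underived
  odd letters, so more than 2n of them multiply to 0. For minimality, m + 1 parameters are used to
  make the first m even power sums vanish but not the next, and m < n provides them.\<close>

lemma Sum_any_lessThan:
  fixes F :: "nat \<Rightarrow> 'a::comm_monoid_add"
  assumes "\<And>j. j \<ge> N \<Longrightarrow> F j = 0"
  shows "Sum_any F = (\<Sum>j<N. F j)"
  by (rule Sum_any.expand_superset) (use assms in \<open>force simp: not_le\<close>)+

lemma gbinomial_0_left_if: "(0::complex) gchoose j = (if j = 0 then 1 else 0)"
  by (cases j) auto

context vertex_superalgebra
begin

abbreviation scale_infix (infixr "*s" 75) where "c *s v \<equiv> scl V c v"

lemma hom_left: "module_hom (scl V) (scl V) (\<lambda>a. nprod V a m b)"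
  using nprod_linear_left by (simp add: linear_iff_module_hom)

lemma hom_right: "module_hom (scl V) (scl V) (\<lambda>b. nprod V a m b)"
  using nprod_linear_right by (simp add: linear_iff_module_hom)

lemmas nprod_simps =
  module_hom.zero[OF hom_left] module_hom.zero[OF hom_right]
  module_hom.add[OF hom_left] module_hom.add[OF hom_right]
  module_hom.scale[OF hom_left] module_hom.scale[OF hom_right]
  module_hom.neg[OF hom_left] module_hom.neg[OF hom_right]
  module_hom.diff[OF hom_left] module_hom.diff[OF hom_right]
  module_hom.sum[OF hom_left] module_hom.sum[OF hom_right]

lemma linear_span_closed:
  assumes "\<And>u v. f (u + v) = f u + f v" "\<And>t v. f (t *s v) = t *s f v"
    and "\<And>s. s \<in> T \<Longrightarrow> f s \<in> span U" "u \<in> span T"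
  shows "f u \<in> span U"
  using assms(4)
proof (induction rule: span_induct_alt)
  case base
  show ?case using assms(2)[of 0 0] by (simp add: span_zero)
qed (simp add: assms(1-3) span_add span_scale)

lemma truncation_uniform:
  assumes "finite A"
  shows "\<exists>N\<ge>0. \<forall>m\<ge>N. \<forall>(a, b)\<in>A. nprod V a m b = 0"
  using assms
proof induction
  case (insert p A)
  obtain a b where p: "p = (a, b)" by force
  obtain N1 where "N1 \<ge> 0" "\<forall>m\<ge>N1. \<forall>(a, b)\<in>A. nprod V a m b = 0" using insert by blast
  moreover obtain N2 where "\<forall>m\<ge>N2. nprod V a m b = 0" using truncation by blast
  ultimately show ?case by (intro exI[of _ "max N1 N2"]) (auto simp: p)
qed auto

lemma par_split: "\<exists>u w. u \<in> par V False \<and> w \<in> par V True \<and> v = u + w"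
  using par_decomp[of v] by blast

lemma par_inter_trivial:
  assumes "v \<in> par V False" "v \<in> par V True"
  shows "v = 0"
proof -
  have z: "0 \<in> par V p" for p using par_subspace subspace_0 by blast
  have "\<exists>!uw. fst uw \<in> par V False \<and> snd uw \<in> par V True \<and> v = fst uw + snd uw"
    by (rule par_decomp)
  then have "(v, 0) = (0, v)" using assms z by (metis add.right_neutral add_0 fst_conv snd_conv)
  then show ?thesis by simp
qed

text \<open>The Borcherds identity with its second index set to 0: on the right only
  \<open>j = 0\<close> survives.\<close>

lemma commutator_homogeneous:
  assumes "a \<in> par V p" "b \<in> par V q"
  shows "nprod V a m (nprod V b k c) - koszul p q *s nprod V b k (nprod V a m c)
       = Sum_any (\<lambda>j::nat. (of_int m gchoose j) *s nprod V (nprod V a (int j) b) (m + k - int j) c)"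
proof -
  have "Sum_any (\<lambda>j::nat. scl V ((-1) ^ j * (of_int 0 gchoose j))
            (nprod V a (m + 0 - int j) (nprod V b (k + int j) c)
             - scl V ((-1) powi 0 * koszul p q)
                 (nprod V b (0 + k - int j) (nprod V a (m + int j) c))))
     = (\<Sum>j<1. scl V ((-1) ^ j * (of_int 0 gchoose j))
            (nprod V a (m + 0 - int j) (nprod V b (k + int j) c)
             - scl V ((-1) powi 0 * koszul p q)
                 (nprod V b (0 + k - int j) (nprod V a (m + int j) c))))"
    by (rule Sum_any_lessThan) (simp add: gbinomial_0_left_if)
  then show ?thesis using borcherds[OF assms, of m 0 k c] by simp
qed

text \<open>For even \<open>a\<close> the sign is 1 whatever the parity of \<open>b\<close>, so the
  formula is additive in \<open>b\<close> and passes from homogeneous to arbitrary \<open>b\<close>.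
  The bound \<open>N\<close> refers to \<open>b\<close> itself, although its two components may need
  a larger one.\<close>

lemma commutator_even:
  assumes a: "a \<in> par V False" and N: "\<And>j. j \<ge> N \<Longrightarrow> nprod V a (int j) b = 0"
  shows "nprod V a m (nprod V b k c) - nprod V b k (nprod V a m c)
       = (\<Sum>j<N. (of_int m gchoose j) *s nprod V (nprod V a (int j) b) (m + k - int j) c)"
proof -
  have *: "\<exists>N. nprod V a m (nprod V b k c) - nprod V b k (nprod V a m c)
       = (\<Sum>j<N. (of_int m gchoose j) *s nprod V (nprod V a (int j) b) (m + k - int j) c) \<and>
       (\<forall>j\<ge>N. nprod V a (int j) b = 0)" for b
  proof -
    obtain b0 b1 where b: "b0 \<in> par V False" "b1 \<in> par V True" "b = b0 + b1"
      using par_split by metis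
    obtain N where N: "\<And>k. k \<ge> N \<Longrightarrow> nprod V a k b0 = 0 \<and> nprod V a k b1 = 0"
      using truncation_uniform[of "{(a, b0), (a, b1)}"] by auto
    have "nprod V a m (nprod V b' k c) - nprod V b' k (nprod V a m c)
       = (\<Sum>j<nat N. (of_int m gchoose j) *s nprod V (nprod V a (int j) b') (m + k - int j) c)"
      if b': "b' = b0 \<or> b' = b1" for b'
    proof -
      obtain q where 1: "b' \<in> par V q" using b' b(1,2) by blast
      have "Sum_any (\<lambda>j::nat. (of_int m gchoose j) *s nprod V (nprod V a (int j) b') (m + k - int j) c)
        = (\<Sum>j<nat N. (of_int m gchoose j) *s nprod V (nprod V a (int j) b') (m + k - int j) c)"
        by (rule Sum_any_lessThan) (use N b' in \<open>auto simp: nprod_simps\<close>)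
      then show ?thesis using commutator_homogeneous[OF a 1, of m k c] by (simp add: koszul_def)
    qed
    note this[of b0, simplified] this[of b1, simplified]
    then have "nprod V a m (nprod V b k c) - nprod V b k (nprod V a m c)
       = (\<Sum>j<nat N. (of_int m gchoose j) *s nprod V (nprod V a (int j) b0) (m + k - int j) c)
       + (\<Sum>j<nat N. (of_int m gchoose j) *s nprod V (nprod V a (int j) b1) (m + k - int j) c)"
      unfolding b(3) nprod_simps by (metis (no_types, lifting) add_diff_add)
    then show ?thesis
      by (intro exI[of _ "nat N"])
        (simp add: b(3) nprod_simps N sum.distrib[symmetric] scale_right_distrib)
  qed
  obtain N' where N': "nprod V a m (nprod V b k c) - nprod V b k (nprod V a m c)
       = (\<Sum>j<N'. (of_int m gchoose j) *s nprod V (nprod V a (int j) b) (m + k - int j) c)"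
    "\<And>j. j \<ge> N' \<Longrightarrow> nprod V a (int j) b = 0" using * by blast
  have "Sum_any (\<lambda>j::nat. (of_int m gchoose j) *s nprod V (nprod V a (int j) b) (m + k - int j) c)
      = (\<Sum>j<N''. (of_int m gchoose j) *s nprod V (nprod V a (int j) b) (m + k - int j) c)"
    if "\<And>j. j \<ge> N'' \<Longrightarrow> nprod V a (int j) b = 0" for N''
    by (rule Sum_any_lessThan) (simp add: that nprod_simps)
  from this[OF N] this[OF N'(2)] N'(1) show ?thesis by simp
qed

text \<open>The Borcherds identity with its first index set to 0: now the left side reduces to
  \<open>j = 0\<close>.\<close>

lemma iterate_homogeneous:
  assumes a: "a \<in> par V p" and b: "b \<in> par V q"
    and N: "\<And>j. j \<ge> N \<Longrightarrow> nprod V b (k + int j) c = 0"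
      "\<And>j. j \<ge> N \<Longrightarrow> nprod V a (int j) c = 0"
  shows "nprod V (nprod V a r b) k c = (\<Sum>j<N. ((-1) ^ j * (of_int r gchoose j)) *s
            (nprod V a (r - int j) (nprod V b (k + int j) c)
             - ((-1) powi r * koszul p q) *s nprod V b (r + k - int j) (nprod V a (int j) c)))"
proof -
  have "Sum_any (\<lambda>j::nat. scl V (of_int 0 gchoose j)
            (nprod V (nprod V a (r + int j) b) (0 + k - int j) c))
    = (\<Sum>j<1. scl V (of_int 0 gchoose j)
            (nprod V (nprod V a (r + int j) b) (0 + k - int j) c))"
    by (rule Sum_any_lessThan) (simp add: gbinomial_0_left_if)
  moreover have "Sum_any (\<lambda>j::nat. scl V ((-1) ^ j * (of_int r gchoose j))
            (nprod V a (0 + r - int j) (nprod V b (k + int j) c)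
             - scl V ((-1) powi r * koszul p q)
                 (nprod V b (r + k - int j) (nprod V a (0 + int j) c))))
      = (\<Sum>j<N. scl V ((-1) ^ j * (of_int r gchoose j))
            (nprod V a (0 + r - int j) (nprod V b (k + int j) c)
             - scl V ((-1) powi r * koszul p q)
                 (nprod V b (r + k - int j) (nprod V a (0 + int j) c))))"
    by (rule Sum_any_lessThan) (simp add: N nprod_simps)
  ultimately show ?thesis using borcherds[OF a b, of 0 r k c] by simp
qed

lemma eq_minus_self: "(v::'v) = - v \<Longrightarrow> v = 0"
proof -
  assume "v = - v"
  then have "v + v = 0" by (metis add.right_inverse)
  then have "2 *s v = 0" using scale_left_distrib[of 1 1 v] by simp
  then show "v = 0" by simp
qed

abbreviation "D \<equiv> deriv_op V"

lemma D_add: "D (a + b) = D a + D b" and D_scale: "D (t *s a) = t *s D a" and D_0: "D 0 = 0"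
  by (simp_all add: deriv_op_def nprod_simps)

lemma D_sum: "D (\<Sum>i\<in>A. F i) = (\<Sum>i\<in>A. D (F i))"
  by (simp add: deriv_op_def nprod_simps)

lemma gbinomial_minus2: "(-1) ^ j * ((-2 :: complex) gchoose j) = of_nat (Suc j)"
proof -
  have "(2 + of_nat j - 1 :: complex) gchoose j = of_nat (Suc j choose j)"
    unfolding binomial_gbinomial by (simp add: add.commute)
  then show ?thesis using gbinomial_minus[of "2::complex" j]
    by (simp add: power_mult_distrib[symmetric] mult.assoc[symmetric])
qed

text \<open>The iterate formula with the vacuum as second factor. Only its mode -1 is nonzero, so at
  most one term survives: in the first half of the summand if \<open>k < 0\<close>, in the second
  half if \<open>k > 0\<close>.\<close>

lemma nprod_D: "nprod V (D a) k c = of_int (- k) *s nprod V a (k - 1) c"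
proof -
  have hom: "nprod V (D a) k c = of_int (- k) *s nprod V a (k - 1) c" if a: "a \<in> par V p" for a p
  proof -
    obtain N0 where N0: "\<And>m. m \<ge> N0 \<Longrightarrow> nprod V a m c = 0" using truncation by blast
    define N where "N = nat N0 + nat (abs k) + 1"
    have 1: "nprod V (vac V) (k + int j) c = 0" if "j \<ge> N" for j
      using that by (auto simp: vac_left N_def)
    have 2: "nprod V a (int j) c = 0" if "j \<ge> N" for j
      by (rule N0) (use that in \<open>simp add: N_def\<close>)
    have "nprod V (D a) k c = (\<Sum>j<N. of_nat (Suc j) *s
       (nprod V a (-2 - int j) (nprod V (vac V) (k + int j) c)
         - nprod V (vac V) (-2 + k - int j) (nprod V a (int j) c)))"
      unfolding deriv_op_def using iterate_homogeneous[where r="-2", OF a vac_even 1 2]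
      by (simp add: gbinomial_minus2 koszul_def power_int_minus del: of_nat_Suc)
    also have "\<dots> = (\<Sum>j<N. if j = nat (-1 - k) then (if k < 0 then of_int (- k) *s nprod V a (k - 1) c else 0) else 0)
      + (\<Sum>j<N. if j = nat (k - 1) then (if k > 0 then of_int (- k) *s nprod V a (k - 1) c else 0) else 0)"
      unfolding sum.distrib[symmetric]
    proof (rule sum.cong[OF refl])
      fix j
      consider "k < 0" | "k = 0" | "k > 0" by linarith
      then show "of_nat (Suc j) *s
         (nprod V a (-2 - int j) (nprod V (vac V) (k + int j) c)
           - nprod V (vac V) (-2 + k - int j) (nprod V a (int j) c))
         = (if j = nat (-1 - k) then (if k < 0 then of_int (- k) *s nprod V a (k - 1) c else 0) else 0)
         + (if j = nat (k - 1) then (if k > 0 then of_int (- k) *s nprod V a (k - 1) c else 0) else 0)"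
      proof cases
        case 1
        have "k + int j = -1 \<longleftrightarrow> j = nat (-1 - k)" using 1 by auto
        then show ?thesis using 1 by (auto simp: vac_left nprod_simps)
      next
        case 3
        have "-2 + k - int j = -1 \<longleftrightarrow> j = nat (k - 1)" using 3 by auto
        then show ?thesis using 3 by (auto simp: vac_left nprod_simps)
      qed (auto simp: vac_left nprod_simps)
    qed
    also have "\<dots> = of_int (- k) *s nprod V a (k - 1) c"
      by (subst sum.delta, simp, subst sum.delta, simp) (auto simp: N_def)
    finally show ?thesis .
  qed
  obtain u w where "u \<in> par V False" "w \<in> par V True" "a = u + w" using par_split by blast
  then show ?thesis using hom by (simp add: D_add nprod_simps scale_right_distrib)
qed

lemma nprod_D_pow:
  "nprod V ((D ^^ l) a) k c = ((-1) ^ l * fact l * (of_int k gchoose l)) *s nprod V a (k - int l) c"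
proof (induction l arbitrary: k)
  case (Suc l)
  have "of_nat (Suc l) * ((of_int k :: complex) gchoose Suc l) = of_int k * (of_int (k - 1) gchoose l)"
    using gbinomial_absorption[of l "of_int k :: complex"] by simp
  moreover have "(-1) ^ Suc l * fact (Suc l) * x = (-1) ^ Suc l * fact l * (of_nat (Suc l) * x)" for x :: complex
    by (simp only: fact_Suc of_nat_mult mult_ac)
  moreover have "of_int (-k) * ((-1) ^ l * fact l * x) = (-1) ^ Suc l * fact l * (of_int k * x)" for x :: complex
    by (simp add: mult_ac)
  ultimately have "of_int (-k) * ((-1) ^ l * fact l * (of_int (k - 1) gchoose l))
      = (-1) ^ Suc l * fact (Suc l) * ((of_int k :: complex) gchoose Suc l)"
    by (simp only:)
  moreover have "nprod V ((D ^^ Suc l) a) k c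
      = (of_int (-k) * ((-1) ^ l * fact l * (of_int (k - 1) gchoose l))) *s nprod V a (k - 1 - int l) c"
    by (simp only: funpow.simps o_apply nprod_D Suc.IH scale_scale)
  moreover have "k - 1 - int l = k - int (Suc l)" by simp
  ultimately show ?case by (simp only:)
qed simp

lemma gbinomial_minus1: "(-1) ^ j * ((-1 :: complex) gchoose j) = 1"
proof -
  have "(1 + of_nat j - 1 :: complex) gchoose j = of_nat (j choose j)"
    unfolding binomial_gbinomial by simp
  then show ?thesis using gbinomial_minus[of "1::complex" j]
    by (simp add: power_mult_distrib[symmetric] mult.assoc[symmetric])
qed

lemma nprod_D_pow_neg1: "nprod V ((D ^^ l) a) (-1) c = fact l *s nprod V a (-1 - int l) c"
proof -
  have "(-1) ^ l * fact l * ((-1::complex) gchoose l) = fact l * ((-1) ^ l * ((-1::complex) gchoose l))"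
    by (simp only: mult_ac)
  then show ?thesis by (simp add: nprod_D_pow gbinomial_minus1)
qed

lemma nprod_lt_neg1: "nprod V a (-1 - int l) c = inverse (fact l) *s nprod V ((D ^^ l) a) (-1) c"
  by (simp add: nprod_D_pow_neg1)

lemma D_vac: "D (vac V) = 0"
  by (simp add: deriv_op_def vac_left)

text \<open>The iterate formula for the mode -2 of \<open>nprod V a m b\<close> on the vacuum: terms
  with \<open>j >= 2\<close> vanish, \<open>j = 0\<close> contributes
  \<open>nprod V a m (D b)\<close>, and \<open>j = 1\<close> contributes
  \<open>nprod V (D a) m b\<close> by \<open>nprod_D\<close>.\<close>

lemma D_nprod: "D (nprod V a m b) = nprod V (D a) m b + nprod V a m (D b)"
proof -
  have hom: "D (nprod V a m b) = nprod V (D a) m b + nprod V a m (D b)"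
    if a: "a \<in> par V p" and b: "b \<in> par V q" for a b p q
  proof -
    have 1: "nprod V b (-2 + int j) (vac V) = 0" if "j \<ge> 2" for j using that by (simp add: vac_right)
    have 2: "nprod V a (int j) (vac V) = 0" for j by (simp add: vac_right)
    have "D (nprod V a m b) = (\<Sum>j<2. ((-1) ^ j * (of_int m gchoose j)) *s
            (nprod V a (m - int j) (nprod V b (-2 + int j) (vac V))))"
      unfolding deriv_op_def using iterate_homogeneous[where r=m, OF a b 1 2]
      by (simp add: 2 nprod_simps)
    then show ?thesis by (simp add: numeral_2_eq_2 nprod_D creation) (simp add: deriv_op_def)
  qed
  obtain u w where "u \<in> par V False" "w \<in> par V True" "a = u + w" using par_split by blast
  moreover obtain u' w' where "u' \<in> par V False" "w' \<in> par V True" "b = u' + w'" using par_split by blast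
  ultimately show ?thesis using hom by (simp add: D_add nprod_simps)
qed

lemma iterate_even:
  assumes a: "a \<in> par V False"
    and N: "\<And>j. j \<ge> N \<Longrightarrow> nprod V b (int j - 1) c = 0" "\<And>j. j \<ge> N \<Longrightarrow> nprod V a (int j) c = 0"
  shows "nprod V (nprod V a (-1) b) (-1) c = (\<Sum>j<N. nprod V a (-1 - int j) (nprod V b (int j - 1) c)
             + nprod V b (-2 - int j) (nprod V a (int j) c))"
proof -
  obtain b0 b1 where b: "b0 \<in> par V False" "b1 \<in> par V True" "b = b0 + b1"
    using par_split by metis
  obtain N0 where N0: "\<And>k. k \<ge> N0 \<Longrightarrow> nprod V b0 k c = 0 \<and> nprod V b1 k c = 0"
    using truncation_uniform[of "{(b0, c), (b1, c)}"] by auto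
  define M where "M = N + nat N0 + 1"
  have M2: "nprod V a (int j) c = 0" if "j \<ge> M" for j using that N(2) by (simp add: M_def)
  have hom: "nprod V (nprod V a (-1) b') (-1) c = (\<Sum>j<M. nprod V a (-1 - int j) (nprod V b' (int j - 1) c)
             + nprod V b' (-2 - int j) (nprod V a (int j) c))" if b': "b' = b0 \<or> b' = b1" for b'
  proof -
    obtain q where 1: "b' \<in> par V q" using b' b(1,2) by blast
    have M1: "nprod V b' (-1 + int j) c = 0" if "j \<ge> M" for j
      using that N0[of "-1 + int j"] b' by (auto simp: M_def)
    show ?thesis using iterate_homogeneous[where r="-1", OF a 1 M1 M2]
      by (simp add: gbinomial_minus1 koszul_def power_int_minus add.commute[of "-1"])
  qed
  have "nprod V (nprod V a (-1) b) (-1) c = (\<Sum>j<M. nprod V a (-1 - int j) (nprod V b (int j - 1) c)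
             + nprod V b (-2 - int j) (nprod V a (int j) c))"
    using hom[of b0] hom[of b1] by (simp add: b(3) nprod_simps sum.distrib algebra_simps)
  also have "\<dots> = (\<Sum>j<N. nprod V a (-1 - int j) (nprod V b (int j - 1) c)
             + nprod V b (-2 - int j) (nprod V a (int j) c))"
    by (rule sum.mono_neutral_right) (auto simp: M_def N nprod_simps)
  finally show ?thesis .
qed

end

section \<open>The Fock space\<close>

text \<open>The generator \<open>x\<^sub>a\<close> has a nontrivial operator product only with \<open>x\<close> of index \<open>partner n a\<close>,
  with coefficient \<open>sg n a\<close>.\<close>

definition partner :: "nat \<Rightarrow> nat \<Rightarrow> nat" where
  "partner n a = (if a < n then a + n else a - n)"

definition sg :: "nat \<Rightarrow> nat \<Rightarrow> complex" where
  "sg n a = (if a < n then 1 else -1)"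

lemma partner_less: "a < 2 * n \<Longrightarrow> partner n a < 2 * n"
  by (auto simp: partner_def)

lemma partner_partner: "a < 2 * n \<Longrightarrow> partner n (partner n a) = a"
  by (auto simp: partner_def)

lemma sg_partner: "a < 2 * n \<Longrightarrow> sg n (partner n a) = - sg n a"
  by (auto simp: partner_def sg_def)

lemma sg_sq: "sg n a * sg n a = 1"
  by (simp add: sg_def)

lemma sum_partner: "(\<Sum>a<2 * n. F (partner n a)) = (\<Sum>a<2 * n. F a)"
  by (rule sum.reindex_bij_witness[of _ "partner n" "partner n"])
    (auto simp: partner_partner partner_less)

text \<open>The order underlying \<open>ordered_words\<close> when all generators are odd.\<close>

definition flt :: "nat \<times> nat \<Rightarrow> nat \<times> nat \<Rightarrow> bool" where
  "flt p q \<longleftrightarrow> fst p < fst q \<or> fst p = fst q \<and> snd p > snd q"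

lemma flt_irrefl: "\<not> flt p p" and flt_trans: "flt p q \<Longrightarrow> flt q r \<Longrightarrow> flt p r"
  and flt_linear: "p \<noteq> q \<Longrightarrow> flt p q \<or> flt q p"
  by (auto simp: flt_def prod_eq_iff)

fun ins :: "nat \<times> nat \<Rightarrow> (nat \<times> nat) list \<Rightarrow> (nat \<times> nat) list" where
  "ins p [] = [p]"
| "ins p (q # w) = (if flt p q then p # q # w else q # ins p w)"

text \<open>The sign produced by anticommuting \<open>p\<close> from the front of the word to its
  sorted place.\<close>

fun isg :: "nat \<times> nat \<Rightarrow> (nat \<times> nat) list \<Rightarrow> complex" where
  "isg p [] = 1"
| "isg p (q # w) = (if flt p q then 1 else - isg p w)"

lemma isg_sq: "isg p w * isg p w = 1"
  by (induction w) auto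

lemma isg_real: "cnj (isg p w) = isg p w"
  by (induction w) auto

lemma set_ins: "set (ins p w) = insert p (set w)"
  by (induction w) auto

lemma sorted_ins: "sorted_wrt flt w \<Longrightarrow> p \<notin> set w \<Longrightarrow> sorted_wrt flt (ins p w)"
  by (induction w) (auto simp: set_ins dest: flt_linear intro: flt_trans)

lemma filter_ins: "p \<notin> set w \<Longrightarrow> filter (\<lambda>q. q \<noteq> p) (ins p w) = w"
  by (induction w) (auto simp: filter_id_conv)

lemma ins_filter: "sorted_wrt flt w \<Longrightarrow> p \<in> set w \<Longrightarrow> ins p (filter (\<lambda>q. q \<noteq> p) w) = w"
proof (induction w)
  case (Cons q w)
  show ?case
  proof (cases "p = q")
    case True
    then have "p \<notin> set w" using Cons.prems flt_irrefl[of q] by auto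
    then have "filter (\<lambda>q. q \<noteq> p) w = w" by (auto simp: filter_id_conv)
    moreover have "ins p w = p # w" using Cons.prems True by (cases w) auto
    ultimately show ?thesis using True by simp
  next
    case False
    then have "\<not> flt p q" using Cons.prems flt_irrefl flt_trans[of p q p] by auto
    then show ?thesis using Cons False by auto
  qed
qed simp

lemma ins_Cons: "(\<And>q. q \<in> set w \<Longrightarrow> flt p q) \<Longrightarrow> ins p w = p # w \<and> isg p w = 1"
  by (cases w) auto

context symplectic_fermion_algebra
begin

definition X :: "nat \<Rightarrow> int \<Rightarrow> 'v \<Rightarrow> 'v" where
  "X a m v = nprod V (sf_gen n e f a) m v"

lemma X_linear: "X a m (u + v) = X a m u + X a m v" "X a m (t *s v) = t *s X a m v" "X a m 0 = 0"
  "X a m (- v) = - X a m v" "X a m (u - v) = X a m u - X a m v" "X a m (\<Sum>i\<in>A. F i) = (\<Sum>i\<in>A. X a m (F i))"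
  by (simp_all add: X_def nprod_simps)

lemma gen_odd: "a < 2 * n \<Longrightarrow> sf_gen n e f a \<in> par V True"
  by (simp add: sf_gen_def e_odd f_odd)

lemma gen_ope:
  assumes "a < 2 * n" "b < 2 * n" "m \<ge> 0"
  shows "nprod V (sf_gen n e f a) m (sf_gen n e f b)
    = (if m = 1 \<and> b = partner n a then sg n a *s vac V else 0)"
proof -
  have "ope_double_pole V (sf_gen n e f a) (sf_gen n e f b) (if b = partner n a then sg n a else 0)"
  proof (cases "a < n"; cases "b < n")
    assume "a < n" "b < n"
    then show ?thesis using ope_ee[of a b] by (simp add: sf_gen_def partner_def)
  next
    assume *: "a < n" "\<not> b < n"
    then have "a = b - n \<longleftrightarrow> b = a + n" "b - n < n" using assms by auto
    then show ?thesis using ope_ef[of a "b - n"] * by (auto simp: sf_gen_def partner_def sg_def)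
  next
    assume *: "\<not> a < n" "b < n"
    then have "b = a - n \<longleftrightarrow> b = a - n" "a - n < n" using assms by auto
    then show ?thesis using ope_fe[of b "a - n"] * by (auto simp: sf_gen_def partner_def sg_def)
  next
    assume *: "\<not> a < n" "\<not> b < n"
    then have "b \<noteq> a - n" "a - n < n" "b - n < n" using assms by auto
    then show ?thesis using ope_ff[of "a - n" "b - n"] * by (simp add: sf_gen_def partner_def sg_def)
  qed
  then show ?thesis using assms(3) by (auto simp: ope_double_pole_def)
qed

lemma X_anticommute:
  assumes "a < 2 * n" "b < 2 * n"
  shows "X a m (X b k v) + X b k (X a m v)
    = (if b = partner n a \<and> m + k = 0 then sg n a * of_int m else 0) *s v"
proof -
  have "Sum_any (\<lambda>j::nat. (of_int m gchoose j) *s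
      nprod V (nprod V (sf_gen n e f a) (int j) (sf_gen n e f b)) (m + k - int j) v)
    = (\<Sum>j<2. (of_int m gchoose j) *s
      nprod V (nprod V (sf_gen n e f a) (int j) (sf_gen n e f b)) (m + k - int j) v)"
    by (rule Sum_any_lessThan) (simp add: gen_ope assms nprod_simps)
  also have "\<dots> = (if b = partner n a \<and> m + k = 0 then sg n a * of_int m else 0) *s v"
    by (auto simp: lessThan_nat_numeral gen_ope assms nprod_simps vac_left)
  finally show ?thesis
    using commutator_homogeneous[OF gen_odd[OF assms(1)] gen_odd[OF assms(2)], of m k v]
    by (simp add: X_def koszul_def)
qed

lemma X_swap:
  assumes "a < 2 * n" "b < 2 * n"
  shows "X a m (X b k v) = (if b = partner n a \<and> m + k = 0 then sg n a * of_int m else 0) *s v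
    - X b k (X a m v)"
  using X_anticommute[OF assms, of m k v] by (simp add: eq_diff_eq)

lemma X_vac: "m \<ge> 0 \<Longrightarrow> X a m (vac V) = 0"
  by (simp add: X_def vac_right)

definition cr :: "nat \<times> nat \<Rightarrow> 'v \<Rightarrow> 'v" where
  "cr p v = wick V ((D ^^ snd p) (sf_gen n e f (fst p))) v"

text \<open>The partner mode of order \<open>k + 1\<close>, scaled so that its anticommutator with
  \<open>cr (a, k)\<close>, which is \<open>fact k\<close> times a mode, is exactly 1.\<close>

definition an :: "nat \<times> nat \<Rightarrow> 'v \<Rightarrow> 'v" where
  "an p v = (- sg n (fst p) / fact (Suc (snd p))) *s X (partner n (fst p)) (int (snd p) + 1) v"

definition I :: "(nat \<times> nat) set" where
  "I = {p. fst p < 2 * n}"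

lemma cr_X: "cr p v = fact (snd p) *s X (fst p) (- 1 - int (snd p)) v"
  by (simp add: cr_def wick_def nprod_D_pow_neg1 X_def)

lemma X_cr: "X a (- 1 - int k) v = inverse (fact k) *s cr (a, k) v"
  by (simp add: cr_X)

lemma cr_linear: "cr p (u + v) = cr p u + cr p v" "cr p (t *s v) = t *s cr p v" "cr p 0 = 0"
  "cr p (- v) = - cr p v" "cr p (u - v) = cr p u - cr p v" "cr p (\<Sum>i\<in>A. F i) = (\<Sum>i\<in>A. cr p (F i))"
  by (simp_all add: cr_def wick_def nprod_simps)

lemma an_linear: "an p (u + v) = an p u + an p v" "an p (t *s v) = t *s an p v" "an p 0 = 0"
  "an p (- v) = - an p v" "an p (u - v) = an p u - an p v" "an p (\<Sum>i\<in>A. F i) = (\<Sum>i\<in>A. an p (F i))"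
  by (simp_all add: an_def X_linear scale_right_distrib scale_right_diff_distrib scale_sum_right mult.commute)

lemma cr_cr:
  assumes "p \<in> I" "q \<in> I"
  shows "cr p (cr q v) = - cr q (cr p v)"
proof -
  have "X (fst p) (- 1 - int (snd p)) (X (fst q) (- 1 - int (snd q)) v)
    = - X (fst q) (- 1 - int (snd q)) (X (fst p) (- 1 - int (snd p)) v)"
    using assms by (subst X_swap) (auto simp: I_def partner_less)
  then show ?thesis by (simp only: cr_X X_linear scale_scale scale_minus_right mult.commute)
qed

lemma an_an:
  assumes "p \<in> I" "q \<in> I"
  shows "an p (an q v) = - an q (an p v)"
proof -
  have "X (partner n (fst p)) (int (snd p) + 1) (X (partner n (fst q)) (int (snd q) + 1) v)
    = - X (partner n (fst q)) (int (snd q) + 1) (X (partner n (fst p)) (int (snd p) + 1) v)"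
    using assms by (subst X_swap) (auto simp: I_def partner_less)
  then show ?thesis by (simp only: an_def X_linear scale_scale scale_minus_right mult.commute)
qed

lemma an_cr:
  assumes "p \<in> I" "q \<in> I"
  shows "an p (cr q v) = (if p = q then v else 0) - cr q (an p v)"
proof -
  let ?s = "(- sg n (fst p) / fact (Suc (snd p))) * fact (snd q)"
  have "an p (cr q v) + cr q (an p v) = ?s *s
      (X (partner n (fst p)) (int (snd p) + 1) (X (fst q) (- 1 - int (snd q)) v)
       + X (fst q) (- 1 - int (snd q)) (X (partner n (fst p)) (int (snd p) + 1) v))"
    by (simp only: an_def cr_X X_linear scale_scale scale_right_distrib mult.commute)
  also have "\<dots> = ?s *s ((if p = q then sg n (partner n (fst p)) * of_nat (Suc (snd p)) else 0) *s v)"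
    using assms by (subst X_anticommute) (auto simp: I_def partner_less partner_partner prod_eq_iff)
  also have "\<dots> = (if p = q then v else 0)"
    using assms by (auto simp: sg_partner I_def sg_sq simp del: of_nat_Suc)
  finally show ?thesis by (simp add: eq_diff_eq)
qed

lemma an_vac: "an p (vac V) = 0"
  by (simp add: an_def X_vac)

section \<open>Ordered monomials as a basis, and linear maps out of the Fock space\<close>

definition mon :: "(nat \<times> nat) list \<Rightarrow> 'v" where
  "mon w = foldr cr w (vac V)"

definition W :: "(nat \<times> nat) list set" where
  "W = {w. set w \<subseteq> I \<and> sorted_wrt flt w}"

lemma ordered_words_eq: "ordered_words V (2 * n) (sf_gen n e f) = W"
proof -
  have "sorted_wrt (\<lambda>(i, k) (j, l). i < j \<or> i = j \<and> (if sf_gen n e f i \<in> par V True then k > l else k \<ge> l)) w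
     = sorted_wrt flt w" if "set w \<subseteq> I" for w
    using that by (induction w) (auto simp: I_def flt_def split_def gen_odd)
  moreover have "(\<forall>(i, k)\<in>set w. i < 2 * n) \<longleftrightarrow> set w \<subseteq> I" for w
    by (auto simp: I_def)
  ultimately show ?thesis unfolding ordered_words_def W_def by blast
qed

lemma wick_monomial_mon: "wick_monomial V (map (\<lambda>(i, k). (sf_gen n e f i, k)) w) = mon w"
  by (induction w) (auto simp: wick_monomial_def mon_def cr_def)

lemma mon_inj: "inj_on mon W" and mon_independent: "\<not> dependent (mon ` W)"
  and mon_span: "span (mon ` W) = UNIV"
  using free by (simp_all add: freely_generated_def Let_def ordered_words_eq wick_monomial_mon)

lemma V_basis_induct [case_names add scale mon]:
  assumes "\<And>u v. Q u \<Longrightarrow> Q v \<Longrightarrow> Q (u + v)" "\<And>t v. Q v \<Longrightarrow> Q (t *s v)"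
    and "\<And>w. w \<in> W \<Longrightarrow> Q (mon w)"
  shows "Q v"
proof -
  have "[] \<in> W" by (simp add: W_def)
  then have "subspace {v. Q v}"
    using assms(1,2) assms(2)[OF assms(3), of "[]" 0] by (auto simp: subspace_def)
  then have "span (mon ` W) \<subseteq> {v. Q v}" using assms(3) by (intro span_minimal) auto
  then show ?thesis by (auto simp: mon_span)
qed

lemma V_induct [case_names add scale vac cr]:
  assumes "\<And>u v. Q u \<Longrightarrow> Q v \<Longrightarrow> Q (u + v)" "\<And>t v. Q v \<Longrightarrow> Q (t *s v)" "Q (vac V)"
    and cr: "\<And>p v. p \<in> I \<Longrightarrow> Q v \<Longrightarrow> Q (cr p v)"
  shows "Q v"
proof -
  have "Q (mon w)" if "set w \<subseteq> I" for w
    using that by (induction w) (auto simp: mon_def assms)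
  then show ?thesis
    by (induction v rule: V_basis_induct) (auto simp: W_def assms)
qed

text \<open>The anticommutator of modes carries the factor \<open>m\<close>, so a zero mode
  anticommutes with every creation operator, and it kills the vacuum.\<close>

lemma X_zero_mode: "a < 2 * n \<Longrightarrow> X a 0 v = 0"
proof (induction v rule: V_induct)
  case (cr p v)
  then show ?case by (simp add: cr_X X_linear I_def X_swap[of a "fst p" 0])
qed (simp_all add: X_linear X_vac)

text \<open>Stated for any anticommuting family \<open>C\<close>, because \<open>fock_extend\<close>
  compares the creation operators with their prescribed images.\<close>

lemma foldr_ins:
  assumes lin: "\<And>q t v. q \<in> I \<Longrightarrow> C q (t *s v) = t *s C q v"
    and anti: "\<And>p q v. p \<in> I \<Longrightarrow> q \<in> I \<Longrightarrow> C p (C q v) = - C q (C p v)"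
    and "p \<in> I" "set w \<subseteq> I"
  shows "C p (foldr C w y) = isg p w *s foldr C (ins p w) y"
  using assms(4)
proof (induction w)
  case (Cons q w)
  then show ?case by (auto simp: anti[OF assms(3)] lin)
qed simp

lemma foldr_repeat:
  assumes lin: "\<And>q t v. q \<in> I \<Longrightarrow> C q (t *s v) = t *s C q v"
    and anti: "\<And>p q v. p \<in> I \<Longrightarrow> q \<in> I \<Longrightarrow> C p (C q v) = - C q (C p v)"
    and "p \<in> set w" "set w \<subseteq> I"
  shows "C p (foldr C w y) = 0"
  using assms(3,4)
proof (induction w)
  case (Cons q w)
  have pq: "p \<in> I" "q \<in> I" using Cons.prems by auto
  have z: "C r 0 = 0" if "r \<in> I" for r using lin[OF that, of 0 0] by simp
  show ?case
  proof (cases "p = q")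
    case True
    have "C p (C p (foldr C w y)) = 0" by (rule eq_minus_self) (rule anti[OF pq(1) pq(1)])
    then show ?thesis using True by simp
  next
    case False
    then show ?thesis using Cons z[OF pq(2)] by (simp add: anti[OF pq])
  qed
qed simp

text \<open>Since the ordered monomials form a basis, the creation operators can be sent to arbitrary
  anticommuting operators.\<close>

lemma fock_extend:
  assumes lin: "\<And>p. p \<in> I \<Longrightarrow> Vector_Spaces.linear (scl V) (scl V) (C p)"
    and anti: "\<And>p q v. p \<in> I \<Longrightarrow> q \<in> I \<Longrightarrow> C p (C q v) = - C q (C p v)"
  shows "\<exists>h. Vector_Spaces.linear (scl V) (scl V) h \<and> h (vac V) = y \<and> (\<forall>p\<in>I. \<forall>v. h (cr p v) = C p (h v))"
proof -
  interpret vp: vector_space_pair "scl V" "scl V" ..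
  have hC: "module_hom (scl V) (scl V) (C p)" if "p \<in> I" for p
    using lin[OF that] by (simp add: linear_iff_module_hom)
  obtain h where h: "Vector_Spaces.linear (scl V) (scl V) h"
      "\<And>b. b \<in> mon ` W \<Longrightarrow> h b = foldr C (the_inv_into W mon b) y"
    using vp.linear_independent_extend[OF mon_independent, of "\<lambda>b. foldr C (the_inv_into W mon b) y"] by blast
  have hm: "module_hom (scl V) (scl V) h" using h(1) by (simp add: linear_iff_module_hom)
  have has_wt: "h (mon w) = foldr C w y" if "w \<in> W" for w
    using h(2)[of "mon w"] that by (simp add: the_inv_into_f_f[OF mon_inj])
  have "h (cr p v) = C p (h v)" if p: "p \<in> I" for p v
  proof -
    have "h (cr p (mon w)) = C p (h (mon w))" if w: "w \<in> W" for w
    proof (cases "p \<in> set w")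
      case True
      have "cr p (mon w) = 0" unfolding mon_def
        by (rule foldr_repeat) (use True w in \<open>auto simp: cr_linear W_def intro: cr_cr\<close>)
      moreover have "C p (foldr C w y) = 0"
        by (rule foldr_repeat) (use True w in \<open>auto simp: module_hom.scale[OF hC] W_def intro: anti\<close>)
      ultimately show ?thesis by (simp add: has_wt w module_hom.zero[OF hm])
    next
      case False
      have "cr p (mon w) = isg p w *s mon (ins p w)" unfolding mon_def
        by (rule foldr_ins) (use p w in \<open>auto simp: cr_linear W_def intro: cr_cr\<close>)
      moreover have "C p (foldr C w y) = isg p w *s foldr C (ins p w) y"
        by (rule foldr_ins) (use p w in \<open>auto simp: module_hom.scale[OF hC] W_def intro: anti\<close>)
      moreover have "ins p w \<in> W" using w False p by (auto simp: W_def set_ins sorted_ins)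
      ultimately show ?thesis by (simp add: has_wt w module_hom.scale[OF hm])
    qed
    then show ?thesis
      by (induction v rule: V_basis_induct)
        (simp_all add: cr_linear module_hom.add[OF hm] module_hom.scale[OF hm] module_hom.add[OF hC[OF p]]
          module_hom.scale[OF hC[OF p]])
  qed
  moreover have "h (vac V) = y" using has_wt[of "[]"] by (simp add: W_def mon_def)
  ultimately show ?thesis using h(1) by blast
qed

text \<open>Only anticommutators with creation modes enter, since these determine all other modes.\<close>

lemma modes_extend:
  assumes lin: "\<And>a m u v. a < 2 * n \<Longrightarrow> Y a m (u + v) = Y a m u + Y a m v"
      "\<And>a m t v. a < 2 * n \<Longrightarrow> Y a m (t *s v) = t *s Y a m v"
    and vac: "\<And>a m. a < 2 * n \<Longrightarrow> m \<ge> 0 \<Longrightarrow> Y a m (vac V) = 0"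
    and anti: "\<And>a b m k v. a < 2 * n \<Longrightarrow> b < 2 * n \<Longrightarrow> k < 0 \<Longrightarrow> Y a m (Y b k v) + Y b k (Y a m v)
      = (if b = partner n a \<and> m + k = 0 then sg n a * of_int m else 0) *s v"
  shows "\<exists>h. Vector_Spaces.linear (scl V) (scl V) h \<and> h (vac V) = vac V \<and>
    (\<forall>b<2 * n. \<forall>m u. h (X b m u) = Y b m (h u))"
proof -
  let ?C = "\<lambda>p u. fact (snd p) *s Y (fst p) (- 1 - int (snd p)) u"
  have "\<exists>h. Vector_Spaces.linear (scl V) (scl V) h \<and> h (vac V) = vac V \<and>
      (\<forall>p\<in>I. \<forall>u. h (cr p u) = ?C p (h u))"
  proof (rule fock_extend)
    show "Vector_Spaces.linear (scl V) (scl V) (?C p)" if "p \<in> I" for p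
      unfolding linear_iff_module_hom module_hom_iff
      using module_axioms that by (simp add: lin scale_right_distrib mult.commute I_def)
    show "?C p (?C q u) = - ?C q (?C p u)" if "p \<in> I" "q \<in> I" for p q u
    proof -
      have pq: "fst p < 2 * n" "fst q < 2 * n" using that by (auto simp: I_def)
      then have "Y (fst p) (- 1 - int (snd p)) (Y (fst q) (- 1 - int (snd q)) u)
          = - Y (fst q) (- 1 - int (snd q)) (Y (fst p) (- 1 - int (snd p)) u)"
        using anti[of "fst p" "fst q" "- 1 - int (snd q)" "- 1 - int (snd p)" u]
        by (simp add: eq_neg_iff_add_eq_0)
      then show ?thesis by (simp only: lin(2)[OF pq(1)] lin(2)[OF pq(2)] scale_scale scale_minus_right mult.commute)
    qed
  qed
  then obtain h where h: "Vector_Spaces.linear (scl V) (scl V) h" "h (vac V) = vac V"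
    and cr: "\<And>p u. p \<in> I \<Longrightarrow> h (cr p u) = ?C p (h u)" by blast
  have hom: "module_hom (scl V) (scl V) h" using h(1) by (simp add: linear_iff_module_hom)
  have neg: "h (X b (- 1 - int k) u) = Y b (- 1 - int k) (h u)" if "b < 2 * n" for b k u
    using cr[of "(b, k)" u] that by (simp add: X_cr I_def module_hom.scale[OF hom])
  \<comment> \<open>A nonnegative mode is moved past the creation modes down to the vacuum; the
    anticommutators with creation modes agree on both sides.\<close>
  have nonneg: "h (X b m u) = Y b m (h u)" if b: "b < 2 * n" and m: "m \<ge> 0" for b m u
  proof (induction u rule: V_induct)
    case (cr p u)
    let ?k = "- 1 - int (snd p)"
    have p: "fst p < 2 * n" using cr by (simp add: I_def)
    have "h (X b m (X (fst p) ?k u))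
        = (if fst p = partner n b \<and> m + ?k = 0 then sg n b * of_int m else 0) *s h u
          - Y (fst p) ?k (Y b m (h u))"
      by (simp add: X_swap[OF b p] module_hom.diff[OF hom] module_hom.scale[OF hom] neg[OF p] cr.IH)
    also have "\<dots> = Y b m (Y (fst p) ?k (h u))"
    proof -
      have "?k < 0" by simp
      then show ?thesis using anti[OF b p, of ?k m "h u"] by (metis add_diff_cancel_right')
    qed
    finally show ?case
      using b p by (simp add: cr_X X_linear lin module_hom.scale[OF hom] neg[OF p])
  qed (use b m in \<open>simp_all add: X_linear lin X_vac vac h(2) module_hom.zero[OF hom]
      module_hom.add[OF hom] module_hom.scale[OF hom]\<close>)
  have "h (X b m u) = Y b m (h u)" if b: "b < 2 * n" for b m u
  proof (cases "m \<ge> 0")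
    case False
    then have "m = - 1 - int (nat (- 1 - m))" by simp
    then show ?thesis using neg[OF b] by metis
  qed (use nonneg[OF b] in auto)
  then show ?thesis using h by blast
qed

section \<open>Coordinates in the monomial basis\<close>

definition coord :: "(nat \<times> nat) list \<Rightarrow> 'v \<Rightarrow> complex" where
  "coord w v = representation (mon ` W) v (mon w)"

lemma coord_linear: "coord w (u + v) = coord w u + coord w v" "coord w (t *s v) = t * coord w v" "coord w 0 = 0"
  "coord w (u - v) = coord w u - coord w v" "coord w (- v) = - coord w v"
  by (simp_all add: coord_def mon_independent mon_span representation_add representation_scale
      representation_zero representation_diff representation_neg)

lemma coord_sum: "coord w (\<Sum>i\<in>A. G i) = (\<Sum>i\<in>A. coord w (G i))"
  by (induction A rule: infinite_finite_induct) (simp_all add: coord_linear)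

lemma coord_mon: "w \<in> W \<Longrightarrow> w' \<in> W \<Longrightarrow> coord w (mon w') = (if w = w' then 1 else 0)"
  using inj_onD[OF mon_inj, of w w'] by (auto simp: coord_def representation_basis mon_independent)

lemma coord_eq_0: "(\<And>w. w \<in> W \<Longrightarrow> coord w v = 0) \<Longrightarrow> v = 0"
proof -
  assume *: "\<And>w. w \<in> W \<Longrightarrow> coord w v = 0"
  have "representation (mon ` W) v b = 0" for b
    using * representation_ne_zero[of "mon ` W" v b] by (auto simp: coord_def)
  then show "v = 0"
    using sum_nonzero_representation_eq[OF mon_independent, of v] by (simp add: mon_span)
qed

lemma cr_mon: "p \<in> I \<Longrightarrow> w \<in> W \<Longrightarrow> cr p (mon w) = (if p \<in> set w then 0 else isg p w *s mon (ins p w))"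
proof (cases "p \<in> set w")
  case True
  assume "p \<in> I" "w \<in> W"
  moreover have "cr p (foldr cr w (vac V)) = 0"
    by (rule foldr_repeat) (use True \<open>w \<in> W\<close> in \<open>auto simp: cr_linear W_def intro: cr_cr\<close>)
  ultimately show ?thesis using True by (simp add: mon_def)
next
  case False
  assume "p \<in> I" "w \<in> W"
  have "cr p (foldr cr w (vac V)) = isg p w *s foldr cr (ins p w) (vac V)"
    by (rule foldr_ins) (use \<open>p \<in> I\<close> \<open>w \<in> W\<close> in \<open>auto simp: cr_linear W_def intro: cr_cr\<close>)
  then show ?thesis using False by (simp add: mon_def)
qed

lemma ins_W: "p \<in> I \<Longrightarrow> w \<in> W \<Longrightarrow> p \<notin> set w \<Longrightarrow> ins p w \<in> W"
  by (auto simp: W_def set_ins sorted_ins)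

lemma filter_W: "w \<in> W \<Longrightarrow> filter P w \<in> W"
  by (auto simp: W_def sorted_wrt_filter)

lemma an_foldr: "p \<in> I \<Longrightarrow> set w \<subseteq> I \<Longrightarrow> p \<notin> set w \<Longrightarrow> an p (foldr cr w (vac V)) = 0"
  by (induction w) (auto simp: an_vac an_cr cr_linear)

lemma an_mon:
  assumes "p \<in> I" "w \<in> W"
  shows "an p (mon w) = (if p \<in> set w then isg p (filter (\<lambda>q. q \<noteq> p) w) *s mon (filter (\<lambda>q. q \<noteq> p) w) else 0)"
proof (cases "p \<in> set w")
  case True
  let ?w = "filter (\<lambda>q. q \<noteq> p) w"
  have "ins p ?w = w" using assms True by (simp add: W_def ins_filter)
  then have "cr p (mon ?w) = isg p ?w *s mon w"
    using cr_mon[OF assms(1) filter_W[OF assms(2)], of "\<lambda>q. q \<noteq> p"] by simp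
  then have "isg p ?w *s cr p (mon ?w) = mon w" by (simp add: isg_sq)
  moreover have "an p (mon ?w) = 0"
    unfolding mon_def by (rule an_foldr) (use assms in \<open>auto simp: W_def\<close>)
  ultimately have "an p (mon w) = isg p ?w *s mon ?w"
    using assms(1) by (auto simp: an_linear an_cr cr_linear dest!: sym[of _ "mon w"])
  then show ?thesis using True by simp
next
  case False
  then show ?thesis using an_foldr[of p w] assms by (auto simp: mon_def W_def)
qed

lemma coord_cr:
  assumes p: "p \<in> I" and w: "w \<in> W"
  shows "coord w (cr p v) = (if p \<in> set w
    then isg p (filter (\<lambda>q. q \<noteq> p) w) * coord (filter (\<lambda>q. q \<noteq> p) w) v else 0)"
proof (induction v rule: V_basis_induct)
  case (mon w')
  show ?case
  proof (cases "p \<in> set w'")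
    case True
    then have "filter (\<lambda>q. q \<noteq> p) w \<noteq> w'" by auto
    then show ?thesis using True mon p w by (simp add: cr_mon coord_linear coord_mon filter_W)
  next
    case False
    have "w = ins p w' \<longleftrightarrow> p \<in> set w \<and> filter (\<lambda>q. q \<noteq> p) w = w'"
      using False filter_ins[of p w'] ins_filter[of w p] w by (auto simp: set_ins W_def)
    then show ?thesis using False mon p w by (auto simp: cr_mon coord_linear coord_mon filter_W ins_W)
  qed
qed (auto simp: cr_linear coord_linear distrib_left)

lemma coord_an:
  assumes p: "p \<in> I" and w: "w \<in> W"
  shows "coord w (an p v) = (if p \<in> set w then 0 else isg p w * coord (ins p w) v)"
proof (induction v rule: V_basis_induct)
  case (mon w')
  show ?case
  proof (cases "p \<in> set w'")
    case True
    have "p \<notin> set w \<Longrightarrow> ins p w = w' \<longleftrightarrow> w = filter (\<lambda>q. q \<noteq> p) w'"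
      using True filter_ins[of p w] ins_filter[of w' p] mon by (auto simp: W_def)
    then show ?thesis using True mon p w by (auto simp: an_mon coord_linear coord_mon filter_W ins_W)
  next
    case False
    then have "ins p w \<noteq> w'" by (auto simp: set_ins)
    then show ?thesis using False mon p w by (simp add: an_mon coord_linear coord_mon ins_W)
  qed
qed (auto simp: an_linear coord_linear distrib_left)

section \<open>Hermitian form and filtration\<close>

definition I_below :: "nat \<Rightarrow> (nat \<times> nat) set" where
  "I_below K = {..<2 * n} \<times> {..<K}"

definition W_below :: "nat \<Rightarrow> (nat \<times> nat) list set" where
  "W_below K = {w \<in> W. set w \<subseteq> I_below K}"

lemma I_below_I: "p \<in> I_below K \<Longrightarrow> p \<in> I"
  by (auto simp: I_below_def I_def)

lemma W_distinct: "w \<in> W \<Longrightarrow> distinct w"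
proof -
  assume "w \<in> W"
  then have "sorted_wrt flt w" by (simp add: W_def)
  then show ?thesis by (induction w) (use flt_irrefl in auto)
qed

lemma finite_W_below: "finite (W_below K)"
proof -
  have "finite {w. set w \<subseteq> I_below K \<and> distinct w}"
    by (rule finite_subset_distinct) (simp add: I_below_def)
  then show ?thesis by (rule finite_subset[rotated]) (auto simp: W_below_def W_distinct)
qed

text \<open>The monomials with fewer than \<open>K\<close> derivatives on each letter are
  orthonormal. The cut-off makes the sum finite; the price is that the form sees nothing outside
  these monomials, so definiteness is claimed only on \<open>filt K d\<close>.\<close>

definition herm :: "nat \<Rightarrow> 'v \<Rightarrow> 'v \<Rightarrow> complex" where
  "herm K u v = (\<Sum>w\<in>W_below K. cnj (coord w u) * coord w v)"

lemma herm_linear: "herm K u (v + v') = herm K u v + herm K u v'" "herm K u (t *s v) = t * herm K u v" "herm K u 0 = 0"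
  "herm K u (v - v') = herm K u v - herm K u v'" "herm K u (- v) = - herm K u v"
  by (simp_all add: herm_def coord_linear distrib_left sum.distrib sum_distrib_left right_diff_distrib
      sum_subtractf sum_negf mult_ac)

lemma herm_left: "herm K (u + u') v = herm K u v + herm K u' v" "herm K (t *s u) v = cnj t * herm K u v" "herm K 0 v = 0"
  "herm K (u - u') v = herm K u v - herm K u' v"
  by (simp_all add: herm_def coord_linear distrib_right sum.distrib sum_distrib_left left_diff_distrib
      sum_subtractf mult.assoc)

lemma herm_sum: "herm K u (\<Sum>i\<in>A. G i) = (\<Sum>i\<in>A. herm K u (G i))"
  by (induction A rule: infinite_finite_induct) (simp_all add: herm_linear)

lemma herm_cnj: "herm K v u = cnj (herm K u v)"
  by (simp add: herm_def mult.commute)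

lemma herm_self: "herm K v v = of_real (\<Sum>w\<in>W_below K. (cmod (coord w v))\<^sup>2)"
  unfolding herm_def of_real_sum
  by (rule sum.cong[OF refl], subst mult.commute) (rule complex_norm_square[symmetric])

text \<open>Inserting and removing \<open>p\<close> are inverse bijections between the words without
  and with \<open>p\<close>, and both operators carry the same real sign.\<close>

lemma herm_cr:
  assumes p: "p \<in> I_below K"
  shows "herm K (cr p u) v = herm K u (an p v)"
proof -
  have pI: "p \<in> I" using p by (rule I_below_I)
  let ?A = "{w \<in> W_below K. p \<in> set w}" and ?B = "{w \<in> W_below K. p \<notin> set w}" and ?f = "filter (\<lambda>q. q \<noteq> p)"
  have "herm K (cr p u) v = (\<Sum>w\<in>?A. cnj (isg p (?f w) * coord (?f w) u) * coord w v)"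
    unfolding herm_def by (rule sum.mono_neutral_cong_right) (use finite_W_below in \<open>auto simp: W_below_def coord_cr pI\<close>)
  also have "\<dots> = (\<Sum>w\<in>?B. cnj (coord w u) * (isg p w * coord (ins p w) v))"
  proof (rule sum.reindex_bij_witness[of _ "ins p" ?f])
    fix w assume "w \<in> ?A"
    then have *: "w \<in> W" "p \<in> set w" "set w \<subseteq> I_below K" by (auto simp: W_below_def)
    show "ins p (?f w) = w" using * by (simp add: ins_filter W_def)
    show "?f w \<in> ?B" using * by (auto simp: W_below_def filter_W)
    show "cnj (coord (?f w) u) * (isg p (?f w) * coord (ins p (?f w)) v)
        = cnj (isg p (?f w) * coord (?f w) u) * coord w v"
      using \<open>ins p (?f w) = w\<close> by (simp add: isg_real mult_ac)
  next
    fix w assume "w \<in> ?B"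
    then have *: "w \<in> W" "p \<notin> set w" "set w \<subseteq> I_below K" by (auto simp: W_below_def)
    show "?f (ins p w) = w" using * by (simp add: filter_ins)
    show "ins p w \<in> ?A" using * p by (auto simp: W_below_def set_ins ins_W pI)
  qed
  also have "\<dots> = herm K u (an p v)"
    unfolding herm_def by (rule sum.mono_neutral_cong_left) (use finite_W_below in \<open>auto simp: W_below_def coord_an pI\<close>)
  finally show ?thesis .
qed

lemma herm_an: "p \<in> I_below K \<Longrightarrow> herm K (an p u) v = herm K u (cr p v)"
  using herm_cr[of p K v u] by (metis herm_cnj complex_cnj_cnj)

text \<open>Exterior degree at most \<open>d\<close>: a finite-dimensional space on which
  \<open>herm K\<close> is definite.\<close>

definition filt :: "nat \<Rightarrow> nat \<Rightarrow> 'v set" where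
  "filt K d = span (mon ` {w \<in> W_below K. length w \<le> d})"

lemma filt_subspace: "subspace (filt K d)"
  by (simp add: filt_def)

lemma filt_mono: "K \<le> K' \<Longrightarrow> d \<le> d' \<Longrightarrow> filt K d \<subseteq> filt K' d'"
  unfolding filt_def by (intro span_mono image_mono) (auto simp: W_below_def I_below_def)

lemma filt_induct [consumes 1, case_names add scale mon]:
  assumes "v \<in> filt K d"
    and "\<And>u v. Q u \<Longrightarrow> Q v \<Longrightarrow> Q (u + v)" "\<And>t v. Q v \<Longrightarrow> Q (t *s v)"
    and "\<And>w. w \<in> W_below K \<Longrightarrow> length w \<le> d \<Longrightarrow> Q (mon w)"
  shows "Q v"
proof -
  have "[] \<in> W_below K" by (simp add: W_def W_below_def)
  then have "subspace {v. Q v}"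
    using assms(2,3) assms(3)[OF assms(4), of "[]" 0] by (auto simp: subspace_def)
  then have "filt K d \<subseteq> {v. Q v}" unfolding filt_def using assms(4) by (intro span_minimal) auto
  then show ?thesis using assms(1) by auto
qed

lemma length_ins: "length (ins p w) = Suc (length w)"
  by (induction w) auto

lemma filt_mon: "w \<in> W_below K \<Longrightarrow> length w \<le> d \<Longrightarrow> mon w \<in> filt K d"
  unfolding filt_def by (rule span_base) auto

lemma filt_closed: "u \<in> filt K d \<Longrightarrow> v \<in> filt K d \<Longrightarrow> u + v \<in> filt K d" "v \<in> filt K d \<Longrightarrow> t *s v \<in> filt K d" "0 \<in> filt K d"
  by (simp_all add: filt_def span_add span_scale span_zero)

lemma filt_sum: "(\<And>i. i \<in> A \<Longrightarrow> G i \<in> filt K d) \<Longrightarrow> (\<Sum>i\<in>A. G i) \<in> filt K d"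
  by (simp add: filt_def span_sum)

lemma filt_cr: "v \<in> filt K d \<Longrightarrow> p \<in> I_below K \<Longrightarrow> cr p v \<in> filt K (Suc d)"
proof (induction rule: filt_induct)
  case (mon w)
  then have "p \<notin> set w \<Longrightarrow> ins p w \<in> W_below K" by (auto simp: W_below_def set_ins ins_W I_below_I)
  then show ?case using mon by (auto simp: cr_mon I_below_I W_below_def filt_closed length_ins intro!: filt_closed filt_mon)
qed (simp_all add: cr_linear filt_closed)

lemma filt_an: "v \<in> filt K (Suc d) \<Longrightarrow> p \<in> I \<Longrightarrow> an p v \<in> filt K d"
proof (induction rule: filt_induct)
  case (mon w)
  then have "p \<in> set w \<Longrightarrow> length (filter (\<lambda>q. q \<noteq> p) w) < length w" by (auto intro: length_filter_less)
  moreover have "filter (\<lambda>q. q \<noteq> p) w \<in> W_below K" using mon by (auto simp: W_below_def filter_W)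
  ultimately show ?case using mon
    by (auto simp: an_mon W_below_def filt_closed intro!: filt_closed(2) filt_mon)
qed (simp_all add: an_linear filt_closed)

lemma filt_0: "v \<in> filt K 0 \<Longrightarrow> p \<in> I \<Longrightarrow> an p v = 0"
  by (induction rule: filt_induct) (auto simp: an_linear an_vac mon_def)

lemma filt_exhaust: "\<exists>K d. v \<in> filt K d"
proof (induction v rule: V_induct)
  case (add u v)
  then obtain K d K' d' where "u \<in> filt K d" "v \<in> filt K' d'" by blast
  then have "u \<in> filt (max K K') (max d d')" "v \<in> filt (max K K') (max d d')"
    using filt_mono[of K "max K K'" d "max d d'"] filt_mono[of K' "max K K'" d' "max d d'"] by auto
  then show ?case using filt_closed by blast
next
  case (scale t v)
  then show ?case using filt_closed by blast
next
  case vac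
  show ?case using filt_mon[of "[]" 0 0] by (auto simp: mon_def W_below_def W_def)
next
  case (cr p v)
  then obtain K d where "v \<in> filt K d" by blast
  then have "v \<in> filt (max K (Suc (snd p))) d" using filt_mono[of K "max K (Suc (snd p))" d d] by auto
  moreover have "p \<in> I_below (max K (Suc (snd p)))" using cr by (cases p) (auto simp: I_def I_below_def)
  ultimately show ?case using filt_cr by blast
qed

lemma filt_coord: "v \<in> filt K d \<Longrightarrow> w \<in> W \<Longrightarrow> w \<notin> W_below K \<Longrightarrow> coord w v = 0"
  by (induction rule: filt_induct) (auto simp: coord_linear coord_mon W_below_def)

lemma herm_definite:
  assumes "v \<in> filt K d" "herm K v v = 0"
  shows "v = 0"
proof (rule coord_eq_0)
  fix w assume "w \<in> W"
  have "(\<Sum>w\<in>W_below K. (cmod (coord w v))\<^sup>2) = 0" using assms(2) unfolding herm_self of_real_eq_0_iff .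
  then have "\<forall>w\<in>W_below K. (cmod (coord w v))\<^sup>2 = 0"
    by (subst (asm) sum_nonneg_eq_0_iff) (auto simp: finite_W_below)
  then show "coord w v = 0" using filt_coord[OF assms(1) \<open>w \<in> W\<close>] by (cases "w \<in> W_below K") auto
qed

text \<open>Gram-Schmidt: the new vector \<open>x\<close> is replaced by its component
  \<open>x'\<close> orthogonal to the span of the previous ones, so correcting by a multiple of
  \<open>x'\<close> keeps the orthogonality already achieved.\<close>

lemma herm_projection:
  assumes "finite B" "B \<subseteq> filt K d" "v \<in> filt K d"
  shows "\<exists>z\<in>span B. \<forall>b\<in>span B. herm K b (v - z) = 0"
proof -
  have orth: "herm K b u = 0" if "\<And>b. b \<in> B \<Longrightarrow> herm K b u = 0" "b \<in> span B" for b u B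
  proof -
    have "subspace {b. herm K b u = 0}"
      by (auto simp: subspace_def herm_left)
    then have "span B \<subseteq> {b. herm K b u = 0}" using that by (intro span_minimal) auto
    then show ?thesis using that by auto
  qed
  from assms have "\<exists>z\<in>span B. \<forall>b\<in>B. herm K b (v - z) = 0"
  proof (induction B arbitrary: v rule: finite_induct)
    case (insert x B)
    obtain z where z: "z \<in> span B" "\<forall>b\<in>B. herm K b (v - z) = 0"
      using insert.IH[of v] insert.prems by blast
    obtain y where y: "y \<in> span B" "\<forall>b\<in>B. herm K b (x - y) = 0"
      using insert.IH[of x] insert.prems by blast
    define x' where "x' = x - y"
    have sB: "span B \<subseteq> filt K d" using insert.prems filt_subspace by (intro span_minimal) auto
    then have x'F: "x' \<in> filt K d" using insert.prems y(1) filt_subspace subspace_diff x'_def by blast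
    have sp: "span B \<subseteq> span (insert x B)" by (intro span_mono) auto
    have x'S: "x' \<in> span (insert x B)"
      unfolding x'_def using sp y(1) by (intro span_diff) (auto intro: span_base)
    \<comment> \<open>If \<open>x'\<close> has norm 0, then \<open>x' = 0\<close> by definiteness,
      and the equation for \<open>t\<close> holds trivially.\<close>
    define t where "t = herm K x' (v - z) / herm K x' x'"
    have t: "herm K x' (v - z) = t * herm K x' x'"
      using herm_definite[OF x'F] by (cases "herm K x' x' = 0") (auto simp: t_def herm_left)
    have 1: "herm K x' (v - (z + t *s x')) = 0" using t by (simp add: herm_linear algebra_simps)
    have 2: "herm K b (v - (z + t *s x')) = 0" if "b \<in> B" for b
      using z(2) y(2) that by (simp add: herm_linear x'_def)
    have "herm K y (v - (z + t *s x')) = 0" using orth[OF 2 y(1)] by simp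
    then have "herm K x (v - (z + t *s x')) = 0"
      using 1 by (simp only: x'_def herm_left diff_0_right)
    moreover have "z + t *s x' \<in> span (insert x B)" using x'S sp z(1) by (auto intro: span_add span_scale)
    ultimately show ?case using 2 by auto
  qed (auto intro: bexI[of _ 0])
  then show ?thesis using orth by blast
qed

end

section \<open>Invariants of the symplectic Lie algebra\<close>

lemma sum_rotate: "(\<Sum>b\<in>B. \<Sum>k\<in>C. \<Sum>l\<in>E. g b k l) = (\<Sum>k\<in>C. \<Sum>l\<in>E. \<Sum>b\<in>B. g b k l)"
  by (subst sum.swap) (intro sum.cong refl sum.swap)

context symplectic_fermion_algebra
begin

definition quad :: "nat \<Rightarrow> nat \<Rightarrow> 'v \<Rightarrow> 'v" where
  "quad k l v = (\<Sum>a<2 * n. sg n a *s cr (a, k) (cr (partner n a, l) v))"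

definition quad_adj :: "nat \<Rightarrow> nat \<Rightarrow> 'v \<Rightarrow> 'v" where
  "quad_adj k l v = (\<Sum>a<2 * n. sg n a *s an (a, k) (an (partner n a, l) v))"

text \<open>The matrix unit of the general linear Lie algebra acting as a derivation, restricted to
  letters with fewer than \<open>K\<close> derivatives.\<close>

definition gl :: "nat \<Rightarrow> nat \<Rightarrow> nat \<Rightarrow> 'v \<Rightarrow> 'v" where
  "gl K a b v = (\<Sum>k<K. cr (a, k) (an (b, k) v))"

lemma quad_linear: "quad k l (u + v) = quad k l u + quad k l v" "quad k l (t *s v) = t *s quad k l v" "quad k l 0 = 0"
  by (simp_all add: quad_def cr_linear scale_right_distrib sum.distrib scale_sum_right mult.commute)

lemma quad_sum: "quad k l (\<Sum>i\<in>A. G i) = (\<Sum>i\<in>A. quad k l (G i))"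
  by (induction A rule: infinite_finite_induct) (simp_all add: quad_linear)

text \<open>Taking adjoints reverses the order of the two operators; restoring it by anticommutation
  gives the sign.\<close>

lemma herm_quad:
  assumes "k < K" "l < K"
  shows "herm K (quad k l u) v = - herm K u (quad_adj k l v)"
proof -
  have hs: "herm K (\<Sum>a\<in>A. G a) v = (\<Sum>a\<in>A. herm K (G a) v)" for A :: "nat set" and G
    by (induction A rule: infinite_finite_induct) (simp_all add: herm_left)
  have "herm K (sg n a *s cr (a, k) (cr (partner n a, l) u)) v
      = - herm K u (sg n a *s an (a, k) (an (partner n a, l) v))" if "a < 2 * n" for a
  proof -
    have "(a, k) \<in> I_below K" "(partner n a, l) \<in> I_below K" using that assms by (auto simp: I_below_def partner_less)
    moreover have "an (partner n a, l) (an (a, k) v) = - an (a, k) (an (partner n a, l) v)"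
      using calculation by (intro an_an I_below_I)
    moreover have "cnj (sg n a) = sg n a" by (simp add: sg_def)
    ultimately show ?thesis by (simp add: herm_cr herm_left herm_linear)
  qed
  then show ?thesis by (simp add: quad_def quad_adj_def hs herm_sum sum_negf)
qed

lemma herm_gl:
  assumes "a < 2 * n" "b < 2 * n"
  shows "herm K (gl K a b u) v = herm K u (gl K b a v)"
proof -
  have hs: "herm K (\<Sum>a\<in>A. G a) v = (\<Sum>a\<in>A. herm K (G a) v)" for A :: "nat set" and G
    by (induction A rule: infinite_finite_induct) (simp_all add: herm_left)
  have "herm K (cr (a, k) (an (b, k) u)) v = herm K u (cr (b, k) (an (a, k) v))" if "k < K" for k
    using that assms by (simp add: herm_cr herm_an I_below_def)
  then show ?thesis by (simp add: gl_def hs herm_sum)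
qed

text \<open>The quadratic Casimir of \<open>gl\<^sub>2\<^sub>n\<close>, with one factor transposed by the symplectic form.\<close>

lemma gl_twisted_casimir:
  "(\<Sum>a<2 * n. \<Sum>b<2 * n. (sg n a * sg n b) *s gl K b a (gl K (partner n b) (partner n a) v))
   = - (\<Sum>b<2 * n. gl K b b v) - (\<Sum>k<K. \<Sum>l<K. quad k l (quad_adj k l v))"
proof -
  \<comment> \<open>Normal ordering: the anticommutator contributes the degree operator, and in the
    remaining quartic term the sums over \<open>a\<close> and \<open>b\<close> separate into
    \<open>quad\<close> and \<open>quad_adj\<close>.\<close>
  have gl_an: "gl K b a (gl K (partner n b) (partner n a) v)
      = (if a = partner n b then gl K b b v else 0)
      - (\<Sum>k<K. \<Sum>l<K. cr (b, k) (cr (partner n b, l) (an (a, k) (an (partner n a, l) v))))"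
    if "a < 2 * n" "b < 2 * n" for a b
  proof -
    have "gl K b a (gl K (partner n b) (partner n a) v)
      = (\<Sum>k<K. \<Sum>l<K. cr (b, k) (an (a, k) (cr (partner n b, l) (an (partner n a, l) v))))"
      by (simp add: gl_def an_linear cr_linear)
    also have "\<dots> = (\<Sum>k<K. \<Sum>l<K. (if l = k then (if a = partner n b then cr (b, k) (an (b, k) v) else 0) else 0)
        - cr (b, k) (cr (partner n b, l) (an (a, k) (an (partner n a, l) v))))"
    proof (intro sum.cong refl)
      fix k l
      have "(a, k) \<in> I" "(partner n b, l) \<in> I" using that by (auto simp: I_def partner_less)
      then show "cr (b, k) (an (a, k) (cr (partner n b, l) (an (partner n a, l) v)))
        = (if l = k then (if a = partner n b then cr (b, k) (an (b, k) v) else 0) else 0)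
        - cr (b, k) (cr (partner n b, l) (an (a, k) (an (partner n a, l) v)))"
        using that by (auto simp: an_cr cr_linear partner_partner)
    qed
    finally show ?thesis by (simp add: sum_subtractf gl_def)
  qed
  have "(\<Sum>a<2 * n. \<Sum>b<2 * n. (sg n a * sg n b) *s gl K b a (gl K (partner n b) (partner n a) v))
    = (\<Sum>b<2 * n. \<Sum>a<2 * n. (if a = partner n b then (sg n a * sg n b) *s gl K b b v else 0))
    - (\<Sum>a<2 * n. \<Sum>b<2 * n. \<Sum>k<K. \<Sum>l<K. (sg n a * sg n b) *s
        cr (b, k) (cr (partner n b, l) (an (a, k) (an (partner n a, l) v))))"
    unfolding sum.swap[of _ "{..<2 * n}" "{..<2 * n}" , where g = "\<lambda>b a. if a = partner n b then (sg n a * sg n b) *s gl K b b v else 0"]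
      sum_subtractf[symmetric]
    by (intro sum.cong refl) (auto simp: gl_an scale_right_diff_distrib scale_sum_right)
  also have "(\<Sum>b<2 * n. \<Sum>a<2 * n. (if a = partner n b then (sg n a * sg n b) *s gl K b b v else 0))
      = - (\<Sum>b<2 * n. gl K b b v)"
    unfolding sum_negf[symmetric]
    by (rule sum.cong[OF refl]) (simp add: partner_less sg_partner sg_sq)
  also have "(\<Sum>a<2 * n. \<Sum>b<2 * n. \<Sum>k<K. \<Sum>l<K. (sg n a * sg n b) *s
        cr (b, k) (cr (partner n b, l) (an (a, k) (an (partner n a, l) v))))
     = (\<Sum>k<K. \<Sum>l<K. \<Sum>b<2 * n. \<Sum>a<2 * n. (sg n a * sg n b) *s
        cr (b, k) (cr (partner n b, l) (an (a, k) (an (partner n a, l) v))))"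
    by (subst sum.swap) (simp only: sum_rotate[where B = "{..<2 * n}"])
  also have "\<dots> = (\<Sum>k<K. \<Sum>l<K. quad k l (quad_adj k l v))"
    by (simp add: quad_def quad_adj_def cr_linear scale_sum_right mult.commute)
  finally show ?thesis by simp
qed

text \<open>Matrix units minus their symplectic transposes span the symplectic Lie algebra, so this
  says that the Lie algebra kills \<open>v\<close>. The operators \<open>gl K\<close> represent the
  action only on vectors built from modes below \<open>K\<close>, whence the condition
  \<open>v \<in> filt K d\<close>.\<close>

definition sp_killed :: "'v \<Rightarrow> bool" where
  "sp_killed v \<longleftrightarrow> (\<forall>K d. v \<in> filt K d \<longrightarrow> (\<forall>a<2 * n. \<forall>b<2 * n.
     gl K a b v = (sg n a * sg n b) *s gl K (partner n b) (partner n a) v))"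

text \<open>On a harmonic invariant the twisted Casimir is both a sum of squares and minus the
  degree, so the degree vanishes.\<close>

lemma harmonic_invariant:
  assumes v: "v \<in> filt K d" and inv: "sp_killed v" and harm: "\<And>k l. k < K \<Longrightarrow> l < K \<Longrightarrow> quad_adj k l v = 0"
  shows "\<exists>t. v = t *s vac V"
proof -
  have "(\<Sum>a<2 * n. \<Sum>b<2 * n. herm K (gl K a b v) (gl K a b v))
      = herm K v (\<Sum>a<2 * n. \<Sum>b<2 * n. gl K b a (gl K a b v))"
    by (simp add: herm_sum herm_gl)
  also have "(\<Sum>a<2 * n. \<Sum>b<2 * n. gl K b a (gl K a b v))
      = (\<Sum>a<2 * n. \<Sum>b<2 * n. (sg n a * sg n b) *s gl K b a (gl K (partner n b) (partner n a) v))"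
  proof (intro sum.cong refl)
    fix a b assume ab: "a \<in> {..<2 * n}" "b \<in> {..<2 * n}"
    have "gl K b a (t *s u) = t *s gl K b a u" for t u
      by (simp add: gl_def cr_linear an_linear scale_sum_right)
    moreover have "gl K a b v = (sg n a * sg n b) *s gl K (partner n b) (partner n a) v"
      using inv v ab by (auto simp: sp_killed_def)
    ultimately show "gl K b a (gl K a b v) = (sg n a * sg n b) *s gl K b a (gl K (partner n b) (partner n a) v)"
      by metis
  qed
  also have "\<dots> = - (\<Sum>b<2 * n. gl K b b v)"
    by (simp add: gl_twisted_casimir harm quad_linear)
  also have "herm K v (- (\<Sum>b<2 * n. gl K b b v)) = - (\<Sum>b<2 * n. \<Sum>k<K. herm K (an (b, k) v) (an (b, k) v))"
    by (simp add: herm_linear herm_sum gl_def herm_an I_below_def)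
  finally have eq: "(\<Sum>a<2 * n. \<Sum>b<2 * n. herm K (gl K a b v) (gl K a b v))
      + (\<Sum>b<2 * n. \<Sum>k<K. herm K (an (b, k) v) (an (b, k) v)) = 0" by simp
  define nrm where "nrm u = (\<Sum>w\<in>W_below K. (cmod (coord w u))\<^sup>2)" for u
  have nrm: "herm K u u = of_real (nrm u)" "nrm u \<ge> 0" for u
    by (simp_all add: nrm_def herm_self sum_nonneg)
  have "(\<Sum>a<2 * n. \<Sum>b<2 * n. nrm (gl K a b v)) + (\<Sum>b<2 * n. \<Sum>k<K. nrm (an (b, k) v)) = 0"
    using eq unfolding nrm(1) by (simp only: of_real_sum[symmetric] of_real_add[symmetric] of_real_eq_0_iff)
  moreover have "(\<Sum>a<2 * n. \<Sum>b<2 * n. nrm (gl K a b v)) \<ge> 0" "(\<Sum>b<2 * n. \<Sum>k<K. nrm (an (b, k) v)) \<ge> 0"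
    by (intro sum_nonneg nrm)+
  ultimately have "(\<Sum>b<2 * n. \<Sum>k<K. nrm (an (b, k) v)) = 0" by linarith
  then have "\<forall>b<2 * n. \<forall>k<K. nrm (an (b, k) v) = 0"
    by (simp add: sum_nonneg_eq_0_iff sum_nonneg nrm)
  then have an0: "an p v = 0" if "p \<in> I_below K" for p
  proof -
    have "an p v \<in> filt K d"
      using filt_an[of v K d p] filt_mono[of K K d "Suc d"] v I_below_I[OF that] by auto
    moreover have "herm K (an p v) (an p v) = 0"
      using that \<open>\<forall>b<2 * n. _\<close> by (cases p) (auto simp: nrm I_below_def)
    ultimately show ?thesis by (rule herm_definite)
  qed
  \<comment> \<open>By \<open>coord_an\<close>, the coordinate of \<open>v\<close> at a nonempty
    word with first letter \<open>p\<close> is a coordinate of \<open>an p v\<close>; so only the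
    vacuum coordinate remains.\<close>
  have "v - coord [] v *s vac V = 0"
  proof (rule coord_eq_0)
    fix w assume w: "w \<in> W"
    have W0: "[] \<in> W" "vac V = mon []" by (simp_all add: W_def mon_def)
    show "coord w (v - coord [] v *s vac V) = 0"
    proof (cases w)
      case Nil
      then show ?thesis using W0 by (simp add: coord_linear coord_mon)
    next
      case (Cons p w')
      have "coord w v = 0"
      proof (cases "w \<in> W_below K")
        case True
        have pw: "p \<in> I_below K" "w' \<in> W" "p \<notin> set w'" "ins p w' = w" "isg p w' = 1"
          using True w Cons ins_Cons[of w' p] W_distinct[OF w] by (auto simp: W_below_def W_def)
        then show ?thesis using coord_an[OF I_below_I[OF pw(1)] pw(2), of v] an0[OF pw(1)] by (simp add: coord_linear)
      qed (use filt_coord[OF v w] in auto)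
      then show ?thesis using W0 w Cons by (simp add: coord_linear coord_mon)
    qed
  qed
  then show ?thesis by auto
qed

definition qword :: "(nat \<times> nat) list \<Rightarrow> 'v" where
  "qword ws = foldr (\<lambda>(k, l). quad k l) ws (vac V)"

lemma filt_quad: "v \<in> filt K d \<Longrightarrow> k < K \<Longrightarrow> l < K \<Longrightarrow> quad k l v \<in> filt K (Suc (Suc d))"
  unfolding quad_def by (intro filt_sum filt_closed filt_cr) (auto simp: I_below_def partner_less)

lemma filt_quad_adj: "v \<in> filt K (Suc (Suc d)) \<Longrightarrow> quad_adj k l v \<in> filt K d"
  unfolding quad_adj_def by (intro filt_sum filt_closed filt_an[where d = d] filt_an[where d = "Suc d"])
    (auto simp: I_def partner_less)

text \<open>First fundamental theorem: \<open>quad_adj\<close> is, up to sign, adjoint to \<open>quad\<close>, so an invariant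
  orthogonal to the image of the operators \<open>quad\<close> on invariants is harmonic.\<close>

lemma invariants_spanned:
  assumes U: "subspace U" "vac V \<in> U"
    and closed: "\<And>k l v. v \<in> U \<Longrightarrow> quad k l v \<in> U" "\<And>k l v. v \<in> U \<Longrightarrow> quad_adj k l v \<in> U"
    and sp: "\<And>v. v \<in> U \<Longrightarrow> sp_killed v"
    and v: "v \<in> U"
  shows "v \<in> span (range qword)"
proof -
  let ?Q = "span (range qword)"
  have "vac V = qword []" by (simp add: qword_def)
  then have vacQ: "vac V \<in> ?Q" by (simp add: span_base)
  have qQ: "quad k l u \<in> ?Q" if "u \<in> ?Q" for k l u
  proof (rule linear_span_closed[OF quad_linear(1,2) _ that])
    fix s assume "s \<in> range qword"
    then obtain ws where "s = qword ws" by blast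
    then have "quad k l s = qword ((k, l) # ws)" by (simp add: qword_def)
    then show "quad k l s \<in> ?Q" by (simp add: span_base)
  qed
  have small: "u \<in> ?Q" if small: "u \<in> U" "u \<in> filt K d" "\<And>k l. k < K \<Longrightarrow> l < K \<Longrightarrow> quad_adj k l u = 0" for u K d
  proof -
    obtain t where "u = t *s vac V" using harmonic_invariant[OF small(2) sp[OF small(1)] small(3)] by blast
    then show ?thesis using vacQ by (simp add: span_scale)
  qed
  have main: "u \<in> U \<Longrightarrow> u \<in> filt K d \<Longrightarrow> u \<in> ?Q" for u K d
  proof (induction d arbitrary: u rule: less_induct)
    case (less d)
    show ?case
    proof (cases "d < 2")
      case True
      have "u \<in> filt K (Suc 0)" using less.prems(2) True filt_mono[of K K d 1] by auto
      then have "an p (an q u) = 0" if "p \<in> I" "q \<in> I" for p q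
        using filt_an[of u K 0 q] filt_0 that by auto
      then have "quad_adj k l u = 0" for k l
        unfolding quad_adj_def by (intro sum.neutral ballI) (simp add: I_def partner_less)
      then show ?thesis using small less.prems by blast
    next
      case False
      define d' where "d' = d - 2"
      have d: "d = Suc (Suc d')" using False by (simp add: d'_def)
      let ?S = "{quad k l w | k l w. k < K \<and> l < K \<and> w \<in> U \<inter> filt K d'}"
      let ?Z = "span ?S"
      have SZ: "?S \<subseteq> filt K d" using filt_quad d by blast
      then have ZF: "?Z \<subseteq> filt K d" by (intro span_minimal filt_subspace)
      \<comment> \<open>\<open>herm_projection\<close> asks for a finite set, which exists because
        \<open>filt K d\<close> has finite dimension.\<close>
      obtain B where B: "B \<subseteq> ?Z" "independent B" "?Z \<subseteq> span B"
        by (rule basis_exists[of ?Z])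
      have "finite B"
      proof (rule independent_span_bound[THEN conjunct1])
        show "finite (mon ` {w \<in> W_below K. length w \<le> d})" by (simp add: finite_W_below)
        show "B \<subseteq> span (mon ` {w \<in> W_below K. length w \<le> d})" using subset_trans[OF B(1) ZF] by (simp only: filt_def)
      qed (rule B(2))
      moreover have BF: "B \<subseteq> filt K d" using B(1) ZF by blast
      ultimately obtain z where z: "z \<in> span B" "\<And>b. b \<in> span B \<Longrightarrow> herm K b (u - z) = 0"
        using herm_projection[of B K d u] less.prems(2) by blast
      have spB: "span B = ?Z" using B(3) span_minimal[OF B(1) subspace_span] by (rule subset_antisym[rotated])
      have "?S \<subseteq> U" using closed(1) by blast
      then have "?Z \<subseteq> U" using U(1) by (rule span_minimal)
      then have zU: "z \<in> U" using z(1) spB by blast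
      have zF: "z \<in> filt K d" using z(1) spB ZF by blast
      let ?u = "u - z"
      have uU: "?u \<in> U" using U(1) less.prems(1) zU by (rule subspace_diff)
      have uF: "?u \<in> filt K d" using filt_subspace less.prems(2) zF by (rule subspace_diff)
      \<comment> \<open>\<open>quad k l (quad_adj k l ?u)\<close> lies in \<open>?S\<close> and is
        therefore orthogonal to \<open>?u\<close>; moving \<open>quad\<close> to the other side
        turns this into the norm of \<open>quad_adj k l ?u\<close>.\<close>
      have "quad_adj k l ?u = 0" if kl: "k < K" "l < K" for k l
      proof (rule herm_definite)
        show dF: "quad_adj k l ?u \<in> filt K d'" using uF filt_quad_adj d by simp
        have "quad k l (quad_adj k l ?u) \<in> ?S" using kl closed(2)[OF uU] dF by blast
        then have "herm K (quad k l (quad_adj k l ?u)) ?u = 0" by (intro z(2)) (simp add: spB span_base)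
        then show "herm K (quad_adj k l ?u) (quad_adj k l ?u) = 0" by (simp add: herm_quad kl)
      qed
      then have "?u \<in> ?Q" using small uU uF by blast
      moreover have "w \<in> ?Q" if "w \<in> U \<inter> filt K d'" for w
        using less.IH[of d' w] d that by simp
      then have "?S \<subseteq> ?Q" using qQ by blast
      then have "?Z \<subseteq> ?Q" by (intro span_minimal subspace_span)
      then have "z \<in> ?Q" using z(1) spB by blast
      ultimately have "?u + z \<in> ?Q" by (rule span_add)
      then show ?thesis by simp
    qed
  qed
  obtain K d where "v \<in> filt K d" using filt_exhaust by blast
  then show ?thesis using main v by blast
qed

end

section \<open>Symplectic automorphisms\<close>

lemma symp_form_dim: "symp_form n \<in> carrier_mat (2 * n) (2 * n)"
  unfolding symp_form_def mult_2 by (rule four_block_carrier_mat) auto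

lemma symp_form_index:
  "a < 2 * n \<Longrightarrow> b < 2 * n \<Longrightarrow> symp_form n $$ (a, b) = (if b = partner n a then sg n a else 0)"
  by (auto simp: symp_form_def partner_def sg_def)

lemma Sp_iff:
  assumes "M \<in> carrier_mat (2 * n) (2 * n)"
  shows "M \<in> Sp n \<longleftrightarrow> (\<forall>c<2 * n. \<forall>d<2 * n.
    (\<Sum>u<2 * n. sg n u * M $$ (u, c) * M $$ (partner n u, d)) = (if d = partner n c then sg n c else 0))"
proof -
  have entry: "(M\<^sup>T * symp_form n * M) $$ (c, d) = (\<Sum>u<2 * n. sg n u * M $$ (u, c) * M $$ (partner n u, d))"
    if "c < 2 * n" "d < 2 * n" for c d
  proof -
    have "(M\<^sup>T * symp_form n) $$ (c, u) = - sg n u * M $$ (partner n u, c)" if "u < 2 * n" for u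
    proof -
      have "(M\<^sup>T * symp_form n) $$ (c, u) = (\<Sum>s<2 * n. M $$ (s, c) * symp_form n $$ (s, u))"
        using assms symp_form_dim[of n] that \<open>c < 2 * n\<close>
        by (simp add: scalar_prod_def atLeast0LessThan)
      also have "\<dots> = (\<Sum>s<2 * n. if s = partner n u then - sg n u * M $$ (partner n u, c) else 0)"
        using that by (intro sum.cong refl) (auto simp: symp_form_index partner_partner sg_partner)
      finally show ?thesis using that by (simp add: partner_less)
    qed
    then have "(M\<^sup>T * symp_form n * M) $$ (c, d) = (\<Sum>u<2 * n. - sg n u * M $$ (partner n u, c) * M $$ (u, d))"
      using assms symp_form_dim[of n] that by (subst index_mult_mat) (auto simp: scalar_prod_def atLeast0LessThan)
    also have "\<dots> = (\<Sum>u<2 * n. sg n (partner n u) * M $$ (partner n u, c) * M $$ (partner n (partner n u), d))"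
      by (intro sum.cong refl) (simp add: sg_partner partner_partner)
    finally show ?thesis by (simp only: sum_partner[of "\<lambda>u. sg n u * M $$ (u, c) * M $$ (partner n u, d)"])
  qed
  have "M \<in> Sp n \<longleftrightarrow> (\<forall>c<2 * n. \<forall>d<2 * n. (M\<^sup>T * symp_form n * M) $$ (c, d) = symp_form n $$ (c, d))"
    (is "_ \<longleftrightarrow> ?R")
  proof -
    have "dim_row (M\<^sup>T * symp_form n * M) = 2 * n" "dim_col (M\<^sup>T * symp_form n * M) = 2 * n"
      using assms by auto
    then show ?thesis unfolding Sp_def mem_Collect_eq mat_eq_iff using assms symp_form_dim[of n] by auto
  qed
  then show ?thesis by (simp add: entry symp_form_index)
qed

text \<open>The defining equation contracts the row indices of \<open>M\<close>, whereas invariance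
  of \<open>B\<close> needs the column indices contracted. With \<open>J'\<close> the inverse of
  \<open>J\<close>, the equation says that \<open>A\<close>, the product of \<open>J'\<close>, the
  transpose of \<open>M\<close> and \<open>J\<close>, is a left inverse of \<open>M\<close>; for
  square matrices it is also a right inverse, which gives the transposed relation.\<close>

lemma Sp_transpose:
  assumes "M \<in> Sp n" "a < 2 * n" "c < 2 * n"
  shows "(\<Sum>b<2 * n. sg n b * M $$ (a, b) * M $$ (c, partner n b)) = (if c = partner n a then sg n a else 0)"
proof -
  let ?N = "2 * n"
  define J where "J = symp_form n"
  define J' where "J' = mat ?N ?N (\<lambda>(a, b). - J $$ (a, b))"
  have M: "M \<in> carrier_mat ?N ?N" "M\<^sup>T * J * M = J" using assms(1) by (simp_all add: Sp_def J_def)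
  have J: "J \<in> carrier_mat ?N ?N" "J' \<in> carrier_mat ?N ?N" using symp_form_dim by (auto simp: J_def J'_def)
  have Ji: "J $$ (i, j) = (if j = partner n i then sg n i else 0)" "J' $$ (i, j) = (if j = partner n i then - sg n i else 0)"
    if "i < ?N" "j < ?N" for i j using that by (simp_all add: J_def J'_def symp_form_index)
  have JJ: "J' * J = 1\<^sub>m ?N"
  proof (rule eq_matI)
    fix i j assume "i < dim_row (1\<^sub>m ?N :: complex mat)" "j < dim_col (1\<^sub>m ?N :: complex mat)"
    then have ij: "i < ?N" "j < ?N" by auto
    have "(J' * J) $$ (i, j) = (\<Sum>u<?N. J' $$ (i, u) * J $$ (u, j))"
      using ij J by (simp add: scalar_prod_def atLeast0LessThan)
    also have "\<dots> = (\<Sum>u<?N. if u = partner n i then (if i = j then 1 else 0) else 0)"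
      using ij by (intro sum.cong refl) (auto simp: Ji partner_partner sg_partner sg_sq)
    finally show "(J' * J) $$ (i, j) = 1\<^sub>m ?N $$ (i, j)" using ij by (simp add: partner_less)
  qed (use J in auto)
  then have JJ': "J * J' = 1\<^sub>m ?N" using J by (simp add: mat_mult_left_right_inverse[of J' ?N J])
  have Mt: "M\<^sup>T \<in> carrier_mat ?N ?N" using M(1) by simp
  note assoc = assoc_mult_mat[of _ ?N ?N _ ?N _ ?N]
  define A where "A = J' * (M\<^sup>T * J)"
  have A: "A \<in> carrier_mat ?N ?N" using J Mt by (simp add: A_def)
  have "A * M = J' * (M\<^sup>T * J * M)" unfolding A_def
    by (rule assoc) (use J Mt M(1) in auto)
  also have "\<dots> = 1\<^sub>m ?N" by (simp add: M(2) JJ)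
  finally have MA: "M * A = 1\<^sub>m ?N"
    using M(1) A by (simp add: mat_mult_left_right_inverse[of A ?N M])
  define E where "E = M * J' * M\<^sup>T"
  have E: "E \<in> carrier_mat ?N ?N" using J Mt M(1) by (simp add: E_def)
  have "E = E * (J * J')" using E by (simp add: JJ')
  also have "\<dots> = E * J * J'" by (rule assoc[symmetric]) (use E J in auto)
  also have "E * J = M * J' * (M\<^sup>T * J)" unfolding E_def by (rule assoc) (use M(1) Mt J in auto)
  also have "\<dots> = M * A" unfolding A_def by (rule assoc) (use M(1) Mt J in auto)
  also have "M * A * J' = J'" using MA J by simp
  finally have EJ: "E = J'" .
  have "(M * J') $$ (a, u) = sg n u * M $$ (a, partner n u)" if "u < ?N" for u
  proof -
    have "(M * J') $$ (a, u) = (\<Sum>s<?N. M $$ (a, s) * J' $$ (s, u))"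
      using M(1) J(2) that assms(2) by (simp add: scalar_prod_def atLeast0LessThan)
    also have "\<dots> = (\<Sum>s<?N. if s = partner n u then sg n u * M $$ (a, partner n u) else 0)"
      using that by (intro sum.cong refl) (auto simp: Ji partner_partner sg_partner)
    finally show ?thesis using that by (simp add: partner_less)
  qed
  then have "E $$ (a, c) = (\<Sum>u<?N. sg n u * M $$ (a, partner n u) * M $$ (c, u))"
    unfolding E_def using M(1) Mt J(2) assms(2,3)
    by (subst index_mult_mat) (auto simp: scalar_prod_def atLeast0LessThan)
  also have "\<dots> = (\<Sum>u<?N. - (sg n (partner n u) * M $$ (a, partner n u) * M $$ (c, partner n (partner n u))))"
    by (intro sum.cong refl) (simp add: sg_partner partner_partner)
  also have "\<dots> = - (\<Sum>u<?N. sg n u * M $$ (a, u) * M $$ (c, partner n u))"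
    by (simp only: sum_negf sum_partner[of "\<lambda>u. sg n u * M $$ (a, u) * M $$ (c, partner n u)"])
  finally show ?thesis using EJ assms(2,3) by (auto simp: Ji minus_equation_iff)
qed

context symplectic_fermion_algebra
begin

text \<open>One expression covers three cases: two creation modes give \<open>quad\<close>, two
  annihilation modes give \<open>quad_adj\<close>, and a mixed pair gives the derivations that occur
  in Wick products. Invariance need be proved only once.\<close>

definition B :: "int \<Rightarrow> int \<Rightarrow> 'v \<Rightarrow> 'v" where
  "B m k v = (\<Sum>a<2 * n. sg n a *s X a m (X (partner n a) k v))"

lemma B_linear: "B m k (u + v) = B m k u + B m k v" "B m k (t *s v) = t *s B m k v" "B m k 0 = 0"
  by (simp_all add: B_def X_linear scale_right_distrib sum.distrib scale_sum_right mult.commute)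

lemma B_sum: "B m k (\<Sum>i\<in>A. G i) = (\<Sum>i\<in>A. B m k (G i))"
  by (induction A rule: infinite_finite_induct) (simp_all add: B_linear)

lemma quad_B: "quad k l v = (fact k * fact l) *s B (- 1 - int k) (- 1 - int l) v"
  by (simp add: quad_def B_def cr_X X_linear scale_sum_right mult_ac)

lemma quad_adj_B: "quad_adj k l v = inverse (fact (Suc k) * fact (Suc l)) *s B (int k + 1) (int l + 1) v"
proof -
  have "quad_adj k l v = (\<Sum>a<2 * n. inverse (fact (Suc k) * fact (Suc l)) *s
      sg n (partner n a) *s X (partner n a) (int k + 1) (X (partner n (partner n a)) (int l + 1) v))"
    unfolding quad_adj_def
  proof (rule sum.cong[OF refl])
    fix a assume a: "a \<in> {..<2 * n}"
    have "sg n a * (sg n a * sg n a) = sg n a" by (simp add: sg_def)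
    then show "sg n a *s an (a, k) (an (partner n a, l) v) = inverse (fact (Suc k) * fact (Suc l)) *s
      sg n (partner n a) *s X (partner n a) (int k + 1) (X (partner n (partner n a)) (int l + 1) v)"
      using a by (simp add: an_def X_linear sg_partner divide_inverse mult_ac del: fact_Suc)
  qed
  then show ?thesis
    by (simp only: B_def scale_sum_right sum_partner[of "\<lambda>a. inverse (fact (Suc k) * fact (Suc l)) *s
      sg n a *s X a (int k + 1) (X (partner n a) (int l + 1) v)"])
qed

abbreviation "orb \<equiv> orbifold V (Sp_automorphisms V n e f)"

lemma hom_automorphism: "vertex_automorphism V g \<Longrightarrow> module_hom (scl V) (scl V) g"
  by (simp add: vertex_automorphism_def linear_iff_module_hom)

lemma Sp_automorphism_B:
  assumes "g \<in> Sp_automorphisms V n e f"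
  shows "g (B m k v) = B m k (g v)"
proof -
  obtain M where M: "M \<in> Sp n" "\<And>b. b < 2 * n \<Longrightarrow>
      g (sf_gen n e f b) = (\<Sum>a<2 * n. M $$ (a, b) *s sf_gen n e f a)"
    and aut: "vertex_automorphism V g"
    using assms by (auto simp: Sp_automorphisms_def)
  note hom = hom_automorphism[OF aut]
  have gX: "g (X b m u) = (\<Sum>a<2 * n. M $$ (a, b) *s X a m (g u))" if "b < 2 * n" for b m u
    using aut M(2)[OF that] by (simp add: X_def vertex_automorphism_def nprod_simps)
  have "g (B m k v) = (\<Sum>b<2 * n. sg n b *s (\<Sum>a<2 * n. M $$ (a, b) *s X a m
      (\<Sum>c<2 * n. M $$ (c, partner n b) *s X c k (g v))))"
    by (simp add: B_def module_hom.sum[OF hom] module_hom.scale[OF hom] gX partner_less)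
  also have "\<dots> = (\<Sum>b<2 * n. \<Sum>a<2 * n. \<Sum>c<2 * n.
      (sg n b * M $$ (a, b) * M $$ (c, partner n b)) *s X a m (X c k (g v)))"
    by (simp add: X_linear scale_sum_right mult.assoc)
  also have "\<dots> = (\<Sum>a<2 * n. \<Sum>c<2 * n.
      (\<Sum>b<2 * n. sg n b * M $$ (a, b) * M $$ (c, partner n b)) *s X a m (X c k (g v)))"
    by (subst sum_rotate) (simp only: scale_sum_left)
  also have "\<dots> = (\<Sum>a<2 * n. \<Sum>c<2 * n. if c = partner n a then sg n a *s X a m (X (partner n a) k (g v)) else 0)"
    by (intro sum.cong refl) (auto simp: Sp_transpose[OF M(1)])
  also have "\<dots> = B m k (g v)"
    unfolding B_def by (intro sum.cong refl) (simp add: partner_less)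
  finally show ?thesis .
qed

lemma orb_subalgebra: "vertex_subalgebra V orb"
  using vertex_superalgebra_axioms
  by (intro orbifold_vertex_subalgebra) (auto simp: Sp_automorphisms_def)

lemma orb_B: "v \<in> orb \<Longrightarrow> B m k v \<in> orb"
  by (auto simp: orbifold_def Sp_automorphism_B)

section \<open>Parity and multiplicativity of intertwiners\<close>

lemma mon_parity: "set w \<subseteq> I \<Longrightarrow> mon w \<in> par V (odd (length w))"
proof (induction w)
  case Nil
  then show ?case by (simp add: mon_def vac_even)
next
  case (Cons p w)
  have "X (fst p) (- 1 - int (snd p)) (mon w) \<in> par V (True \<noteq> odd (length w))"
    using Cons unfolding X_def by (intro nprod_par gen_odd) (auto simp: I_def)
  then have "cr p (mon w) \<in> par V (True \<noteq> odd (length w))"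
    using par_subspace subspace_scale by (auto simp: cr_X)
  then show ?case by (simp add: mon_def)
qed

text \<open>Splitting \<open>v\<close> along the basis by parity of length gives a second even-odd
  decomposition; the component of the wrong parity lies in both parts and hence vanishes. Thus
  parity is visible on monomials, as needed to check that automorphisms preserve it.\<close>

lemma par_span: "v \<in> par V q \<Longrightarrow> v \<in> span (mon ` {w \<in> W. odd (length w) = q})"
proof -
  assume v: "v \<in> par V q"
  have "\<exists>v0 v1. v = v0 + v1 \<and> v0 \<in> span (mon ` {w \<in> W. odd (length w) = q}) \<and>
      v1 \<in> span (mon ` {w \<in> W. odd (length w) = (\<not> q)})"
  proof (induction v rule: V_basis_induct)
    case (add u v)
    then obtain u0 u1 v0 v1 where "u = u0 + u1" "v = v0 + v1"
      "u0 \<in> span (mon ` {w \<in> W. odd (length w) = q})" "v0 \<in> span (mon ` {w \<in> W. odd (length w) = q})"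
      "u1 \<in> span (mon ` {w \<in> W. odd (length w) = (\<not> q)})" "v1 \<in> span (mon ` {w \<in> W. odd (length w) = (\<not> q)})"
      by blast
    then show ?case
      by (intro exI[of _ "u0 + v0"] exI[of _ "u1 + v1"]) (simp add: span_add algebra_simps)
  next
    case (scale t v)
    then obtain v0 v1 where "v = v0 + v1" "v0 \<in> span (mon ` {w \<in> W. odd (length w) = q})"
      "v1 \<in> span (mon ` {w \<in> W. odd (length w) = (\<not> q)})" by blast
    then show ?case
      by (intro exI[of _ "t *s v0"] exI[of _ "t *s v1"]) (simp add: span_scale scale_right_distrib)
  next
    case (mon w)
    show ?case
    proof (cases "odd (length w) = q")
      case True
      then show ?thesis using mon by (intro exI[of _ "mon w"] exI[of _ 0]) (simp add: span_base span_zero)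
    next
      case False
      then show ?thesis using mon by (intro exI[of _ 0] exI[of _ "mon w"]) (simp add: span_base span_zero)
    qed
  qed
  then obtain v0 v1 where v01: "v = v0 + v1" "v0 \<in> span (mon ` {w \<in> W. odd (length w) = q})"
      "v1 \<in> span (mon ` {w \<in> W. odd (length w) = (\<not> q)})" by blast
  have sp: "span (mon ` {w \<in> W. odd (length w) = r}) \<subseteq> par V r" for r
    by (intro span_minimal par_subspace) (use mon_parity in \<open>auto simp: W_def\<close>)
  have "v1 = v - v0" using v01(1) by simp
  moreover have "v - v0 \<in> par V q" using v v01(2) sp by (intro subspace_diff par_subspace) auto
  moreover have "v1 \<in> par V (\<not> q)" using v01(3) sp by blast
  ultimately have "v1 = 0" using par_inter_trivial[of v1] by (cases q) simp_all
  then show ?thesis using v01 by simp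
qed

text \<open>A linear map intertwining the modes of the generators is multiplicative, since the modes of
  all other elements are obtained from these by the Borcherds identity.\<close>

lemma intertwiner_multiplicative:
  assumes lin: "Vector_Spaces.linear (scl V) (scl V) g" and vac: "g (vac V) = vac V"
    and gX: "\<And>b m u. b < 2 * n \<Longrightarrow> g (X b m u) = (\<Sum>a<2 * n. M a b *s X a m (g u))"
  shows "v \<in> par V q \<Longrightarrow> g v \<in> par V q" "g (nprod V v m u) = nprod V (g v) m (g u)"
proof -
  have hom: "module_hom (scl V) (scl V) g" using lin by (simp add: linear_iff_module_hom)
  have gmon: "g (mon w) \<in> par V (odd (length w))" if "set w \<subseteq> I" for w
    using that
  proof (induction w)
    case Nil
    then show ?case by (simp add: mon_def vac_even vac)
  next
    case (Cons p w)
    have "X a (- 1 - int (snd p)) (g (mon w)) \<in> par V (True \<noteq> odd (length w))" if "a < 2 * n" for a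
      using Cons that unfolding X_def by (intro nprod_par gen_odd) auto
    then have "(\<Sum>a<2 * n. M a (fst p) *s X a (- 1 - int (snd p)) (g (mon w))) \<in> par V (True \<noteq> odd (length w))"
      by (intro subspace_sum subspace_scale par_subspace) auto
    then have "g (cr p (mon w)) \<in> par V (True \<noteq> odd (length w))"
      using Cons.prems by (auto simp: cr_X module_hom.scale[OF hom] gX I_def intro!: subspace_scale par_subspace)
    then show ?case by (simp add: mon_def)
  qed
  show "g v \<in> par V q" if "v \<in> par V q" for v q
  proof -
    have "subspace {v. g v \<in> par V q}"
      using par_subspace[of q]
      by (auto simp: subspace_def module_hom.add[OF hom] module_hom.scale[OF hom] module_hom.zero[OF hom])
    then have "span (mon ` {w \<in> W. odd (length w) = q}) \<subseteq> {v. g v \<in> par V q}"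
      using gmon by (intro span_minimal) (auto simp: W_def)
    then show ?thesis using par_span[OF that] by auto
  qed
  have ggen: "g (sf_gen n e f b) = (\<Sum>a<2 * n. M a b *s sf_gen n e f a)" if "b < 2 * n" for b
    using gX[OF that, of "-1" "vac V"] by (simp add: X_def vac creation)
  have gnX: "nprod V (g (sf_gen n e f b)) m u = (\<Sum>a<2 * n. M a b *s X a m u)" if "b < 2 * n" for b m u
    by (simp add: ggen[OF that] nprod_simps X_def)
  have gmul: "g (nprod V (mon w) m u) = nprod V (g (mon w)) m (g u)" if "set w \<subseteq> I" for w m u
    using that
  proof (induction w arbitrary: m u)
    case Nil
    then show ?case by (simp add: mon_def vac vac_left module_hom.zero[OF hom])
  next
    case (Cons p w)
    let ?x = "sf_gen n e f (fst p)" and ?r = "- 1 - int (snd p)"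
    have p: "fst p < 2 * n" and w: "set w \<subseteq> I" using Cons.prems by (auto simp: I_def)
    have gx: "g (nprod V ?x m u) = nprod V (g ?x) m (g u)" for m u
      using gX[OF p] gnX[OF p] by (simp add: X_def)
    have gpar: "g ?x \<in> par V True"
      unfolding ggen[OF p] using gen_odd by (intro subspace_sum subspace_scale par_subspace) auto
    obtain N where N: "N \<ge> 0" "\<And>j. j \<ge> N \<Longrightarrow> nprod V (mon w) j u = 0" "\<And>j. j \<ge> N \<Longrightarrow> nprod V ?x j u = 0"
      "\<And>j. j \<ge> N \<Longrightarrow> nprod V (g (mon w)) j (g u) = 0" "\<And>j. j \<ge> N \<Longrightarrow> nprod V (g ?x) j (g u) = 0"
      using truncation_uniform[of "{(mon w, u), (?x, u), (g (mon w), g u), (g ?x, g u)}"] by auto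
    define K where "K = nat (N + \<bar>m\<bar>)"
    have *: "nprod V (nprod V ?x ?r (mon w)) m u = (\<Sum>j<K. ((-1) ^ j * (of_int ?r gchoose j)) *s
            (nprod V ?x (?r - int j) (nprod V (mon w) (m + int j) u)
             - ((-1) powi ?r * koszul True (odd (length w))) *s nprod V (mon w) (?r + m - int j) (nprod V ?x (int j) u)))"
      using N by (intro iterate_homogeneous gen_odd p mon_parity w) (auto simp: K_def)
    have **: "nprod V (nprod V (g ?x) ?r (g (mon w))) m (g u) = (\<Sum>j<K. ((-1) ^ j * (of_int ?r gchoose j)) *s
            (nprod V (g ?x) (?r - int j) (nprod V (g (mon w)) (m + int j) (g u))
             - ((-1) powi ?r * koszul True (odd (length w))) *s nprod V (g (mon w)) (?r + m - int j) (nprod V (g ?x) (int j) (g u))))"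
      using N by (intro iterate_homogeneous gpar gmon w) (auto simp: K_def)
    have "g (nprod V (nprod V ?x ?r (mon w)) m u) = nprod V (nprod V (g ?x) ?r (g (mon w))) m (g u)"
      unfolding * ** using Cons.IH[OF w] gx
      by (simp add: module_hom.sum[OF hom] module_hom.scale[OF hom] module_hom.diff[OF hom])
    moreover have "mon (p # w) = fact (snd p) *s nprod V ?x ?r (mon w)"
      by (simp add: mon_def cr_X X_def)
    ultimately show ?case by (simp add: nprod_simps module_hom.scale[OF hom] gx)
  qed
  show "g (nprod V v m u) = nprod V (g v) m (g u)"
  proof (induction v rule: V_basis_induct)
    case (mon w)
    then show ?case using gmul by (auto simp: W_def)
  qed (simp_all add: nprod_simps module_hom.add[OF hom] module_hom.scale[OF hom])
qed

section \<open>Transvections as automorphisms\<close>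

text \<open>The transvection \<open>x \<mapsto> x + t \<omega>(v, x) v\<close> along \<open>v = \<Sum>\<^sub>a v\<^sub>a x\<^sub>a\<close>.\<close>

definition tv :: "(nat \<Rightarrow> complex) \<Rightarrow> nat \<Rightarrow> complex" where
  "tv v b = sg n (partner n b) * v (partner n b)"

definition TM :: "(nat \<Rightarrow> complex) \<Rightarrow> complex \<Rightarrow> nat \<Rightarrow> nat \<Rightarrow> complex" where
  "TM v t a b = (if a = b then 1 else 0) + t * v a * tv v b"

definition XV :: "(nat \<Rightarrow> complex) \<Rightarrow> int \<Rightarrow> 'v \<Rightarrow> 'v" where
  "XV v m u = (\<Sum>a<2 * n. v a *s X a m u)"

definition TX :: "(nat \<Rightarrow> complex) \<Rightarrow> complex \<Rightarrow> nat \<Rightarrow> int \<Rightarrow> 'v \<Rightarrow> 'v" where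
  "TX v t b m u = X b m u + (t * tv v b) *s XV v m u"

lemma XV_linear: "XV v m (u + w) = XV v m u + XV v m w" "XV v m (s *s u) = s *s XV v m u" "XV v m 0 = 0"
  by (simp_all add: XV_def X_linear scale_right_distrib sum.distrib scale_sum_right mult.commute)

lemma XV_sum: "XV v m (\<Sum>i\<in>A. G i) = (\<Sum>i\<in>A. XV v m (G i))"
  by (induction A rule: infinite_finite_induct) (simp_all add: XV_linear)

lemma TX_linear: "TX v t b m (u + w) = TX v t b m u + TX v t b m w" "TX v t b m (s *s u) = s *s TX v t b m u"
  "TX v t b m 0 = 0" "TX v t b m (- u) = - TX v t b m u" "TX v t b m (u - w) = TX v t b m u - TX v t b m w"
proof -
  show 1: "TX v t b m (u + w) = TX v t b m u + TX v t b m w" for u w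
    by (simp add: TX_def X_linear XV_linear scale_right_distrib)
  show 2: "TX v t b m (s *s u) = s *s TX v t b m u" for s u
    by (simp add: TX_def X_linear XV_linear scale_right_distrib mult.commute)
  show "TX v t b m 0 = 0" using 2[of 0 0] by simp
  show 3: "TX v t b m (- u) = - TX v t b m u" for u using 2[of "-1" u] by simp
  show "TX v t b m (u - w) = TX v t b m u - TX v t b m w" using 1[of u "- w"] 3[of w] by simp
qed

lemma TX_TM: "b < 2 * n \<Longrightarrow> TX v t b m u = (\<Sum>a<2 * n. TM v t a b *s X a m u)"
proof -
  assume b: "b < 2 * n"
  have "(\<Sum>a<2 * n. TM v t a b *s X a m u)
      = (\<Sum>a<2 * n. (if a = b then X a m u else 0) + (t * tv v b) *s v a *s X a m u)"
    by (intro sum.cong refl) (simp add: TM_def scale_left_distrib mult_ac)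
  also have "\<dots> = TX v t b m u"
    using b by (simp add: sum.distrib TX_def XV_def scale_sum_right)
  finally show ?thesis by simp
qed

text \<open>This is \<omega>(v, v) = 0: the substitution \<open>a\<close> to
  \<open>partner n a\<close> changes the sign of the sum.\<close>

lemma sum_tv: "(\<Sum>a<2 * n. v a * tv v a) = 0"
proof -
  have "(\<Sum>a<2 * n. v a * tv v a) = (\<Sum>a<2 * n. - (v (partner n a) * tv v (partner n a)))"
    by (intro sum.cong refl) (simp add: tv_def partner_partner sg_partner)
  also have "\<dots> = - (\<Sum>a<2 * n. v a * tv v a)"
    by (simp only: sum_negf sum_partner[of "\<lambda>a. v a * tv v a"])
  finally show ?thesis by simp
qed

lemma X_XV: "b < 2 * n \<Longrightarrow> X b m (XV v k u) + XV v k (X b m u)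
    = (if m + k = 0 then - tv v b * of_int m else 0) *s u"
proof -
  assume b: "b < 2 * n"
  have "X b m (XV v k u) + XV v k (X b m u) = (\<Sum>a<2 * n. v a *s (X b m (X a k u) + X a k (X b m u)))"
    by (simp add: XV_def X_linear scale_right_distrib sum.distrib)
  also have "\<dots> = (\<Sum>a<2 * n. if a = partner n b then
      (if m + k = 0 then - tv v b * of_int m else 0) *s u else 0)"
    using b by (intro sum.cong refl) (auto simp: X_anticommute tv_def sg_partner mult_ac)
  finally show ?thesis using b by (simp add: partner_less)
qed

lemma XV_XV: "XV v m (XV v k u) + XV v k (XV v m u) = 0"
proof -
  have "XV v m (XV v k u) + XV v k (XV v m u) = (\<Sum>a<2 * n. v a *s (X a m (XV v k u) + XV v k (X a m u)))"
    by (simp add: scale_right_distrib sum.distrib XV_def[of v m] XV_sum XV_linear)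
  also have "\<dots> = ((\<Sum>a<2 * n. v a * tv v a) * (if m + k = 0 then - of_int m else 0)) *s u"
    unfolding sum_distrib_right scale_sum_left by (intro sum.cong refl) (simp add: X_XV mult_ac)
  finally show ?thesis by (simp add: sum_tv)
qed

text \<open>The two terms linear in \<open>t\<close> are opposite because \<open>k = - m\<close>
  when they are present, and the term quadratic in \<open>t\<close> vanishes because
  \<open>v\<close> is isotropic.\<close>

lemma TX_anticommute:
  assumes "b < 2 * n" "c < 2 * n"
  shows "TX v t b m (TX v t c k u) + TX v t c k (TX v t b m u)
    = (if c = partner n b \<and> m + k = 0 then sg n b * of_int m else 0) *s u"
proof -
  have "TX v t b m (TX v t c k u) + TX v t c k (TX v t b m u)
     = (X b m (X c k u) + X c k (X b m u))
       + (t * tv v c) *s (X b m (XV v k u) + XV v k (X b m u))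
       + (t * tv v b) *s (X c k (XV v m u) + XV v m (X c k u))
       + (t * tv v b * (t * tv v c)) *s (XV v m (XV v k u) + XV v k (XV v m u))"
    by (simp add: TX_def X_linear XV_linear scale_right_distrib mult.commute algebra_simps)
  also have "\<dots> = (if c = partner n b \<and> m + k = 0 then sg n b * of_int m else 0) *s u
     + ((t * tv v c) * (if m + k = 0 then - tv v b * of_int m else 0)
       + (t * tv v b) * (if k + m = 0 then - tv v c * of_int k else 0)) *s u"
    by (simp only: X_anticommute[OF assms] X_XV[OF assms(1)] X_XV[OF assms(2)] XV_XV
        scale_zero_right add_0_right scale_scale scale_left_distrib add.assoc)
  also have "(t * tv v c) * (if m + k = 0 then - tv v b * of_int m else 0)
       + (t * tv v b) * (if k + m = 0 then - tv v c * of_int k else 0) = 0"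
    by (auto simp: add_eq_0_iff)
  finally show ?thesis by simp
qed

lemma transvection_exists:
  "\<exists>g. Vector_Spaces.linear (scl V) (scl V) g \<and> g (vac V) = vac V \<and>
    (\<forall>b<2 * n. \<forall>m u. g (X b m u) = TX v t b m (g u))"
proof (rule modes_extend)
  show "TX v t a m (vac V) = 0" if "m \<ge> 0" for a m
    using that by (simp add: TX_def XV_def X_vac)
qed (simp_all only: TX_linear TX_anticommute)

lemma TM_Sp: "mat (2 * n) (2 * n) (\<lambda>(a, b). TM v t a b) \<in> Sp n"
proof (subst Sp_iff)
  have "(\<Sum>u<2 * n. sg n u * TM v t u c * TM v t (partner n u) d) = (if d = partner n c then sg n c else 0)"
    if cd: "c < 2 * n" "d < 2 * n" for c d
  proof -
    have *: "sg n u * v (partner n u) = - tv v u" if "u < 2 * n" for u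
      using that by (simp add: tv_def sg_partner)
    have "(\<Sum>u<2 * n. sg n u * TM v t u c * TM v t (partner n u) d)
      = (\<Sum>u<2 * n. (if u = c then (if d = partner n c then sg n c else 0) else 0)
        + (if u = c then - tv v c * t * tv v d else 0)
        + (if u = partner n d then t * tv v c * tv v d else 0)
        - t * t * tv v c * tv v d * (v u * tv v u))"
    proof (intro sum.cong refl)
      fix u assume u: "u \<in> {..<2 * n}"
      have "sg n u * TM v t u c * TM v t (partner n u) d
        = (if u = c \<and> partner n u = d then sg n u else 0)
        + (if u = c then (sg n u * v (partner n u)) * t * tv v d else 0)
        + (if partner n u = d then t * tv v c * (sg n u * v u) else 0)
        + t * t * tv v c * tv v d * (v u * (sg n u * v (partner n u)))"
        by (simp add: TM_def algebra_simps)
      also have "(if partner n u = d then t * tv v c * (sg n u * v u) else 0)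
          = (if u = partner n d then t * tv v c * tv v d else 0)"
        using u cd by (auto simp: tv_def partner_partner)
      finally show "sg n u * TM v t u c * TM v t (partner n u) d
        = (if u = c then (if d = partner n c then sg n c else 0) else 0)
        + (if u = c then - tv v c * t * tv v d else 0)
        + (if u = partner n d then t * tv v c * tv v d else 0)
        - t * t * tv v c * tv v d * (v u * tv v u)"
        using u * by auto
    qed
    also have "\<dots> = (if d = partner n c then sg n c else 0)"
      using cd by (simp add: sum.distrib sum_subtractf partner_less sum_distrib_left[symmetric] sum_tv)
    finally show ?thesis .
  qed
  then show "\<forall>c<2 * n. \<forall>d<2 * n. (\<Sum>u<2 * n. sg n u * mat (2 * n) (2 * n) (\<lambda>(a, b). TM v t a b) $$ (u, c)
      * mat (2 * n) (2 * n) (\<lambda>(a, b). TM v t a b) $$ (partner n u, d)) = (if d = partner n c then sg n c else 0)"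
    by (simp add: partner_less)
qed auto

text \<open>Bijectivity comes from the transvection with parameter \<open>- t\<close>, which is the
  inverse.\<close>

lemma transvection_automorphism:
  "\<exists>g\<in>Sp_automorphisms V n e f. \<forall>b<2 * n. \<forall>m u. g (X b m u) = TX v t b m (g u)"
proof -
  obtain g where g: "Vector_Spaces.linear (scl V) (scl V) g" "g (vac V) = vac V"
    "\<And>b m u. b < 2 * n \<Longrightarrow> g (X b m u) = TX v t b m (g u)"
    using transvection_exists[of v t] by blast
  obtain h where h: "Vector_Spaces.linear (scl V) (scl V) h" "h (vac V) = vac V"
    "\<And>b m u. b < 2 * n \<Longrightarrow> h (X b m u) = TX v (- t) b m (h u)"
    using transvection_exists[of v "- t"] by blast
  have inv: "h (g u) = u" if g: "Vector_Spaces.linear (scl V) (scl V) g" "g (vac V) = vac V"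
      "\<And>b m u. b < 2 * n \<Longrightarrow> g (X b m u) = TX v t b m (g u)"
    and h: "Vector_Spaces.linear (scl V) (scl V) h" "h (vac V) = vac V"
      "\<And>b m u. b < 2 * n \<Longrightarrow> h (X b m u) = TX v (- t) b m (h u)" for g h u t
  proof -
    have hg: "module_hom (scl V) (scl V) g" and hh: "module_hom (scl V) (scl V) h"
      using g(1) h(1) by (simp_all add: linear_iff_module_hom)
    show ?thesis
    proof (induction u rule: V_induct)
      case (cr p u)
      have p: "fst p < 2 * n" using cr by (simp add: I_def)
      let ?k = "- 1 - int (snd p)" and ?y = "tv v (fst p)"
      \<comment> \<open>A transvection fixes its own direction \<open>v\<close>, since
        \<open>v\<close> is isotropic.\<close>
      have "h (XV v ?k w) = XV v ?k (h w)" for w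
      proof -
        have "h (XV v ?k w) = (\<Sum>a<2 * n. v a *s X a ?k (h w) + (- t * (v a * tv v a)) *s XV v ?k (h w))"
          by (simp add: XV_def[of v ?k w] module_hom.sum[OF hh] module_hom.scale[OF hh] h(3) TX_def
              scale_right_distrib mult_ac scale_right_diff_distrib)
        also have "\<dots> = XV v ?k (h w) + (- t * (\<Sum>a<2 * n. v a * tv v a)) *s XV v ?k (h w)"
          by (simp only: sum.distrib XV_def[symmetric] scale_sum_left[symmetric] sum_distrib_left)
        finally show ?thesis by (simp add: sum_tv)
      qed
      then have "h (g (X (fst p) ?k u)) = X (fst p) ?k u"
        using p cr.IH by (simp add: g(3) h(3) TX_def module_hom.add[OF hh] module_hom.scale[OF hh])
      then show ?case by (simp add: cr_X module_hom.scale[OF hh] module_hom.scale[OF hg])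
    qed (simp_all add: module_hom.add[OF hh] module_hom.add[OF hg] module_hom.scale[OF hh] module_hom.scale[OF hg] g h)
  qed
  have "h (g u) = u" for u by (rule inv[OF g h])
  moreover have "g (h u) = u" for u using inv[of h "- t" g] g h by simp
  ultimately have "bij g" by (intro o_bij[of h]) auto
  have gX: "g (X b m u) = (\<Sum>a<2 * n. TM v t a b *s X a m (g u))" if "b < 2 * n" for b m u
    using g(3)[OF that] TX_TM[OF that] by simp
  have "g (sf_gen n e f b) = (\<Sum>a<2 * n. TM v t a b *s sf_gen n e f a)" if "b < 2 * n" for b
    using gX[OF that, of "-1" "vac V"] by (simp add: X_def g(2) creation)
  then have "\<exists>M\<in>Sp n. \<forall>b<2 * n. g (sf_gen n e f b) = (\<Sum>a<2 * n. M $$ (a, b) *s sf_gen n e f a)"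
    by (intro bexI[OF _ TM_Sp[of v t]]) simp
  moreover have "vertex_automorphism V g"
    unfolding vertex_automorphism_def
    using g(1,2) \<open>bij g\<close> intertwiner_multiplicative[OF g(1,2) gX] by auto
  ultimately show ?thesis using g(3) by (auto simp: Sp_automorphisms_def)
qed

section \<open>From invariance under transvections to the Lie algebra\<close>

text \<open>\<open>poly_jet G u u'\<close>: the coordinates of \<open>G t\<close> are polynomials in \<open>t\<close>, and \<open>G t = u + t u' + O(t\<^sup>2)\<close>.\<close>

definition poly_jet :: "(complex \<Rightarrow> 'v) \<Rightarrow> 'v \<Rightarrow> 'v \<Rightarrow> bool" where
  "poly_jet G u u' \<longleftrightarrow> (\<forall>w\<in>W. \<exists>p. (\<forall>t. coord w (G t) = poly p t) \<and> coeff p 0 = coord w u \<and> coeff p 1 = coord w u')"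

lemma poly_jet_const: "poly_jet (\<lambda>t. u) u 0"
  unfolding poly_jet_def by (intro ballI exI[of _ "[:coord w u:]" for w]) (simp add: coord_linear)

lemma poly_jet_add: "poly_jet G u u' \<Longrightarrow> poly_jet G' w w' \<Longrightarrow> poly_jet (\<lambda>t. G t + G' t) (u + w) (u' + w')"
  unfolding poly_jet_def coord_linear by (metis coeff_add poly_add)

lemma poly_jet_scale: "poly_jet G u u' \<Longrightarrow> poly_jet (\<lambda>t. s *s G t) (s *s u) (s *s u')"
  unfolding poly_jet_def coord_linear by (metis coeff_smult poly_smult)

lemma poly_jet_sum: "(\<And>i. i \<in> A \<Longrightarrow> poly_jet (G i) (u i) (u' i)) \<Longrightarrow>
    poly_jet (\<lambda>t. \<Sum>i\<in>A. G i t) (\<Sum>i\<in>A. u i) (\<Sum>i\<in>A. u' i)"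
  by (induction A rule: infinite_finite_induct)
    (use poly_jet_const[of 0] in \<open>simp_all add: poly_jet_add\<close>)

lemma poly_jet_times: "poly_jet G u u' \<Longrightarrow> poly_jet (\<lambda>t. t *s G t) 0 u"
  unfolding poly_jet_def
proof
  fix w assume *: "\<forall>w\<in>W. \<exists>p. (\<forall>t. coord w (G t) = poly p t) \<and> coeff p 0 = coord w u \<and> coeff p 1 = coord w u'" "w \<in> W"
  then obtain p where "\<forall>t. coord w (G t) = poly p t" "coeff p 0 = coord w u" by blast
  then show "\<exists>p. (\<forall>t. coord w (t *s G t) = poly p t) \<and> coeff p 0 = coord w 0 \<and> coeff p 1 = coord w u"
    by (intro exI[of _ "pCons 0 p"]) (simp add: coord_linear)
qed

lemma poly_jet_cr: "p \<in> I \<Longrightarrow> poly_jet G u u' \<Longrightarrow> poly_jet (\<lambda>t. cr p (G t)) (cr p u) (cr p u')"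
  unfolding poly_jet_def
proof
  fix w
  let ?w = "filter (\<lambda>q. q \<noteq> p) w"
  assume *: "p \<in> I" "\<forall>w\<in>W. \<exists>p. (\<forall>t. coord w (G t) = poly p t) \<and> coeff p 0 = coord w u \<and> coeff p 1 = coord w u'" "w \<in> W"
  then obtain r where r: "\<forall>t. coord ?w (G t) = poly r t" "coeff r 0 = coord ?w u" "coeff r 1 = coord ?w u'"
    using filter_W by blast
  show "\<exists>r. (\<forall>t. coord w (cr p (G t)) = poly r t) \<and> coeff r 0 = coord w (cr p u) \<and> coeff r 1 = coord w (cr p u')"
    by (rule exI[of _ "if p \<in> set w then smult (isg p ?w) r else 0"]) (simp add: coord_cr * r(1,2) r(3)[simplified])
qed

lemma poly_jet_unique:
  assumes "poly_jet (\<lambda>t. u) u u'"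
  shows "u' = 0"
proof (rule coord_eq_0)
  fix w assume "w \<in> W"
  then obtain p where p: "\<forall>t. coord w u = poly p t" "coeff p 1 = coord w u'"
    using assms unfolding poly_jet_def by blast
  then have "poly p = poly [:coord w u:]" by auto
  then have "p = [:coord w u:]" by (simp only: poly_eq_poly_eq_iff)
  then show "coord w u' = 0" using p(2) by simp
qed

text \<open>The derivative of the transvection at \<open>t = 0\<close>: the rank one matrix with
  entries \<open>v a * tv v c\<close>, acting as a derivation.\<close>

definition TD :: "nat \<Rightarrow> (nat \<Rightarrow> complex) \<Rightarrow> 'v \<Rightarrow> 'v" where
  "TD K v u = (\<Sum>c<2 * n. tv v c *s (\<Sum>a<2 * n. v a *s gl K a c u))"

lemma gl_linear: "gl K a b (u + v) = gl K a b u + gl K a b v" "gl K a b (t *s v) = t *s gl K a b v"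
  by (simp_all add: gl_def cr_linear an_linear sum.distrib scale_sum_right)

lemma TD_linear: "TD K v (u + w) = TD K v u + TD K v w" "TD K v (t *s u) = t *s TD K v u"
  by (simp_all add: TD_def gl_linear scale_right_distrib sum.distrib scale_sum_right mult_ac)

lemma gl_cr:
  assumes p: "p \<in> I_below K" and ac: "a < 2 * n" "c < 2 * n"
  shows "gl K a c (cr p u) = (if c = fst p then cr (a, snd p) u else 0) + cr p (gl K a c u)"
proof -
  have "gl K a c (cr p u) = (\<Sum>k<K. (if k = snd p then (if c = fst p then cr (a, snd p) u else 0) else 0)
      + cr p (cr (a, k) (an (c, k) u)))"
    unfolding gl_def
  proof (rule sum.cong[OF refl])
    fix k
    have I: "(a, k) \<in> I" "(c, k) \<in> I" "p \<in> I" using ac I_below_I[OF p] by (auto simp: I_def)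
    show "cr (a, k) (an (c, k) (cr p u)) = (if k = snd p then (if c = fst p then cr (a, snd p) u else 0) else 0)
      + cr p (cr (a, k) (an (c, k) u))"
      by (auto simp: an_cr I cr_linear cr_cr[OF I(1,3), of "an (c, k) u"] prod_eq_iff)
  qed
  then show ?thesis using p by (simp add: sum.distrib gl_def cr_linear I_below_def mem_Times_iff)
qed

lemma TD_cr:
  assumes p: "p \<in> I_below K"
  shows "TD K v (cr p u) = tv v (fst p) *s (\<Sum>a<2 * n. v a *s cr (a, snd p) u) + cr p (TD K v u)"
proof -
  have "TD K v (cr p u) = (\<Sum>c<2 * n. (if c = fst p then tv v (fst p) *s (\<Sum>a<2 * n. v a *s cr (a, snd p) u) else 0)
      + tv v c *s (\<Sum>a<2 * n. v a *s cr p (gl K a c u)))"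
    unfolding TD_def
    by (intro sum.cong refl) (auto simp: gl_cr[OF p] scale_right_distrib sum.distrib)
  then show ?thesis using p by (simp add: sum.distrib TD_def cr_linear I_below_def mem_Times_iff)
qed

lemma transvection_jet:
  assumes g: "\<And>t. Vector_Spaces.linear (scl V) (scl V) (g t)" "\<And>t. g t (vac V) = vac V"
    "\<And>t b m u. b < 2 * n \<Longrightarrow> g t (X b m u) = TX v t b m (g t u)"
    and u: "u \<in> filt K d"
  shows "poly_jet (\<lambda>t. g t u) u (TD K v u)"
proof -
  have hg: "module_hom (scl V) (scl V) (g t)" for t using g(1) by (simp add: linear_iff_module_hom)
  have mon: "poly_jet (\<lambda>t. g t (mon w)) (mon w) (TD K v (mon w))" if "set w \<subseteq> I_below K" for w
    using that
  proof (induction w)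
    case Nil
    have "TD K v (vac V) = 0" by (simp add: TD_def gl_def an_vac cr_linear)
    then show ?case using poly_jet_const[of "vac V"] by (simp add: mon_def g(2))
  next
    case (Cons p w)
    have p: "p \<in> I_below K" "fst p < 2 * n" and w: "set w \<subseteq> I_below K" using Cons.prems by (auto simp: I_below_def)
    have "fact (snd p) *s (t * tv v (fst p)) *s XV v (- 1 - int (snd p)) u
        = tv v (fst p) *s (\<Sum>a<2 * n. v a *s (t *s cr (a, snd p) u))" for t u
      by (simp add: XV_def cr_X scale_sum_right mult_ac)
    then have gcr: "g t (cr p u) = cr p (g t u) + tv v (fst p) *s (\<Sum>a<2 * n. v a *s (t *s cr (a, snd p) (g t u)))" for t u
      by (simp add: cr_X[of p] module_hom.scale[OF hg] g(3) p TX_def scale_right_distrib del: scale_scale)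
    have "poly_jet (\<lambda>t. cr p (g t (mon w)) + tv v (fst p) *s (\<Sum>a<2 * n. v a *s (t *s cr (a, snd p) (g t (mon w)))))
       (cr p (mon w) + tv v (fst p) *s (\<Sum>a<2 * n. v a *s 0))
       (cr p (TD K v (mon w)) + tv v (fst p) *s (\<Sum>a<2 * n. v a *s cr (a, snd p) (mon w)))"
      using poly_jet_times[OF poly_jet_cr[OF _ Cons.IH[OF w]]] Cons.IH[OF w] I_below_I[OF p(1)]
      by (intro poly_jet_add poly_jet_scale poly_jet_sum poly_jet_cr) (auto simp: I_def)
    then show ?case by (simp add: mon_def gcr[of _ "foldr cr w (vac V)"] TD_cr[OF p(1)] add.commute)
  qed
  show ?thesis using u
    by (induction rule: filt_induct)
      (simp_all add: module_hom.add[OF hg] module_hom.scale[OF hg] TD_linear poly_jet_add poly_jet_scale mon W_below_def)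
qed

lemma orb_TD:
  assumes "u \<in> orb" "u \<in> filt K d"
  shows "TD K v u = 0"
proof -
  obtain g where g: "\<And>t. g t \<in> Sp_automorphisms V n e f"
    "\<And>t b m u. b < 2 * n \<Longrightarrow> g t (X b m u) = TX v t b m (g t u)"
    using transvection_automorphism[of v] by metis
  have "poly_jet (\<lambda>t. g t u) u (TD K v u)"
    using g by (intro transvection_jet[OF _ _ _ assms(2)])
      (auto simp: Sp_automorphisms_def vertex_automorphism_def)
  moreover have "g t u = u" for t using assms(1) g(1) by (auto simp: orbifold_def)
  ultimately have "poly_jet (\<lambda>t. u) u (TD K v u)" by (simp only:)
  then show ?thesis by (rule poly_jet_unique)
qed

text \<open>\<open>TD\<close> is a quadratic form in \<open>v\<close>. Evaluating it at vectors with
  one or two coordinates equal to 1 polarizes it, and its coefficients are exactly the required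
  relations.\<close>

lemma orb_sp_killed:
  assumes "u \<in> orb"
  shows "sp_killed u"
  unfolding sp_killed_def
proof (intro allI impI)
  fix K d a b assume u: "u \<in> filt K d" and ab: "a < 2 * n" "b < 2 * n"
  have TD: "TD K v u = (\<Sum>c<2 * n. \<Sum>a<2 * n. (sg n c * v c * v a) *s gl K a (partner n c) u)" for v
  proof -
    have "TD K v u = (\<Sum>c<2 * n. \<Sum>a<2 * n. (sg n (partner n c) * v (partner n c) * v a) *s gl K a (partner n (partner n c)) u)"
      unfolding TD_def by (intro sum.cong refl) (simp add: tv_def scale_sum_right partner_partner)
    then show ?thesis
      by (simp only: sum_partner[of "\<lambda>c. \<Sum>a<2 * n. (sg n c * v c * v a) *s gl K a (partner n c) u"])
  qed
  have diag: "gl K c (partner n c) u = 0" if "c < 2 * n" for c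
  proof -
    have "TD K (\<lambda>a. if a = c then 1 else 0) u = sg n c *s gl K c (partner n c) u"
      using that by (simp add: TD if_distrib[of "\<lambda>x. x *s _"] if_distrib[of "\<lambda>x. _ * x"] cong: if_cong)
    then show ?thesis using orb_TD[OF assms u] by (simp add: sg_def split: if_splits)
  qed
  show "gl K a b u = (sg n a * sg n b) *s gl K (partner n b) (partner n a) u"
  proof (cases "b = partner n a")
    case True
    then show ?thesis using diag[OF ab(1)] ab by (simp add: partner_partner)
  next
    case False
    define c where "c = partner n b"
    have c: "c < 2 * n" "c \<noteq> a" "partner n c = b" using False ab by (auto simp: c_def partner_less partner_partner)
    have "TD K (\<lambda>x. if x \<in> {a, c} then 1 else 0) u
        = (\<Sum>x\<in>{a, c}. \<Sum>y\<in>{a, c}. sg n x *s gl K y (partner n x) u)"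
      unfolding TD using ab c
      by (intro sum.mono_neutral_cong_right) (auto intro!: sum.mono_neutral_cong_right sum.neutral)
    then have "sg n a *s gl K c (partner n a) u + sg n c *s gl K a b u = 0"
      using orb_TD[OF assms u] diag[OF ab(1)] diag[OF c(1)] c by simp
    moreover have "sg n c = - sg n b" using ab by (simp add: c_def sg_partner)
    ultimately have "sg n b *s gl K a b u = sg n a *s gl K c (partner n a) u" by simp
    then have "sg n b *s sg n b *s gl K a b u = sg n b *s sg n a *s gl K c (partner n a) u" by simp
    then show ?thesis by (simp add: sg_sq c_def mult.commute)
  qed
qed

lemma orb_span: "orb = span (range qword)"
proof
  have sub: "subspace orb" and vac: "vac V \<in> orb" using orb_subalgebra by (auto simp: vertex_subalgebra_def)
  show "orb \<subseteq> span (range qword)"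
  proof
    fix v assume "v \<in> orb"
    show "v \<in> span (range qword)"
      by (rule invariants_spanned[OF sub vac _ _ orb_sp_killed \<open>v \<in> orb\<close>])
        (use subspace_scale[OF sub] in \<open>auto simp: quad_B quad_adj_B orb_B\<close>)
  qed
  have "qword ws \<in> orb" for ws
  proof (induction ws)
    case (Cons x ws)
    then show ?case using subspace_scale[OF sub] by (cases x) (simp add: qword_def quad_B orb_B)
  qed (simp add: qword_def vac)
  then show "span (range qword) \<subseteq> orb" by (intro span_minimal sub) auto
qed

end

section \<open>Modes of quadratic invariants and conformal weight\<close>

lemma sum_lessThan_add: "(\<Sum>a<m + (k::nat). F a) = (\<Sum>a<m. F a) + (\<Sum>i<k. F (m + i))"
  for F :: "nat \<Rightarrow> 'a::comm_monoid_add"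
  by (induction k) (simp_all add: add.assoc)

text \<open>The factor relating a mode of a derivative to a mode of the field: mode \<open>m\<close>
  of \<open>(D ^^ k) a\<close> is \<open>dcoeff k m\<close> times mode \<open>m - int k\<close> of
  \<open>a\<close>.\<close>

definition dcoeff :: "nat \<Rightarrow> int \<Rightarrow> complex" where
  "dcoeff k m = (-1) ^ k * fact k * (of_int m gchoose k)"

lemma dcoeff_0: "dcoeff 0 m = 1"
  by (simp add: dcoeff_def)

lemma dcoeff_zero: "0 \<le> m \<Longrightarrow> m < int k \<Longrightarrow> dcoeff k m = 0"
proof -
  assume "0 \<le> m" "m < int k"
  then have "(of_int m :: complex) = of_nat (nat m)" "nat m < k" by auto
  then show ?thesis by (simp add: dcoeff_def flip: binomial_gbinomial)
qed

lemma dcoeff_neg: "dcoeff k (- 1 - int j) = fact (j + k) / fact j"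
proof -
  have "(of_nat (Suc j) + of_nat k - 1 :: complex) gchoose k = of_nat (j + k choose k)"
    unfolding binomial_gbinomial by (simp add: add.commute)
  moreover have "(of_int (- 1 - int j) :: complex) = - of_nat (Suc j)" by simp
  ultimately have "(-1) ^ k * ((of_int (- 1 - int j) :: complex) gchoose k) = of_nat (j + k choose k)"
    using gbinomial_minus[of "of_nat (Suc j) :: complex" k]
    by (simp only: mult.assoc[symmetric] power_mult_distrib[symmetric]) simp
  moreover have "of_nat (j + k choose k) = (fact (j + k) / (fact k * fact j) :: complex)"
    by (simp add: binomial_fact)
  ultimately show ?thesis unfolding dcoeff_def by (simp add: field_simps)
qed

context symplectic_fermion_algebra
begin

lemma B_swap: "(\<Sum>a<2 * n. sg n a *s X (partner n a) m (X a k v)) = - B m k v"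
proof -
  have "(\<Sum>a<2 * n. sg n a *s X (partner n a) m (X a k v))
    = (\<Sum>a<2 * n. - (sg n (partner n a) *s X (partner n a) m (X (partner n (partner n a)) k v)))"
    by (intro sum.cong refl) (simp add: sg_partner partner_partner)
  then show ?thesis
    by (simp only: sum_negf B_def sum_partner[of "\<lambda>a. sg n a *s X a m (X (partner n a) k v)"])
qed

lemma B_X:
  assumes b: "b < 2 * n"
  shows "B m k (X b r v) = X b r (B m k v) + (if k + r = 0 then of_int (- k) *s X b m v else 0)
    + (if m + r = 0 then of_int (- m) *s X b k v else 0)"
proof -
  have "B m k (X b r v) = (\<Sum>a<2 * n. sg n a *s X b r (X a m (X (partner n a) k v))
      + (if a = b then if k + r = 0 then of_int (- k) *s X b m v else 0 else 0)
      + (if a = partner n b then if m + r = 0 then of_int (- m) *s X b k v else 0 else 0))"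
    unfolding B_def
  proof (rule sum.cong[OF refl])
    fix a assume "a \<in> {..<2 * n}"
    then have a: "a < 2 * n" "partner n a < 2 * n" by (auto simp: partner_less)
    have 1: "X (partner n a) k (X b r v)
      = (if a = b \<and> k + r = 0 then - sg n a * of_int k else 0) *s v - X b r (X (partner n a) k v)"
      using X_swap[OF a(2) b, of k r v] a(1) b by (auto simp: partner_partner sg_partner)
    have 2: "X a m (X b r w) = (if a = partner n b \<and> m + r = 0 then sg n a * of_int m else 0) *s w - X b r (X a m w)" for w
      using X_swap[OF a(1) b, of m r w] a(1) b by (auto simp: partner_partner)
    show "sg n a *s X a m (X (partner n a) k (X b r v)) = sg n a *s X b r (X a m (X (partner n a) k v))
      + (if a = b then if k + r = 0 then of_int (- k) *s X b m v else 0 else 0)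
      + (if a = partner n b then if m + r = 0 then of_int (- m) *s X b k v else 0 else 0)"
      unfolding 1 X_linear 2 using b
      by (auto simp: scale_right_diff_distrib mult.assoc[symmetric] sg_sq partner_partner)
  qed
  then show ?thesis using b by (simp add: sum.distrib B_def X_linear partner_less)
qed

lemma B_vac: "k \<ge> 0 \<Longrightarrow> B m k (vac V) = 0"
  by (simp add: B_def X_vac X_linear)

lemma B_zero_mode: "B m 0 v = 0"
  by (simp add: B_def X_zero_mode partner_less X_linear)

lemma cr_vac: "cr (a, k) (vac V) = (D ^^ k) (sf_gen n e f a)"
  by (simp add: cr_def wick_def creation)

definition qvec :: "nat \<Rightarrow> nat \<Rightarrow> 'v" where
  "qvec k l = quad k l (vac V)"

lemma qvec_eq: "qvec k l = (\<Sum>a<2 * n. sg n a *s nprod V ((D ^^ k) (sf_gen n e f a)) (-1) ((D ^^ l) (sf_gen n e f (partner n a))))"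
  by (simp add: qvec_def quad_def cr_vac) (simp add: cr_def wick_def)

text \<open>Two signs cancel, one from anticommuting the factors and one from
  \<open>sg_partner\<close>. This symmetry is what later removes the quadratic invariants of odd
  order.\<close>

lemma quad_commute: "quad k l v = quad l k v"
proof -
  have "quad k l v = (\<Sum>a<2 * n. sg n (partner n a) *s cr (partner n a, l) (cr (partner n (partner n a), k) v))"
    unfolding quad_def
  proof (rule sum.cong[OF refl])
    fix a assume "a \<in> {..<2 * n}"
    then show "sg n a *s cr (a, k) (cr (partner n a, l) v)
        = sg n (partner n a) *s cr (partner n a, l) (cr (partner n (partner n a), k) v)"
      using cr_cr[of "(a, k)" "(partner n a, l)" v] by (simp add: sg_partner partner_partner I_def partner_less)
  qed
  then show ?thesis unfolding quad_def
    by (simp only: sum_partner[of "\<lambda>a. sg n a *s cr (a, l) (cr (partner n a, k) v)"])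
qed

lemma sf_j_qvec: "sf_j V n e f k = (1/2) *s qvec 0 k"
proof -
  have "qvec 0 k = (\<Sum>i<n. cr (i, 0) (cr (i + n, k) (vac V))) + (\<Sum>i<n. - cr (n + i, 0) (cr (i, k) (vac V)))"
    unfolding qvec_def quad_def mult_2 sum_lessThan_add
    by (intro arg_cong2[of _ _ _ _ "(+)"] sum.cong refl) (auto simp: sg_def partner_def)
  also have "\<dots> = (\<Sum>i<n. cr (i, 0) (cr (i + n, k) (vac V)) + cr (i, k) (cr (n + i, 0) (vac V)))"
    unfolding sum.distrib using cr_cr[of "(n + i, 0)" "(i, k)" "vac V" for i]
    by (intro arg_cong2[of _ _ _ _ "(+)"] sum.cong refl) (simp add: I_def)
  also have "\<dots> = (\<Sum>i<n. wick V (e i) ((D ^^ k) (f i)) + wick V ((D ^^ k) (e i)) (f i))"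
    unfolding cr_vac by (intro sum.cong refl) (simp add: cr_def sf_gen_def)
  finally show ?thesis by (simp add: sf_j_def)
qed

lemma sf_conformal_qvec: "sf_conformal V n e f = (- 1/2) *s qvec 0 0"
proof -
  have "sf_j V n e f 0 = (\<Sum>i<n. wick V (e i) (f i))"
    unfolding sf_j_def by (simp add: scale_sum_right scale_right_distrib scale_left_distrib[symmetric])
  then show ?thesis unfolding sf_conformal_def sf_j_qvec[symmetric] by (simp add: sf_j_qvec[of 0])
qed

lemma D_parity: "a \<in> par V q \<Longrightarrow> (D ^^ k) a \<in> par V q"
proof (induction k)
  case (Suc k)
  then have "D ((D ^^ k) a) \<in> par V (q \<noteq> False)"
    unfolding deriv_op_def[of V "(D ^^ k) a"] by (intro nprod_par vac_even) simp
  then show ?case by simp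
qed simp

lemma qvec_even: "qvec k l \<in> par V False"
  unfolding qvec_eq
  using nprod_par[OF D_parity D_parity, OF gen_odd gen_odd]
  by (intro subspace_sum subspace_scale par_subspace) (auto simp: partner_less)

text \<open>The iterate formula summed over the generators; in its second half the partner acts
  first, and \<open>B_swap\<close> turns the minus into a plus. The eventual form in
  \<open>N\<close> stands for an infinite sum and lets each application choose a convenient
  cut-off.\<close>

lemma qvec_mode:
  "\<exists>N0. \<forall>N\<ge>N0. nprod V (qvec k l) r v = (\<Sum>j<N.
      (dcoeff k (- 1 - int j) * dcoeff l (r + int j)) *s B (- 1 - int j - int k) (r + int j - int l) v
    + (dcoeff l (r - 1 - int j) * dcoeff k (int j)) *s B (r - 1 - int j - int l) (int j - int k) v)"
proof -
  let ?x = "\<lambda>k a. (D ^^ k) (sf_gen n e f a)"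
  have xX: "nprod V (?x k a) m u = dcoeff k m *s X a (m - int k) u" for k a m u
    by (simp add: nprod_D_pow dcoeff_def X_def)
  let ?A = "(\<lambda>a. (?x k a, v)) ` {..<2 * n} \<union> (\<lambda>a. (?x l a, v)) ` {..<2 * n}"
  have "finite ?A" by simp
  then obtain N1 where N1': "N1 \<ge> 0" "\<forall>m\<ge>N1. \<forall>(a, b)\<in>?A. nprod V a m b = 0"
    using truncation_uniform by blast
  have N1: "nprod V (?x k a) m v = 0" "nprod V (?x l a) m v = 0" if "m \<ge> N1" "a < 2 * n" for m a
    using N1'(2) that by auto
  define N0 where "N0 = nat (N1 + \<bar>r\<bar>)"
  show ?thesis
  proof (intro exI[of _ N0] allI impI)
    fix N assume N: "N \<ge> N0"
    have sq: "(-1) ^ j * (of_int (-1) gchoose j) = (1 :: complex)" for j using gbinomial_minus1 by simp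
    have "nprod V (nprod V (?x k a) (-1) (?x l (partner n a))) r v = (\<Sum>j<N. 
        (dcoeff k (- 1 - int j) * dcoeff l (r + int j)) *s X a (- 1 - int j - int k) (X (partner n a) (r + int j - int l) v)
        - (dcoeff l (r - 1 - int j) * dcoeff k (int j)) *s X (partner n a) (r - 1 - int j - int l) (X a (int j - int k) v))"
      if a: "a < 2 * n" for a
    proof -
      have "nprod V (nprod V (?x k a) (-1) (?x l (partner n a))) r v = (\<Sum>j<N. ((-1) ^ j * (of_int (-1) gchoose j)) *s
            (nprod V (?x k a) (-1 - int j) (nprod V (?x l (partner n a)) (r + int j) v)
             - ((-1) powi (-1) * koszul True True) *s nprod V (?x l (partner n a)) (-1 + r - int j) (nprod V (?x k a) (int j) v)))"
        by (rule iterate_homogeneous) (use N N1 N1'(1) a in \<open>auto simp: N0_def partner_less intro!: D_parity gen_odd\<close>)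
      also have "\<dots> = (\<Sum>j<N. 
        (dcoeff k (- 1 - int j) * dcoeff l (r + int j)) *s X a (- 1 - int j - int k) (X (partner n a) (r + int j - int l) v)
        - (dcoeff l (r - 1 - int j) * dcoeff k (int j)) *s X (partner n a) (r - 1 - int j - int l) (X a (int j - int k) v))"
        unfolding sq by (intro sum.cong refl) (simp add: xX X_linear koszul_def power_int_minus)
      finally show ?thesis .
    qed
    then have "nprod V (qvec k l) r v = (\<Sum>a<2 * n. sg n a *s (\<Sum>j<N.
        (dcoeff k (- 1 - int j) * dcoeff l (r + int j)) *s X a (- 1 - int j - int k) (X (partner n a) (r + int j - int l) v)
        - (dcoeff l (r - 1 - int j) * dcoeff k (int j)) *s X (partner n a) (r - 1 - int j - int l) (X a (int j - int k) v)))"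
      by (simp add: qvec_eq nprod_simps)
    also have "\<dots> = (\<Sum>j<N.
        (dcoeff k (- 1 - int j) * dcoeff l (r + int j)) *s (\<Sum>a<2 * n. sg n a *s X a (- 1 - int j - int k) (X (partner n a) (r + int j - int l) v))
        - (dcoeff l (r - 1 - int j) * dcoeff k (int j)) *s (\<Sum>a<2 * n. sg n a *s X (partner n a) (r - 1 - int j - int l) (X a (int j - int k) v)))"
      by (simp add: scale_sum_right scale_right_diff_distrib sum_subtractf sum.swap[of _ "{..<N}"] mult.commute)
    finally show "nprod V (qvec k l) r v = (\<Sum>j<N.
      (dcoeff k (- 1 - int j) * dcoeff l (r + int j)) *s B (- 1 - int j - int k) (r + int j - int l) v
    + (dcoeff l (r - 1 - int j) * dcoeff k (int j)) *s B (r - 1 - int j - int l) (int j - int k) v)"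
      unfolding B_swap by (simp add: B_def)
  qed
qed

section \<open>Virasoro operators and the weight grading\<close>

abbreviation "L \<equiv> sf_conformal V n e f"

lemma L_even: "L \<in> par V False"
  unfolding sf_conformal_qvec by (intro subspace_scale par_subspace qvec_even)

lemma L_gen:
  assumes "b < 2 * n"
  shows "nprod V L 0 (sf_gen n e f b) = D (sf_gen n e f b)" "nprod V L 1 (sf_gen n e f b) = sf_gen n e f b"
proof -
  have x: "sf_gen n e f b = X b (-1) (vac V)" by (simp add: X_def creation)
  have vac: "X b (int j) (vac V) = 0" for j by (simp add: X_vac)
  have *: "nprod V (qvec 0 0) (int r) (sf_gen n e f b) = (- 2) *s X b (int r - 2) (vac V)" if r: "r \<le> 1" for r
  proof -
    obtain N0 where N0: "\<And>N. N \<ge> N0 \<Longrightarrow> nprod V (qvec 0 0) (int r) (sf_gen n e f b) = (\<Sum>j<N.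
        B (- 1 - int j) (int r + int j) (sf_gen n e f b) + B (int r - 1 - int j) (int j) (sf_gen n e f b))"
      using qvec_mode[of 0 0 "int r" "sf_gen n e f b"] by (auto simp: dcoeff_0)
    define N where "N = N0 + 2"
    have "N \<ge> N0" by (simp add: N_def)
    then have "nprod V (qvec 0 0) (int r) (sf_gen n e f b) = (\<Sum>j<N.
        B (- 1 - int j) (int r + int j) (sf_gen n e f b) + B (int r - 1 - int j) (int j) (sf_gen n e f b))"
      by (rule N0)
    \<comment> \<open>Only mode 1 contracts with \<open>X b (-1)\<close>; it occurs at
      \<open>j = 1 - r\<close> in the first part and at \<open>j = 1\<close> in the second.\<close>
    also have "(\<Sum>j<N. B (- 1 - int j) (int r + int j) (sf_gen n e f b) + B (int r - 1 - int j) (int j) (sf_gen n e f b))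
        = (\<Sum>j<N. (if j = 1 - r then - X b (int r - 2) (vac V) else 0) + (if j = 1 then - X b (int r - 2) (vac V) else 0))"
    proof (intro sum.cong refl arg_cong2[of _ _ _ _ "(+)"])
        fix j
        have "int r + int j = 1 \<longleftrightarrow> j = 1 - r" using r by auto
        then show "B (- 1 - int j) (int r + int j) (sf_gen n e f b) = (if j = 1 - r then - X b (int r - 2) (vac V) else 0)"
          unfolding x B_X[OF assms] using r by (auto simp: B_vac X_linear)
        show "B (int r - 1 - int j) (int j) (sf_gen n e f b) = (if j = 1 then - X b (int r - 2) (vac V) else 0)"
          unfolding x B_X[OF assms] using r by (auto simp: B_vac X_linear vac)
    qed
    also have "\<dots> = (- 2) *s X b (int r - 2) (vac V)"
    proof -
      have "1 - r < N" "1 < N" by (auto simp: N_def)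
      then show ?thesis using scale_left_distrib[of 1 1 "X b (int r - 2) (vac V)"] by (simp add: sum.distrib)
    qed
    finally show ?thesis .
  qed
  show "nprod V L 0 (sf_gen n e f b) = D (sf_gen n e f b)"
    using *[of 0] by (simp add: sf_conformal_qvec nprod_simps X_def deriv_op_def)
  show "nprod V L 1 (sf_gen n e f b) = sf_gen n e f b"
    using *[of 1] by (simp add: sf_conformal_qvec nprod_simps X_def creation)
qed

lemma L_nprod:
  "nprod V L 0 (nprod V a m b) = nprod V a m (nprod V L 0 b) + nprod V (nprod V L 0 a) m b"
  "nprod V L 1 (nprod V a m b) = nprod V a m (nprod V L 1 b) + nprod V (nprod V L 0 a) (m + 1) b
     + nprod V (nprod V L 1 a) m b"
proof -
  obtain N0 where N0: "\<And>m. m \<ge> N0 \<Longrightarrow> nprod V L m a = 0" using truncation by blast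
  define N where "N = Suc (Suc (nat N0))"
  have c: "nprod V L i (nprod V a m b) - nprod V a m (nprod V L i b)
       = (\<Sum>j<N. (of_int i gchoose j) *s nprod V (nprod V L (int j) a) (i + m - int j) b)" for i
    by (rule commutator_even[OF L_even]) (auto intro!: N0 simp: N_def)
  have "(\<Sum>j<N. (of_int 0 gchoose j) *s nprod V (nprod V L (int j) a) (0 + m - int j) b)
      = (\<Sum>j<1. (of_int 0 gchoose j) *s nprod V (nprod V L (int j) a) (0 + m - int j) b)"
    by (rule sum.mono_neutral_right) (auto simp: N_def gbinomial_0_left_if)
  then show "nprod V L 0 (nprod V a m b) = nprod V a m (nprod V L 0 b) + nprod V (nprod V L 0 a) m b"
    using c[of 0] by (simp add: algebra_simps)
  have "(1::complex) gchoose j = 0" if "j \<ge> 2" for j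
    using that binomial_gbinomial[of 1 j, where ?'a = complex] by (simp add: binomial_eq_0)
  then have "(\<Sum>j<N. (of_int 1 gchoose j) *s nprod V (nprod V L (int j) a) (1 + m - int j) b)
      = (\<Sum>j<2. (of_int 1 gchoose j) *s nprod V (nprod V L (int j) a) (1 + m - int j) b)"
    by (intro sum.mono_neutral_right) (auto simp: N_def)
  then show "nprod V L 1 (nprod V a m b) = nprod V a m (nprod V L 1 b) + nprod V (nprod V L 0 a) (m + 1) b
     + nprod V (nprod V L 1 a) m b"
    using c[of 1] by (simp add: numeral_2_eq_2 algebra_simps)
qed

text \<open>Both sides are derivations of all products, agree on the generators and kill the
  vacuum.\<close>

lemma L_translation: "nprod V L 0 v = D v"
proof (induction v rule: V_induct)
  case (cr p v)
  let ?m = "- 1 - int (snd p)"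
  have "nprod V L 0 (X (fst p) ?m v) = D (X (fst p) ?m v)"
    using cr by (simp add: X_def L_nprod D_nprod L_gen I_def)
  then show ?case by (simp add: cr_X nprod_simps D_scale)
qed (simp_all add: nprod_simps D_add D_scale vac_right D_vac)

definition has_wt :: "int \<Rightarrow> 'v \<Rightarrow> bool" where
  "has_wt d v \<longleftrightarrow> nprod V L 1 v = of_int d *s v"

lemma has_wt_add: "has_wt d u \<Longrightarrow> has_wt d v \<Longrightarrow> has_wt d (u + v)" and has_wt_scale: "has_wt d u \<Longrightarrow> has_wt d (t *s u)"
  and has_wt_0: "has_wt d 0" and has_wt_diff: "has_wt d u \<Longrightarrow> has_wt d v \<Longrightarrow> has_wt d (u - v)"
  by (simp_all add: has_wt_def nprod_simps scale_right_distrib scale_right_diff_distrib mult.commute)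

lemma has_wt_minus: "has_wt d u \<Longrightarrow> has_wt d (- u)"
  by (simp add: has_wt_def nprod_simps)

lemma has_wt_sum: "(\<And>i. i \<in> A \<Longrightarrow> has_wt d (G i)) \<Longrightarrow> has_wt d (\<Sum>i\<in>A. G i)"
  by (induction A rule: infinite_finite_induct) (simp_all add: has_wt_0 has_wt_add)

lemma has_wt_span: "(\<And>s. s \<in> T \<Longrightarrow> has_wt d s) \<Longrightarrow> v \<in> span T \<Longrightarrow> has_wt d v"
proof -
  assume *: "\<And>s. s \<in> T \<Longrightarrow> has_wt d s" "v \<in> span T"
  have "subspace {v. has_wt d v}" by (auto simp: subspace_def has_wt_0 has_wt_add has_wt_scale)
  then have "span T \<subseteq> {v. has_wt d v}" using *(1) by (intro span_minimal) auto
  then show ?thesis using *(2) by auto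
qed

lemma has_wt_vac: "has_wt 0 (vac V)"
  by (simp add: has_wt_def vac_right)

lemma has_wt_nprod: "has_wt c a \<Longrightarrow> has_wt d b \<Longrightarrow> i = c + d - m - 1 \<Longrightarrow> has_wt i (nprod V a m b)"
proof -
  assume *: "has_wt c a" "has_wt d b" "i = c + d - m - 1"
  have "nprod V L 1 (nprod V a m b)
      = of_int d *s nprod V a m b + of_int (- (m + 1)) *s nprod V a m b + of_int c *s nprod V a m b"
    using *(1,2) by (simp add: has_wt_def L_nprod L_translation nprod_D nprod_simps del: of_int_add of_int_minus)
  also have "\<dots> = of_int i *s nprod V a m b"
    by (simp only: scale_left_distrib[symmetric] of_int_add[symmetric] *(3)) (simp add: algebra_simps)
  finally show ?thesis by (simp add: has_wt_def)
qed

lemma has_wt_D: "has_wt d a \<Longrightarrow> has_wt (d + 1) (D a)"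
  unfolding deriv_op_def by (rule has_wt_nprod[OF _ has_wt_vac]) auto

lemma has_wt_D_pow: "has_wt d a \<Longrightarrow> has_wt (d + int k) ((D ^^ k) a)"
proof (induction k)
  case (Suc k)
  then show ?case using has_wt_D[of "d + int k" "(D ^^ k) a"] by (simp add: algebra_simps)
qed simp

lemma has_wt_gen: "b < 2 * n \<Longrightarrow> has_wt 1 (sf_gen n e f b)"
  by (simp add: has_wt_def L_gen)

lemma has_wt_quad: "has_wt d v \<Longrightarrow> has_wt (int k + int l + 2 + d) (quad k l v)"
  unfolding quad_def cr_def wick_def fst_conv snd_conv
  by (intro has_wt_sum has_wt_scale has_wt_nprod[where c = "1 + int k" and d = "1 + int l + d"]
      has_wt_nprod[where c = "1 + int l" and d = d] has_wt_D_pow has_wt_gen)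
    (auto simp: partner_less)

lemma has_wt_qvec: "has_wt (int k + int l + 2) (qvec k l)"
  using has_wt_quad[OF has_wt_vac] by (simp add: qvec_def)

lemma has_wt_distinct: "has_wt c v \<Longrightarrow> has_wt d v \<Longrightarrow> c \<noteq> d \<Longrightarrow> v = 0"
  unfolding has_wt_def by (metis of_int_eq_iff scale_right_imp_eq)

text \<open>Mode 1 of \<open>L\<close> minus the scalar \<open>c\<close> removes the summand of
  weight \<open>c\<close> and rescales the others by nonzero factors.\<close>

lemma has_wt_independent:
  assumes "finite A" "\<And>d. d \<in> A \<Longrightarrow> has_wt d (G d)" "(\<Sum>d\<in>A. G d) = 0" "d \<in> A"
  shows "G d = 0"
  using assms
proof (induction A arbitrary: G d rule: finite_induct)
  case (insert c A)
  let ?G = "\<lambda>d. of_int (d - c) *s G d"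
  have "nprod V L 1 (\<Sum>d\<in>insert c A. G d) = (\<Sum>d\<in>insert c A. of_int d *s G d)"
    using insert.prems(1) by (simp only: nprod_simps has_wt_def cong: sum.cong)
  then have "(\<Sum>d\<in>insert c A. of_int d *s G d) - of_int c *s (\<Sum>d\<in>insert c A. G d) = 0"
    using insert.prems(2) by (simp only: nprod_simps scale_zero_right diff_zero)
  then have "(\<Sum>d\<in>insert c A. ?G d) = 0"
    by (simp only: scale_sum_right sum_subtractf[symmetric] scale_left_diff_distrib of_int_diff)
  then have "(\<Sum>d\<in>A. ?G d) = 0" using insert.hyps by simp
  then have "?G d = 0" if "d \<in> A" for d
    using insert.IH[of ?G d] insert.prems(1) that by (auto intro: has_wt_scale)
  then have *: "G d = 0" if "d \<in> A" for d using that insert.hyps(2) by auto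
  then have "G c = 0" using insert.prems(2) insert.hyps by simp
  then show ?case using * insert.prems(3) by auto
qed simp

text \<open>Collecting a combination by weight, all components of weight other than \<open>d\<close>
  vanish by independence of eigenvectors. This is what allows inductions on weight over spanning
  sets of words.\<close>

lemma has_wt_homogeneous_part:
  assumes T: "\<And>s. s \<in> T \<Longrightarrow> \<exists>d. has_wt d s" and v: "v \<in> span T" "has_wt d v"
  shows "v \<in> span {s \<in> T. has_wt d s}"
proof -
  have "\<exists>A G. finite A \<and> v = (\<Sum>d\<in>A. G d) \<and> (\<forall>d. G d \<in> span {s \<in> T. has_wt d s})" using v(1)
  proof (induction rule: span_induct_alt)
    case base
    show ?case by (intro exI[of _ "{}"] exI[of _ "\<lambda>_. 0"]) (simp add: span_zero)
  next
    case (step t s u)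
    then obtain A G where A: "finite A" "u = (\<Sum>d\<in>A. G d)" "\<And>d. G d \<in> span {s \<in> T. has_wt d s}" by blast
    obtain c where c: "has_wt c s" using T step by blast
    let ?G = "\<lambda>d. (if d \<in> A then G d else 0) + (if d = c then t *s s else 0)"
    have "(\<Sum>d\<in>insert c A. ?G d) = (\<Sum>d\<in>insert c A. if d \<in> A then G d else 0) + t *s s"
      using A(1) by (simp add: sum.distrib)
    also have "(\<Sum>d\<in>insert c A. if d \<in> A then G d else 0) = (\<Sum>d\<in>A. G d)"
      using A(1) by (intro sum.mono_neutral_cong_right) auto
    finally have "t *s s + u = (\<Sum>d\<in>insert c A. ?G d)" using A(2) by (simp add: add.commute)
    moreover have "?G d \<in> span {s \<in> T. has_wt d s}" for d
    proof -
      have "(if d \<in> A then G d else 0) \<in> span {s \<in> T. has_wt d s}" using A(3) by (simp add: span_zero)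
      moreover have "(if d = c then t *s s else 0) \<in> span {s \<in> T. has_wt d s}"
        using c step(1) by (simp add: span_zero span_scale span_base)
      ultimately show ?thesis by (rule span_add)
    qed
    ultimately show ?case using A(1) by (intro exI[of _ "insert c A"] exI[of _ ?G]) auto
  qed
  then obtain A G where A: "finite A" "v = (\<Sum>d\<in>A. G d)" "\<And>d. G d \<in> span {s \<in> T. has_wt d s}" by blast
  have hG: "has_wt c (G c)" for c using has_wt_span[OF _ A(3)] by auto
  let ?H = "\<lambda>c. (if c \<in> A then G c else 0) - (if c = d then v else 0)"
  have "(\<Sum>c\<in>insert d A. if c \<in> A then G c else 0) = (\<Sum>d\<in>A. G d)"
    using A(1) by (intro sum.mono_neutral_cong_right) auto
  then have "(\<Sum>c\<in>insert d A. ?H c) = 0" using A(1,2) by (simp add: sum_subtractf)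
  then have "?H d = 0"
    using A(1) hG v(2) by (intro has_wt_independent[of "insert d A" ?H]) (auto intro!: has_wt_diff has_wt_minus has_wt_0)
  then show ?thesis using A(3)[of d] by (auto simp: span_zero split: if_splits)
qed

section \<open>Strong generation\<close>

text \<open>A creation mode paired with an annihilation mode acts as a derivation: it replaces a
  letter with \<open>q - 1\<close> derivatives by the same letter with \<open>p\<close>
  derivatives.\<close>

lemma B_quad:
  assumes "q \<ge> 1"
  shows "B (- 1 - int p) (int q) (quad k l u) =
      (if q = Suc k then - (fact q / fact p) *s quad p l u else 0)
    + (if q = Suc l then - (fact q / fact p) *s quad k p u else 0) + quad k l (B (- 1 - int p) (int q) u)"
proof -
  have Bcr: "B (- 1 - int p) (int q) (cr (b, k) u) = (if q = Suc k then - (fact q / fact p) *s cr (b, p) u else 0)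
      + cr (b, k) (B (- 1 - int p) (int q) u)" if "b < 2 * n" for b k u
  proof -
    have "int q + (- 1 - int k) = 0 \<longleftrightarrow> q = Suc k" by auto
    moreover have "- 1 - int p + (- 1 - int k) \<noteq> 0" by simp
    ultimately have *: "B (- 1 - int p) (int q) (cr (b, k) u) = fact k *s (X b (- 1 - int k) (B (- 1 - int p) (int q) u)
        + (if q = Suc k then of_int (- int (Suc k)) *s X b (- 1 - int p) u else 0))"
      by (simp add: cr_X B_linear B_X[OF that])
    have "fact k * of_int (- int (Suc k)) = - (fact (Suc k) / fact p) * (fact p :: complex)"
      by (simp add: field_simps)
    then have "fact k *s of_int (- int (Suc k)) *s X b (- 1 - int p) u = - (fact (Suc k) / fact p) *s cr (b, p) u"
      by (simp only: cr_X fst_conv snd_conv scale_scale)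
    then show ?thesis unfolding *
      by (cases "q = Suc k") (simp_all only: scale_right_distrib if_True if_False simp_thms cr_X[of "(b, k)"] fst_conv snd_conv
          scale_zero_right add_0 add_0_right add.commute)
  qed
  have "B (- 1 - int p) (int q) (quad k l u) = (\<Sum>a<2 * n.
      (if q = Suc k then - (fact q / fact p) *s (sg n a *s cr (a, p) (cr (partner n a, l) u)) else 0)
    + (if q = Suc l then - (fact q / fact p) *s (sg n a *s cr (a, k) (cr (partner n a, p) u)) else 0)
    + sg n a *s cr (a, k) (cr (partner n a, l) (B (- 1 - int p) (int q) u)))"
    unfolding quad_def B_sum B_linear
  proof (rule sum.cong[OF refl])
    fix a assume "a \<in> {..<2 * n}"
    then have a: "a < 2 * n" "partner n a < 2 * n" by (auto simp: partner_less)
    have s: "sg n a * - c = - (c * sg n a)" for c by simp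
    show "sg n a *s B (- 1 - int p) (int q) (cr (a, k) (cr (partner n a, l) u)) =
      (if q = Suc k then - (fact q / fact p) *s (sg n a *s cr (a, p) (cr (partner n a, l) u)) else 0)
    + (if q = Suc l then - (fact q / fact p) *s (sg n a *s cr (a, k) (cr (partner n a, p) u)) else 0)
    + sg n a *s cr (a, k) (cr (partner n a, l) (B (- 1 - int p) (int q) u))"
      unfolding Bcr[OF a(1)] Bcr[OF a(2)]
      by (cases "q = Suc k"; cases "q = Suc l")
        (simp_all add: cr_linear scale_right_distrib scale_right_diff_distrib mult.commute[of "sg n a"] s del: fact_Suc)
  qed
  then show ?thesis by (auto simp: sum.distrib quad_def scale_sum_right)
qed

text \<open>In \<open>qvec_mode\<close> the first term with \<open>j = 0\<close> is
  \<open>quad k l v\<close>. Elsewhere the inner mode either is a creation mode, whose coefficient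
  vanishes by \<open>dcoeff_zero\<close>, or is some \<open>q >= 0\<close>, and then the total
  weight determines the outer mode.\<close>

lemma qvec_wick:
  "nprod V (qvec k l) (-1) v - quad k l v \<in> span {B (- 1 - int (q + k + l + 1)) (int q) v | q. True}"
proof -
  let ?T = "{B (- 1 - int (q + k + l + 1)) (int q) v | q. True}"
  obtain N0 where N0: "\<And>N. N \<ge> N0 \<Longrightarrow> nprod V (qvec k l) (-1) v = (\<Sum>j<N.
      (dcoeff k (- 1 - int j) * dcoeff l (-1 + int j)) *s B (- 1 - int j - int k) (-1 + int j - int l) v
    + (dcoeff l (- 1 - 1 - int j) * dcoeff k (int j)) *s B (-1 - 1 - int j - int l) (int j - int k) v)"
    using qvec_mode[of k l "-1" v] by blast
  let ?f = "\<lambda>j. (dcoeff k (- 1 - int j) * dcoeff l (-1 + int j)) *s B (- 1 - int j - int k) (-1 + int j - int l) v"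
  let ?g = "\<lambda>j. (dcoeff l (- 1 - 1 - int j) * dcoeff k (int j)) *s B (-1 - 1 - int j - int l) (int j - int k) v"
  have f0: "?f 0 = quad k l v"
    using dcoeff_neg[of k 0] dcoeff_neg[of l 0] by (simp add: quad_B)
  have f: "?f (Suc j) \<in> span ?T" for j
  proof (cases "j < l")
    case True
    then show ?thesis by (simp add: dcoeff_zero span_zero)
  next
    case False
    then have "B (- 1 - int (Suc j) - int k) (-1 + int (Suc j) - int l) v
        = B (- 1 - int ((j - l) + k + l + 1)) (int (j - l)) v"
      by (intro arg_cong2[of _ _ _ _ "\<lambda>x y. B x y v"]) auto
    also have "\<dots> \<in> ?T" by blast
    finally show ?thesis by (intro span_scale span_base)
  qed
  have g: "?g j \<in> span ?T" for j
  proof (cases "j < k")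
    case True
    then show ?thesis by (simp add: dcoeff_zero span_zero)
  next
    case False
    then have "B (-1 - 1 - int j - int l) (int j - int k) v = B (- 1 - int ((j - k) + k + l + 1)) (int (j - k)) v"
      by (intro arg_cong2[of _ _ _ _ "\<lambda>x y. B x y v"]) auto
    also have "\<dots> \<in> ?T" by blast
    finally show ?thesis by (intro span_scale span_base)
  qed
  have "nprod V (qvec k l) (-1) v = (\<Sum>j<Suc N0. ?f j + ?g j)" by (rule N0) simp
  also have "\<dots> = quad k l v + ((\<Sum>j<N0. ?f (Suc j)) + (\<Sum>j<Suc N0. ?g j))"
    unfolding sum.distrib sum.lessThan_Suc_shift[of ?f] f0 by (simp only: add.assoc)
  finally have "nprod V (qvec k l) (-1) v - quad k l v = (\<Sum>j<N0. ?f (Suc j)) + (\<Sum>j<Suc N0. ?g j)"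
    by (simp only: add_diff_cancel_left')
  moreover have "\<dots> \<in> span ?T" by (intro span_add span_sum f g)
  ultimately show ?thesis by (simp only:)
qed

section \<open>Words in the quadratic invariants\<close>

definition qwt :: "(nat \<times> nat) list \<Rightarrow> nat" where
  "qwt ws = sum_list (map (\<lambda>(k, l). k + l + 2) ws)"

lemma has_wt_qword: "has_wt (int (qwt ws)) (qword ws)"
proof (induction ws)
  case Nil
  then show ?case by (simp add: qwt_def qword_def has_wt_vac)
next
  case (Cons p ws)
  then show ?case using has_wt_quad[of "int (qwt ws)" "qword ws" "fst p" "snd p"]
    by (simp add: qwt_def qword_def split_def algebra_simps)
qed

lemma quad_span:
  assumes "u \<in> span {qword ws | ws. P ws}" "\<And>ws. P ws \<Longrightarrow> Q ((k, l) # ws)"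
  shows "quad k l u \<in> span {qword ws | ws. Q ws}"
proof -
  show ?thesis
  proof (rule linear_span_closed[OF quad_linear(1,2) _ assms(1)])
    fix s assume "s \<in> {qword ws | ws. P ws}"
    then obtain ws where "s = qword ws" "P ws" by blast
    then have "quad k l s = qword ((k, l) # ws)" "Q ((k, l) # ws)" by (simp_all add: qword_def assms(2))
    then show "quad k l s \<in> span {qword ws | ws. Q ws}" by (intro span_base) auto
  qed
qed

text \<open>Each correction term in \<open>qvec_wick\<close> keeps the length of the word, whereas
  \<open>quad\<close> adds a letter; hence corrections are shorter than the leading term.\<close>

lemma B_qword:
  "B (- 1 - int (q + r)) (int q) (qword ws)
    \<in> span {qword ws' | ws'. length ws' = length ws \<and> qwt ws' = qwt ws + r + 1}"
proof (cases "q = 0")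
  case True
  then show ?thesis by (simp add: B_zero_mode span_zero)
next
  case False
  then have q: "q \<ge> 1" by simp
  show ?thesis
  proof (induction ws)
    case Nil
    then show ?case by (simp add: qword_def B_vac span_zero)
  next
    case (Cons p ws)
    obtain k l where p: "p = (k, l)" by force
    let ?T = "{qword ws' | ws'. length ws' = length (p # ws) \<and> qwt ws' = qwt (p # ws) + r + 1}"
    have mem: "qword ((k', l') # ws) \<in> span ?T" if "k' + l' = k + l + r + 1" for k' l'
      by (rule span_base) (use that in \<open>auto simp: qwt_def p intro!: exI[of _ "(k', l') # ws"]\<close>)
    have "quad k l (B (- 1 - int (q + r)) (int q) (qword ws)) \<in> span ?T"
      by (rule quad_span[OF Cons.IH]) (auto simp: qwt_def p)
    moreover have "(if q = Suc k then - (fact q / fact (q + r)) *s quad (q + r) l (qword ws) else 0) \<in> span ?T"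
      using mem[of "q + r" l] by (auto simp: qword_def span_zero span_neg span_scale)
    moreover have "(if q = Suc l then - (fact q / fact (q + r)) *s quad k (q + r) (qword ws) else 0) \<in> span ?T"
      using mem[of k "q + r"] by (auto simp: qword_def span_zero span_neg span_scale)
    ultimately have "B (- 1 - int (q + r)) (int q) (quad k l (qword ws)) \<in> span ?T"
      unfolding B_quad[OF q] by (intro span_add)
    then show ?case by (simp add: qword_def p)
  qed
qed

lemma D_qvec: "D (qvec k l) = qvec (Suc k) l + qvec k (Suc l)"
  unfolding qvec_eq D_sum D_scale D_nprod by (simp add: scale_right_distrib sum.distrib)

section \<open>Wick monomials in the proposed generators\<close>

text \<open>Here a letter \<open>(m, k)\<close> stands for the \<open>k\<close>-th derivative of \<open>2 j\<^sup>2\<^sup>m\<close>.\<close>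

definition jmon :: "(nat \<times> nat) list \<Rightarrow> 'v" where
  "jmon ws = foldr (\<lambda>(m, k). nprod V ((D ^^ k) (qvec 0 (2 * m))) (-1)) ws (vac V)"

definition jweight :: "(nat \<times> nat) list \<Rightarrow> nat" where
  "jweight ws = sum_list (map (\<lambda>(m, k). 2 * m + 2 + k) ws)"

definition jword :: "(nat \<times> nat) list \<Rightarrow> bool" where
  "jword ws \<longleftrightarrow> (\<forall>p\<in>set ws. fst p < n)"

definition jspan :: "'v set" where
  "jspan = span {jmon ws | ws. jword ws}"

lemma jmon_Cons: "jmon ((m, k) # ws) = nprod V ((D ^^ k) (qvec 0 (2 * m))) (-1) (jmon ws)"
  by (simp add: jmon_def)

lemma has_wt_jmon: "has_wt (int (jweight ws)) (jmon ws)"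
proof (induction ws)
  case Nil
  then show ?case by (simp add: jweight_def jmon_def has_wt_vac)
next
  case (Cons p ws)
  obtain m k where p: "p = (m, k)" by force
  show ?case unfolding p jmon_Cons
    by (rule has_wt_nprod[OF has_wt_D_pow[OF has_wt_qvec] Cons.IH]) (simp add: jweight_def)
qed

lemma orb_closed: "subspace orb" "vac V \<in> orb" "a \<in> orb \<Longrightarrow> b \<in> orb \<Longrightarrow> nprod V a m b \<in> orb"
  using orb_subalgebra by (auto simp: vertex_subalgebra_def)

lemma orb_qvec: "qvec k l \<in> orb"
  unfolding qvec_def quad_B using orb_closed by (intro subspace_scale orb_B)

lemma orb_D_pow: "a \<in> orb \<Longrightarrow> (D ^^ k) a \<in> orb"
proof (induction k)
  case (Suc k)
  then show ?case using orb_closed(3)[OF _ orb_closed(2), of "(D ^^ k) a" "-2"] by (simp add: deriv_op_def[of V "(D ^^ k) a"])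
qed simp

lemma orb_jmon: "jmon ws \<in> orb"
proof (induction ws)
  case (Cons p ws)
  then show ?case by (cases p) (simp add: jmon_Cons orb_closed orb_D_pow orb_qvec)
qed (simp add: jmon_def orb_closed)

lemma jspan_orb: "jspan \<subseteq> orb"
  unfolding jspan_def by (intro span_minimal orb_closed) (auto simp: orb_jmon)

lemma jspan_letter:
  assumes "u \<in> jspan" "m < n"
  shows "nprod V ((D ^^ k) (qvec 0 (2 * m))) (-1) u \<in> jspan"
  unfolding jspan_def
proof (rule linear_span_closed[OF _ _ _ assms(1)[unfolded jspan_def]])
  fix s assume "s \<in> {jmon ws | ws. jword ws}"
  then obtain ws where "s = jmon ws" "jword ws" by blast
  then have "nprod V ((D ^^ k) (qvec 0 (2 * m))) (-1) s = jmon ((m, k) # ws)" "jword ((m, k) # ws)"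
    using assms(2) by (simp_all add: jmon_Cons jword_def)
  then show "nprod V ((D ^^ k) (qvec 0 (2 * m))) (-1) s \<in> span {jmon ws | ws. jword ws}" by (intro span_base) auto
qed (simp_all add: nprod_simps)

lemma jspan_closed: "u \<in> jspan \<Longrightarrow> v \<in> jspan \<Longrightarrow> u + v \<in> jspan" "u \<in> jspan \<Longrightarrow> t *s u \<in> jspan" "0 \<in> jspan" "vac V \<in> jspan"
  "u \<in> jspan \<Longrightarrow> v \<in> jspan \<Longrightarrow> u - v \<in> jspan"
proof -
  have "vac V = jmon []" "jword []" by (simp_all add: jmon_def jword_def)
  then show "vac V \<in> jspan" unfolding jspan_def by (intro span_base) auto
qed (simp_all add: jspan_def span_add span_scale span_zero span_diff)

lemma jspan_subspace: "subspace jspan"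
  by (simp add: jspan_def)

lemma jspan_sum: "(\<And>i. i \<in> A \<Longrightarrow> G i \<in> jspan) \<Longrightarrow> (\<Sum>i\<in>A. G i) \<in> jspan"
  by (simp add: jspan_def span_sum)

text \<open>Length and weight are tracked for the sake of \<open>jspan_wick_word\<close>, which is
  an induction on length under a bound on the weight.\<close>

lemma D_jmon: "jword ws \<Longrightarrow>
  D (jmon ws) \<in> span {jmon ws' | ws'. jword ws' \<and> length ws' = length ws \<and> jweight ws' = Suc (jweight ws)}"
proof (induction ws)
  case Nil
  then show ?case by (simp add: jmon_def D_vac span_zero)
next
  case (Cons p ws)
  obtain m k where p: "p = (m, k)" by force
  let ?T = "{jmon ws' | ws'. jword ws' \<and> length ws' = length (p # ws) \<and> jweight ws' = Suc (jweight (p # ws))}"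
  let ?T' = "{jmon ws' | ws'. jword ws' \<and> length ws' = length ws \<and> jweight ws' = Suc (jweight ws)}"
  have m: "m < n" and ws: "jword ws" using Cons.prems by (auto simp: jword_def p)
  have "jmon ((m, Suc k) # ws) \<in> ?T"
    using m ws by (auto simp: jword_def jweight_def p intro!: exI[of _ "(m, Suc k) # ws"])
  then have 1: "nprod V ((D ^^ Suc k) (qvec 0 (2 * m))) (-1) (jmon ws) \<in> span ?T"
    unfolding jmon_Cons by (rule span_base)
  have mem: "jmon ((m, k) # ws') \<in> ?T" if "jword ws'" "length ws' = length ws" "jweight ws' = Suc (jweight ws)" for ws'
    using m that by (auto simp: jword_def jweight_def p intro!: exI[of _ "(m, k) # ws'"])
  have "nprod V ((D ^^ k) (qvec 0 (2 * m))) (-1) (D (jmon ws)) \<in> span ?T"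
    by (rule linear_span_closed[where f = "nprod V ((D ^^ k) (qvec 0 (2 * m))) (-1)", OF _ _ _ Cons.IH[OF ws]])
      (use mem in \<open>auto simp: nprod_simps jmon_Cons intro!: span_base\<close>)
  then show ?case using 1 unfolding p jmon_Cons D_nprod by (simp add: span_add)
qed

lemma D_pow_jmon: "jword ws \<Longrightarrow>
  (D ^^ j) (jmon ws) \<in> span {jmon ws' | ws'. jword ws' \<and> length ws' = length ws \<and> jweight ws' = jweight ws + j}"
proof (induction j)
  case 0
  then show ?case by (auto intro!: span_base)
next
  case (Suc j)
  let ?T = "\<lambda>j. {jmon ws' | ws'. jword ws' \<and> length ws' = length ws \<and> jweight ws' = jweight ws + j}"
  have mem: "D (jmon ws') \<in> span (?T (Suc j))" if "jword ws'" "length ws' = length ws" "jweight ws' = jweight ws + j" for ws'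
    using D_jmon[OF that(1)] that by simp
  have "D ((D ^^ j) (jmon ws)) \<in> span (?T (Suc j))"
    by (rule linear_span_closed[where f = D, OF _ _ _ Suc.IH[OF Suc.prems]]) (use mem in \<open>auto simp: D_add D_scale\<close>)
  then show ?case by simp
qed

lemma jspan_D:
  assumes "u \<in> jspan"
  shows "D u \<in> jspan"
  unfolding jspan_def
proof (rule linear_span_closed[OF D_add D_scale _ assms[unfolded jspan_def]])
  fix s assume "s \<in> {jmon ws | ws. jword ws}"
  then obtain ws where "s = jmon ws" "jword ws" by blast
  then show "D s \<in> span {jmon ws | ws. jword ws}"
    using D_jmon by (auto intro!: subsetD[OF span_mono D_jmon])
qed

text \<open>Regrouping a Wick product produces terms in which some nonnegative mode has acted. They
  contain an invariant of weight below \<open>d\<close>, which lies in \<open>jspan\<close> by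
  \<open>low\<close>; outer modes acting on it are then handled letter by letter or by the induction
  on length.\<close>

lemma jspan_wick_word:
  assumes low: "\<And>u d'. u \<in> orb \<Longrightarrow> has_wt d' u \<Longrightarrow> d' < d \<Longrightarrow> u \<in> jspan"
    and "jword ws" "b \<in> jspan" "has_wt \<beta> b" "int (jweight ws) + \<beta> \<le> d"
  shows "nprod V (jmon ws) (-1) b \<in> jspan"
  using assms(2-)
proof (induction "length ws" arbitrary: ws b \<beta>)
  case 0
  then show ?case by (simp add: jmon_def vac_left)
next
  case (Suc len)
  obtain m k ws' where ws: "ws = (m, k) # ws'" using Suc.hyps(2) by (cases ws) auto
  let ?x = "(D ^^ k) (qvec 0 (2 * m))" and ?a = "jmon ws'"
  let ?dx = "2 * int m + 2 + int k"
  have m: "m < n" and ok': "jword ws'" using Suc.prems(1) by (auto simp: ws jword_def)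
  have len: "len = length ws'" using Suc.hyps(2) by (simp add: ws)
  have jweight: "int (jweight ws) = ?dx + int (jweight ws')" by (simp add: ws jweight_def)
  have "has_wt (int 0 + int (2 * m) + 2 + int k) ?x" by (rule has_wt_D_pow[OF has_wt_qvec])
  then have hx: "has_wt ?dx ?x" by simp
  have bO: "b \<in> orb" using Suc.prems(2) jspan_orb by blast
  have letter: "nprod V ?x (- 1 - int j) u \<in> jspan" if "u \<in> jspan" for j u
    unfolding nprod_lt_neg1 using jspan_letter[OF that m, of "j + k"]
    by (intro jspan_closed) (simp add: funpow_add)
  obtain N0 where N0: "N0 \<ge> 0" "\<And>j. j \<ge> N0 \<Longrightarrow> nprod V ?a j b = 0" "\<And>j. j \<ge> N0 \<Longrightarrow> nprod V ?x j b = 0"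
    using truncation_uniform[of "{(?a, b), (?x, b)}"] by auto
  define N where "N = Suc (nat N0)"
  have "nprod V (jmon ws) (-1) b = (\<Sum>j<N. nprod V ?x (-1 - int j) (nprod V ?a (int j - 1) b)
             + nprod V ?a (-2 - int j) (nprod V ?x (int j) b))"
    unfolding ws jmon_Cons
    by (rule iterate_even) (use N0 in \<open>auto simp: N_def intro: D_parity qvec_even\<close>)
  also have "\<dots> \<in> jspan"
  proof (intro jspan_sum jspan_closed)
    fix j
    have "nprod V ?a (int j - 1) b \<in> jspan"
    proof (cases j)
      case 0
      then show ?thesis using Suc.hyps(1)[OF len ok' Suc.prems(2,3)] Suc.prems(4) jweight by simp
    next
      case (Suc i)
      show ?thesis
        by (rule low[OF orb_closed(3)[OF orb_jmon bO] has_wt_nprod[OF has_wt_jmon \<open>has_wt \<beta> b\<close> refl]])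
          (use \<open>int (jweight ws) + \<beta> \<le> d\<close> jweight Suc in simp)
    qed
    then show "nprod V ?x (-1 - int j) (nprod V ?a (int j - 1) b) \<in> jspan" by (rule letter)
    let ?u = "nprod V ?x (int j) b"
    have hu: "has_wt (?dx + \<beta> - int j - 1) ?u" by (rule has_wt_nprod[OF hx \<open>has_wt \<beta> b\<close> refl])
    have uT: "?u \<in> jspan"
      by (rule low[OF orb_closed(3)[OF orb_D_pow[OF orb_qvec] bO] hu])
        (use \<open>int (jweight ws) + \<beta> \<le> d\<close> jweight in simp)
    \<comment> \<open>Up to a scalar, mode \<open>- 2 - int j\<close> is mode -1 of the derivative
      of order \<open>Suc j\<close>, a combination of words of the same length as
      \<open>ws'\<close>, so the induction hypothesis applies.\<close>
    let ?T = "{jmon ws'' | ws''. jword ws'' \<and> length ws'' = length ws' \<and> jweight ws'' = jweight ws' + Suc j}"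
    have mem: "nprod V (jmon ws'') (-1) ?u \<in> jspan"
      if "jword ws''" "length ws'' = length ws'" "jweight ws'' = jweight ws' + Suc j" for ws''
      by (rule Suc.hyps(1)[OF _ that(1) uT hu]) (use that len jweight \<open>int (jweight ws) + \<beta> \<le> d\<close> in auto)
    have "nprod V ((D ^^ Suc j) ?a) (-1) ?u \<in> jspan"
      unfolding jspan_def by (rule linear_span_closed[where f = "\<lambda>a. nprod V a (-1) ?u", OF _ _ _ D_pow_jmon[OF ok']])
        (use mem in \<open>auto simp: nprod_simps jspan_def\<close>)
    then have "nprod V ?a (-1 - int (Suc j)) ?u \<in> jspan"
      unfolding nprod_lt_neg1 by (rule jspan_closed(2))
    moreover have "-1 - int (Suc j) = -2 - int j" by simp
    ultimately show "nprod V ?a (-2 - int j) ?u \<in> jspan" by (simp only:)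
  qed
  finally show ?case .
qed

lemma jspan_wick:
  assumes low: "\<And>u d'. u \<in> orb \<Longrightarrow> has_wt d' u \<Longrightarrow> d' < d \<Longrightarrow> u \<in> jspan"
    and a: "a \<in> jspan" "has_wt \<alpha> a" and b: "b \<in> jspan" "has_wt \<beta> b" and d: "\<alpha> + \<beta> \<le> d"
  shows "nprod V a (-1) b \<in> jspan"
proof -
  let ?T = "{s \<in> {jmon ws | ws. jword ws}. has_wt \<alpha> s}"
  have a': "a \<in> span ?T"
    by (rule has_wt_homogeneous_part[OF _ _ a(2)]) (use a(1) has_wt_jmon in \<open>auto simp: jspan_def\<close>)
  have mem: "nprod V (jmon ws) (-1) b \<in> jspan" if "jword ws" "has_wt \<alpha> (jmon ws)" for ws
  proof (cases "\<alpha> = int (jweight ws)")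
    case True
    then show ?thesis using jspan_wick_word[OF low that(1) b] d by simp
  next
    case False
    then have "jmon ws = 0" using has_wt_distinct[OF that(2) has_wt_jmon] by simp
    then show ?thesis by (simp add: nprod_simps jspan_closed)
  qed
  show ?thesis
    unfolding jspan_def by (rule linear_span_closed[where f = "\<lambda>a. nprod V a (-1) b", OF _ _ _ a'])
      (use mem in \<open>auto simp: nprod_simps jspan_def\<close>)
qed

section \<open>The decoupling relation\<close>

lemma foldr_cr_nondistinct: "set w \<subseteq> I \<Longrightarrow> \<not> distinct w \<Longrightarrow> foldr cr w (vac V) = 0"
proof (induction w)
  case (Cons p w)
  show ?case
  proof (cases "p \<in> set w")
    case True
    have "cr p (foldr cr w (vac V)) = 0"
      by (rule foldr_repeat) (use True Cons.prems in \<open>auto simp: cr_linear intro: cr_cr\<close>)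
    then show ?thesis by simp
  next
    case False
    then show ?thesis using Cons by (simp add: cr_linear)
  qed
qed simp

text \<open>In the exterior algebra, the \<open>n\<close>-th power of \<open>\<Sum>\<^sub>i e\<^sub>i f\<^sub>i\<close> is divisible by all \<open>e\<^sub>i\<close> and \<open>f\<^sub>i\<close>.\<close>

lemma classical_relation: "quad 0 l ((quad 0 0 ^^ n) (vac V)) = 0"
proof -
  define Gd where "Gd d = span {foldr cr w (vac V) | w. set w \<subseteq> I_below 1 \<and> length w = d}" for d
  have cr: "cr p u \<in> Gd (Suc d)" if "u \<in> Gd d" "p \<in> I_below 1" for p u d
    unfolding Gd_def
  proof (rule linear_span_closed[OF cr_linear(1,2) _ that(1)[unfolded Gd_def]])
    fix s assume "s \<in> {foldr cr w (vac V) | w. set w \<subseteq> I_below 1 \<and> length w = d}"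
    then obtain w where "s = foldr cr w (vac V)" "set w \<subseteq> I_below 1" "length w = d" by blast
    then show "cr p s \<in> span {foldr cr w (vac V) | w. set w \<subseteq> I_below 1 \<and> length w = Suc d}"
      using that(2) by (intro span_base) (auto intro!: exI[of _ "p # w"])
  qed
  have quad: "(quad 0 0 ^^ i) (vac V) \<in> Gd (2 * i)" for i
  proof (induction i)
    case 0
    then show ?case unfolding Gd_def by (intro span_base) auto
  next
    case (Suc i)
    have "quad 0 0 u \<in> Gd (Suc (Suc d))" if "u \<in> Gd d" for u d
      unfolding quad_def
    proof (rule subspace_sum[of "Gd (Suc (Suc d))"])
      show sub: "subspace (Gd (Suc (Suc d)))" by (simp add: Gd_def)
      fix a assume "a \<in> {..<2 * n}"
      then show "sg n a *s cr (a, 0) (cr (partner n a, 0) u) \<in> Gd (Suc (Suc d))"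
        using that by (intro subspace_scale[OF sub] cr) (auto simp: I_below_def partner_less)
    qed
    then show ?case using Suc by simp
  qed
  have "cr (a, 0) ((quad 0 0 ^^ n) (vac V)) = 0" if "a < 2 * n" for a
  proof -
    have "cr (a, 0) ((quad 0 0 ^^ n) (vac V)) \<in> Gd (Suc (2 * n))"
      by (rule cr[OF quad]) (use that in \<open>simp add: I_below_def\<close>)
    moreover have "foldr cr w (vac V) = 0" if "set w \<subseteq> I_below 1" "length w = Suc (2 * n)" for w
    proof (rule foldr_cr_nondistinct)
      show "set w \<subseteq> I" using that(1) I_below_I by blast
      \<comment> \<open>A word of length 2n + 1 over the 2n letters without derivatives must repeat
        a letter.\<close>
      have "card (set w) \<le> card (I_below 1)" using that(1) by (intro card_mono) (auto simp: I_below_def)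
      then have "card (set w) \<noteq> length w" using that(2) by (simp add: I_below_def card_cartesian_product)
      then show "\<not> distinct w" using distinct_card by blast
    qed
    then have "Gd (Suc (2 * n)) \<subseteq> {0}"
      unfolding Gd_def by (intro span_minimal) auto
    ultimately show ?thesis by blast
  qed
  then have "cr (a, l) (cr (partner n a, 0) ((quad 0 0 ^^ n) (vac V))) = 0" if "a < 2 * n" for a
    using that by (simp add: partner_less cr_linear)
  then have "quad l 0 ((quad 0 0 ^^ n) (vac V)) = 0" by (simp add: quad_def)
  then show ?thesis by (simp add: quad_commute[of 0 l])
qed

text \<open>The power consists of 2i letters, all without derivatives, so the derivation acts only
  for \<open>q = 1\<close> and hits each of them once; this is the factor 2i. For
  \<open>i = 0\<close> the truncated exponent \<open>i - 1\<close> is harmless since the coefficient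
  is 0.\<close>

lemma B_quad_power:
  assumes "q \<ge> 1"
  shows "B (- 1 - int p) (int q) ((quad 0 0 ^^ i) (vac V))
    = (if q = 1 then - (2 * of_nat i / fact p) *s quad 0 p ((quad 0 0 ^^ (i - 1)) (vac V)) else 0)"
proof (induction i)
  case 0
  then show ?case by (simp add: B_vac)
next
  case (Suc i)
  have comm: "quad 0 0 (quad 0 p u) = quad 0 p (quad 0 0 u)" for u
  proof -
    have "cr (a, 0) (cr (partner n a, 0) (quad 0 p u)) = quad 0 p (cr (a, 0) (cr (partner n a, 0) u))" if a: "a < 2 * n" for a
    proof -
      have 1: "cr x (quad 0 p u) = quad 0 p (cr x u)" if x: "x \<in> I" for x u
      proof -
        have "cr x (cr (a, 0) (cr (partner n a, p) u)) = cr (a, 0) (cr (partner n a, p) (cr x u))" if "a < 2 * n" for a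
          using cr_cr[OF x, of "(a, 0)"] cr_cr[OF x, of "(partner n a, p)" u] that
          by (simp add: I_def partner_less cr_linear)
        then show ?thesis by (simp add: quad_def cr_linear)
      qed
      show ?thesis using a by (simp add: 1 I_def partner_less)
    qed
    then show ?thesis unfolding quad_def[of 0 0] by (simp add: quad_linear quad_sum)
  qed
  have "quad 0 0 ((quad 0 0 ^^ (i - 1)) (vac V)) = (quad 0 0 ^^ i) (vac V)" if "i > 0"
    using that by (cases i) auto
  then have third: "quad 0 0 (- (2 * of_nat i / fact p) *s quad 0 p ((quad 0 0 ^^ (i - 1)) (vac V)))
      = - (2 * of_nat i / fact p) *s quad 0 p ((quad 0 0 ^^ i) (vac V))"
  proof (cases "i = 0")
    case True
    then show ?thesis by (simp add: quad_linear)
  next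
    case False
    then show ?thesis unfolding quad_linear comm
      using \<open>i > 0 \<Longrightarrow> quad 0 0 ((quad 0 0 ^^ (i - 1)) (vac V)) = (quad 0 0 ^^ i) (vac V)\<close> by simp
  qed
  have coeff: "- (1 / fact p) + - (1 / fact p) + - (2 * of_nat i / fact p) = - (2 * of_nat (Suc i) / (fact p :: complex))"
    by (simp add: field_simps)
  show ?case
  proof (cases "q = 1")
    case True
    have "B (- 1 - int p) (int q) ((quad 0 0 ^^ Suc i) (vac V))
        = - (1 / fact p) *s quad 0 p ((quad 0 0 ^^ i) (vac V)) + - (1 / fact p) *s quad 0 p ((quad 0 0 ^^ i) (vac V))
        + - (2 * of_nat i / fact p) *s quad 0 p ((quad 0 0 ^^ i) (vac V))"
      using B_quad[OF assms, of p 0 0 "(quad 0 0 ^^ i) (vac V)"] Suc.IH third True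
      by (simp only: funpow.simps o_apply quad_commute[of p 0] One_nat_def simp_thms if_True fact_1 fact_Suc_0)
    then show ?thesis using True by (simp only: scale_left_distrib[symmetric] coeff if_True simp_thms diff_Suc_1)
  next
    case False
    then show ?thesis using B_quad[OF assms, of p 0 0 "(quad 0 0 ^^ i) (vac V)"] Suc.IH by (simp add: quad_linear)
  qed
qed

text \<open>The nonzero coefficient \<open>\<kappa>\<close> is what makes \<open>j\<^sup>2\<^sup>m\<close> with \<open>m \<ge> n\<close> decouple.\<close>

lemma qvec_wick_power:
  "\<exists>\<kappa>. \<kappa> \<noteq> 0 \<and> nprod V (qvec 0 (2 * k)) (-1) ((quad 0 0 ^^ i) (vac V))
    = quad 0 (2 * k) ((quad 0 0 ^^ i) (vac V)) + (\<kappa> * of_nat i) *s quad 0 (2 * k + 2) ((quad 0 0 ^^ (i - 1)) (vac V))"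
proof -
  define l where "l = 2 * k"
  let ?u = "(quad 0 0 ^^ i) (vac V)"
  let ?v = "B (- 1 - int (l + 2)) (int 1) ?u"
  \<comment> \<open>Annihilation mode 1 occurs once in each half of \<open>qvec_mode\<close>, and
    these are the two coefficients. As \<open>l\<close> is even, both are positive and cannot
    cancel; the witness given at the end only rescales this sum.\<close>
  define \<kappa> where "\<kappa> = dcoeff l (int l + 1) + dcoeff l (- 3)"
  have "(of_int (int l + 1) :: complex) = of_nat (Suc l)" by simp
  then have "dcoeff l (int l + 1) = fact l * of_nat (Suc l)"
    unfolding dcoeff_def by (simp only: binomial_gbinomial[symmetric]) (simp add: l_def)
  moreover have "dcoeff l (- 3) = fact (l + 2) / 2" using dcoeff_neg[of l 2] by (simp add: add.commute)
  ultimately have "\<kappa> = fact (Suc l) * of_nat (l + 4) / 2"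
    by (simp add: \<kappa>_def field_simps)
  moreover have "fact (Suc l) * (of_nat (l + 4) :: complex) \<noteq> 0"
    unfolding mult_eq_0_iff of_nat_eq_0_iff by (simp del: fact_Suc)
  ultimately have \<kappa>: "\<kappa> \<noteq> 0" by (simp only: divide_eq_0_iff) simp
  let ?f = "\<lambda>j. (dcoeff 0 (- 1 - int j) * dcoeff l (-1 + int j)) *s B (- 1 - int j - int 0) (-1 + int j - int l) ?u"
  let ?g = "\<lambda>j. (dcoeff l (- 1 - 1 - int j) * dcoeff 0 (int j)) *s B (-1 - 1 - int j - int l) (int j - int 0) ?u"
  obtain N0 where N0: "\<And>N. N \<ge> N0 \<Longrightarrow> nprod V (qvec 0 l) (-1) ?u = (\<Sum>j<N. ?f j + ?g j)"
    using qvec_mode[of 0 l "-1" ?u] by blast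
  define N where "N = N0 + l + 3"
  have B0: "B a b ?u = 0" if "a = - 1 - int p" "b = int q" "q \<noteq> 1" for a b p q
    using B_quad_power[of q p i] that by (cases "q = 0") (simp_all add: B_zero_mode)
  have f0: "?f 0 = quad 0 l ?u"
    using dcoeff_neg[of l 0] by (simp add: quad_B dcoeff_0)
  have f: "?f (Suc j) = (if j = Suc l then dcoeff l (int l + 1) *s ?v else 0)" for j
  proof -
    consider "j < l" | "j \<ge> l" "j \<noteq> Suc l" | "j = Suc l" by linarith
    then show ?thesis
    proof cases
      case 1
      then have "dcoeff l (-1 + int (Suc j)) = 0" by (intro dcoeff_zero) auto
      then show ?thesis using 1 by (simp only: mult_zero_right scale_zero_left) simp
    next
      case 2
      then have "B (- 1 - int (Suc j) - int 0) (-1 + int (Suc j) - int l) ?u = 0"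
        by (intro B0[of _ "Suc j" _ "j - l"]) auto
      then show ?thesis using 2(2) by (simp only: scale_zero_right if_False)
    next
      case 3
      then have "- 1 - int (Suc j) - int 0 = - 1 - int (l + 2)" "-1 + int (Suc j) - int l = int 1"
        "-1 + int (Suc j) = int l + 1" by auto
      then show ?thesis using 3 by (simp only: dcoeff_0 mult_1_left if_True simp_thms)
    qed
  qed
  have g: "?g j = (if j = 1 then dcoeff l (- 3) *s ?v else 0)" for j
  proof (cases "j = 1")
    case False
    then have "B (-1 - 1 - int j - int l) (int j - int 0) ?u = 0" by (intro B0[of _ "j + l + 1" _ j]) auto
    then show ?thesis using False by (simp only: scale_zero_right if_False)
  next
    case True
    then have "-1 - 1 - int j - int l = - 1 - int (l + 2)" "int j - int 0 = int 1" "- 1 - 1 - int j = -3" by auto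
    then show ?thesis using True by (simp only: dcoeff_0 mult_1_right if_True simp_thms)
  qed
  have N: "N = Suc (N0 + l + 2)" "Suc l < N0 + l + 2" "1 < N" by (simp_all add: N_def)
  have "nprod V (qvec 0 l) (-1) ?u = (\<Sum>j<N. ?f j + ?g j)" by (rule N0) (simp add: N_def)
  also have "\<dots> = ?f 0 + (\<Sum>j<N0 + l + 2. ?f (Suc j)) + (\<Sum>j<N. ?g j)"
    unfolding sum.distrib by (simp only: N(1) sum.lessThan_Suc_shift[of ?f])
  also have "(\<Sum>j<N0 + l + 2. ?f (Suc j)) = dcoeff l (int l + 1) *s ?v"
    unfolding f using N(2) by (subst sum.delta) auto
  also have "(\<Sum>j<N. ?g j) = dcoeff l (- 3) *s ?v"
    unfolding g using N(3) by (subst sum.delta) auto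
  also have "?f 0 + dcoeff l (int l + 1) *s ?v + dcoeff l (- 3) *s ?v = quad 0 l ?u + \<kappa> *s ?v"
    unfolding f0 \<kappa>_def scale_left_distrib add.assoc by (rule refl)
  also have "?v = - (2 * of_nat i / fact (l + 2)) *s quad 0 (l + 2) ((quad 0 0 ^^ (i - 1)) (vac V))"
    using B_quad_power[of 1 "l + 2" i] by (simp only: le_refl if_True simp_thms)
  finally have "nprod V (qvec 0 l) (-1) ?u = quad 0 l ?u
      + ((- 2 * \<kappa> / fact (l + 2)) * of_nat i) *s quad 0 (l + 2) ((quad 0 0 ^^ (i - 1)) (vac V))"
    by (simp add: mult_ac)
  then show ?thesis unfolding l_def using \<kappa>
    by (intro exI[of _ "- 2 * \<kappa> / fact (2 * k + 2)"] conjI) (simp_all del: fact_Suc)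
qed

lemma quad_power_qword: "(quad 0 0 ^^ i) (vac V) = qword (replicate i (0, 0))"
  by (induction i) (simp_all add: qword_def)

text \<open>Induction on weight. Within a weight the quadratic invariants come first, since longer
  words are Wick products of invariants of lower weight up to shorter words of the same
  weight.\<close>

lemma qword_jspan: "qword ws \<in> jspan"
proof (induction "qwt ws" arbitrary: ws rule: less_induct)
  case less
  define d where "d = qwt ws"
  have IH: "qword ws' \<in> jspan" if "qwt ws' < d" for ws' using less.hyps that by (simp add: d_def)
  \<comment> \<open>The hypothesis on words is upgraded to all invariants of lower weight, as
    products with nonnegative modes are not single words.\<close>
  have low: "u \<in> jspan" if u: "u \<in> orb" "has_wt d' u" "d' < int d" for u d'
  proof -
    have "u \<in> span {s \<in> range qword. has_wt d' s}"
      by (rule has_wt_homogeneous_part[OF _ _ u(2)]) (use u(1) orb_span has_wt_qword in auto)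
    moreover have "qword ws' \<in> jspan" if "has_wt d' (qword ws')" for ws'
    proof (cases "d' = int (qwt ws')")
      case True
      then show ?thesis using IH u(3) by simp
    next
      case False
      then have "qword ws' = 0" using has_wt_distinct[OF that has_wt_qword] by simp
      then show ?thesis by (simp add: jspan_closed)
    qed
    then have "span {s \<in> range qword. has_wt d' s} \<subseteq> jspan"
      by (intro span_minimal jspan_subspace) auto
    ultimately show ?thesis by blast
  qed
  have qorb: "qword ws' \<in> orb" for ws' unfolding orb_span by (rule span_base) simp
  have pos: "qwt ws' \<ge> 2" if "ws' \<noteq> []" for ws' using that by (cases ws') (auto simp: qwt_def)
  \<comment> \<open>Nonempty words have weight at least 2, and so does \<open>qvec k l\<close>; both
    factors therefore have weight below \<open>d\<close>.\<close>
  have wick: "nprod V (qvec k l) (-1) (qword ws') \<in> jspan" if "ws' \<noteq> []" "k + l + 2 + qwt ws' = d" for k l ws'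
  proof (rule jspan_wick[OF low _ has_wt_qvec _ has_wt_qword])
    show "qvec k l \<in> jspan" by (rule low[OF orb_qvec has_wt_qvec]) (use that pos[OF that(1)] in simp)
    show "qword ws' \<in> jspan" by (rule IH) (use that in simp)
    show "int k + int l + 2 + int (qwt ws') \<le> int d" using that(2) by simp
  qed auto
  have SD: "qvec (Suc k) l + qvec k (Suc l) \<in> jspan" if "k + l + 3 = d" for k l
    unfolding D_qvec[symmetric] by (intro jspan_D low[OF orb_qvec has_wt_qvec]) (use that in simp)
  have S0: "qvec 0 M \<in> jspan" if M: "M + 2 = d" for M
  proof (cases "even M")
    case False
    \<comment> \<open>Modulo derivatives, moving one derivative to the other factor costs a sign.
      Moving an odd number \<open>M\<close> of them gives -1, while the symmetry of
      \<open>qvec\<close> gives +1, so twice the vector lies in \<open>jspan\<close>.\<close>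
    have alt: "qvec k (M - k) + (- ((-1) ^ k)) *s qvec 0 M \<in> jspan" if "k \<le> M" for k
      using that
    proof (induction k)
      case (Suc k)
      have "qvec (Suc k) (M - Suc k) + qvec k (Suc (M - Suc k)) \<in> jspan" by (rule SD) (use Suc.prems M in simp)
      moreover have "Suc (M - Suc k) = M - k" using Suc.prems by simp
      ultimately have "qvec (Suc k) (M - Suc k) + qvec k (M - k) - (qvec k (M - k) + (- ((-1) ^ k)) *s qvec 0 M) \<in> jspan"
        using Suc by (intro jspan_closed(5)) simp_all
      then show ?case by simp
    qed (simp add: jspan_closed)
    have "qvec M 0 + qvec 0 M \<in> jspan" using alt[of M] False by simp
    moreover have "qvec M 0 = qvec 0 M" by (simp add: qvec_def quad_commute)
    ultimately have "qvec 0 M + qvec 0 M \<in> jspan" by simp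
    then have "(1/2) *s (qvec 0 M + qvec 0 M) \<in> jspan" by (rule jspan_closed)
    then show ?thesis by (simp add: scale_right_distrib scale_left_distrib[symmetric])
  next
    case True
    then obtain m where m: "M = 2 * m" by blast
    show ?thesis
    proof (cases "m < n")
      case True
      then show ?thesis using jspan_letter[OF jspan_closed(4) True, of 0] by (simp add: m creation)
    next
      case False
      define k where "k = m - n"
      \<comment> \<open>All these vectors have weight \<open>d\<close>. The chain starts at the
        relation \<open>classical_relation\<close> for \<open>i = 0\<close> and ends with
        \<open>qvec 0 (2 * m)\<close> at \<open>i = n\<close>, each step dividing by a nonzero
        coefficient.\<close>
      let ?u = "\<lambda>i. quad 0 (2 * (k + i)) ((quad 0 0 ^^ (n - i)) (vac V))"
      have "?u i \<in> jspan" if "i \<le> n" for i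
        using that
      proof (induction i)
        case 0
        then show ?case using classical_relation by (simp add: jspan_closed)
      next
        case (Suc i)
        obtain \<kappa> where \<kappa>: "\<kappa> \<noteq> 0" "nprod V (qvec 0 (2 * (k + i))) (-1) ((quad 0 0 ^^ (n - i)) (vac V))
            = ?u i + (\<kappa> * of_nat (n - i)) *s quad 0 (2 * (k + i) + 2) ((quad 0 0 ^^ (n - i - 1)) (vac V))"
          using qvec_wick_power[of "k + i" "n - i"] by blast
        have "nprod V (qvec 0 (2 * (k + i))) (-1) ((quad 0 0 ^^ (n - i)) (vac V)) \<in> jspan"
          unfolding quad_power_qword
        proof (rule wick)
          have "qwt (replicate j (0, 0)) = 2 * j" for j by (induction j) (simp_all add: qwt_def)
          then show "0 + 2 * (k + i) + 2 + qwt (replicate (n - i) (0, 0)) = d"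
            using Suc.prems False M m by (simp add: k_def)
        qed (use Suc.prems in auto)
        moreover have "?u i \<in> jspan" using Suc by simp
        ultimately have "nprod V (qvec 0 (2 * (k + i))) (-1) ((quad 0 0 ^^ (n - i)) (vac V)) - ?u i \<in> jspan"
          by (rule jspan_closed(5))
        moreover have "2 * (k + i) + 2 = 2 * (k + Suc i)" "n - i - 1 = n - Suc i" by simp_all
        moreover define c where "c = \<kappa> * of_nat (n - i)"
        ultimately have "c *s ?u (Suc i) \<in> jspan"
          unfolding \<kappa>(2) by (simp only: add_diff_cancel_left')
        then have "inverse c *s c *s ?u (Suc i) \<in> jspan" by (rule jspan_closed(2))
        moreover have "c \<noteq> 0" using \<kappa>(1) Suc.prems by (simp add: c_def)
        ultimately show ?case by (simp only: scale_scale left_inverse scale_one simp_thms)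
      qed
      from this[of n] show ?thesis using False by (simp add: qvec_def k_def m)
    qed
  qed
  have S1: "qvec k l \<in> jspan" if "k + l + 2 = d" for k l
    using that
  proof (induction k arbitrary: l)
    case 0
    then show ?case using S0 by simp
  next
    case (Suc k)
    have "qvec (Suc k) l + qvec k (Suc l) - qvec k (Suc l) \<in> jspan"
      by (intro jspan_closed(5) SD Suc.IH) (use Suc.prems in simp_all)
    then show ?case by simp
  qed
  have "qword ws' \<in> jspan" if "qwt ws' = d" for ws'
    using that
  proof (induction "length ws'" arbitrary: ws' rule: less_induct)
    case less
    show ?case
    proof (cases ws')
      case Nil
      then show ?thesis by (simp add: qword_def jspan_closed)
    next
      case (Cons p ws2)
      obtain k l where p: "p = (k, l)" by force
      have jweight: "k + l + 2 + qwt ws2 = d" using less.prems by (simp add: Cons p qwt_def)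
      show ?thesis
      proof (cases "ws2 = []")
        case True
        then show ?thesis using S1 jweight by (simp add: Cons p qword_def qvec_def qwt_def)
      next
        case False
        have "qword ws3 \<in> jspan" if "length ws3 = length ws2" "qwt ws3 = qwt ws2 + (k + l + 1) + 1" for ws3
          by (rule less.hyps) (use that jweight Cons in auto)
        then have "span {qword ws3 | ws3. length ws3 = length ws2 \<and> qwt ws3 = qwt ws2 + (k + l + 1) + 1} \<subseteq> jspan"
          by (intro span_minimal jspan_subspace) auto
        then have "B (- 1 - int (q + k + l + 1)) (int q) (qword ws2) \<in> jspan" for q
          using B_qword[of q "k + l + 1" ws2] by (auto simp: add.assoc)
        then have "span {B (- 1 - int (q + k + l + 1)) (int q) (qword ws2) | q. True} \<subseteq> jspan"
          by (intro span_minimal jspan_subspace) auto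
        then have "nprod V (qvec k l) (-1) (qword ws2) - quad k l (qword ws2) \<in> jspan"
          using qvec_wick by blast
        then have "nprod V (qvec k l) (-1) (qword ws2) - (nprod V (qvec k l) (-1) (qword ws2) - quad k l (qword ws2)) \<in> jspan"
          by (rule jspan_closed(5)[OF wick[OF False jweight]])
        then show ?thesis by (simp add: Cons p qword_def)
      qed
    qed
  qed
  then show ?case by (simp add: d_def)
qed

lemma jspan_eq_orb: "jspan = orb"
proof (rule antisym[OF jspan_orb])
  show "orb \<subseteq> jspan"
    unfolding orb_span using qword_jspan by (intro span_minimal jspan_subspace) auto
qed

end

section \<open>Twisted vacuum functionals\<close>

text \<open>The coefficients of \<open>(-1)\<^sup>l / l!\<close> times the \<open>l\<close>-th derivative of \<open>exp (c z) / z\<close>, listed in the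
  order of modes: \<open>tw c l m\<close> belongs to \<open>z\<close> to the power \<open>-m-1\<close>.\<close>

definition tw :: "complex \<Rightarrow> nat \<Rightarrow> int \<Rightarrow> complex" where
  "tw c l m = (if m \<ge> 0 then (if m = int l then 1 else 0)
     else (-1) ^ l * c ^ (nat (- 1 - m) + l + 1) / (of_nat (nat (- 1 - m) + l + 1) * fact (nat (- 1 - m)) * fact l))"

lemma tw_neg: "tw c l (- 1 - int q) = (-1) ^ l * c ^ (q + l + 1) / (of_nat (q + l + 1) * fact q * fact l)"
  by (simp add: tw_def)

text \<open>Working with Laurent series turns the convolutions of mode coefficients into
  products.\<close>

fun EF :: "complex \<Rightarrow> nat \<Rightarrow> complex fls" where
  "EF c 0 = fls_X_inv * fps_to_fls (fps_exp c)"
| "EF c (Suc l) = fls_const (- 1 / of_nat (Suc l)) * fls_deriv (EF c l)"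

lemma EF_nth: "fls_nth (EF c l) k = tw c l (- 1 - k)"
proof (induction l arbitrary: k)
  case 0
  have "fls_nth (EF c 0) k = (if k + 1 < 0 then 0 else c ^ nat (k + 1) / fact (nat (k + 1)))"
    by (simp add: fls_X_inv_times_conv_shift)
  moreover have "nat (k + 1) = Suc (nat k)" if "k \<ge> 0" using that by simp
  ultimately show ?case by (auto simp: tw_def algebra_simps)
next
  case (Suc l)
  have "fls_nth (EF c (Suc l)) k = - (of_int (k + 1) / of_nat (Suc l)) * tw c l (- 1 - (k + 1))"
    by (simp add: Suc.IH)
  also have "\<dots> = tw c (Suc l) (- 1 - k)"
  proof (cases "k \<ge> 0")
    case True
    then obtain q where q: "k = int q" using nonneg_int_cases by blast
    have "- 1 - (k + 1) = - 1 - int (Suc q)" "- 1 - k = - 1 - int q" "of_int (k + 1) = (of_nat (Suc q) :: complex)"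
      by (simp_all add: q)
    moreover have "- (of_nat (Suc q) / of_nat (Suc l)) * ((-1) ^ l * c ^ (Suc q + l + 1) / (of_nat (Suc q + l + 1) * fact (Suc q) * fact l))
      = (-1) ^ Suc l * c ^ (q + Suc l + 1) / (of_nat (q + Suc l + 1) * fact q * (fact (Suc l) :: complex))"
    proof -
      have nz: "(of_nat (Suc q) :: complex) \<noteq> 0" "(of_nat (Suc l) :: complex) \<noteq> 0" "(of_nat (Suc q + l + 1) :: complex) \<noteq> 0"
        "(fact q :: complex) \<noteq> 0" "(fact l :: complex) \<noteq> 0" by (simp_all del: of_nat_Suc of_nat_add)
      have f: "fact (Suc q) = of_nat (Suc q) * (fact q :: complex)" "fact (Suc l) = of_nat (Suc l) * (fact l :: complex)"
        by simp_all
      have e: "q + Suc l + 1 = Suc q + l + 1" by simp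
      show ?thesis unfolding f e using nz by (simp add: divide_simps del: of_nat_Suc of_nat_add)
    qed
    ultimately show ?thesis by (simp only: tw_neg)
  next
    case False
    show ?thesis
    proof (cases "k = - 1 - int (Suc l)")
      case True
      then have "of_int (k + 1) = - (of_nat (Suc l) :: complex)" by simp
      then show ?thesis using True by (simp add: tw_def del: of_nat_Suc)
    next
      case neq: False
      then show ?thesis using False by (cases "k = -1") (auto simp: tw_def)
    qed
  qed
  finally show ?case .
qed

text \<open>The exponential times a polynomial in 1/z without constant term. This shape survives
  differentiation, and a product of two such series with opposite exponents has only negative powers
  left.\<close>

definition exp_multiple :: "complex \<Rightarrow> complex fls \<Rightarrow> bool" where
  "exp_multiple c f \<longleftrightarrow> (\<exists>P. f = fps_to_fls (fps_exp c) * P \<and> (\<forall>k\<ge>0. fls_nth P k = 0))"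

lemma exp_multiple_const: "exp_multiple c f \<Longrightarrow> exp_multiple c (fls_const a * f)"
  unfolding exp_multiple_def
  by (elim exE conjE) (rule_tac x = "fls_const a * P" in exI, simp add: mult_ac)

lemma exp_multiple_deriv: "exp_multiple c f \<Longrightarrow> exp_multiple c (fls_deriv f)"
  unfolding exp_multiple_def
proof (elim exE conjE)
  fix P assume P: "f = fps_to_fls (fps_exp c) * P" "\<forall>k\<ge>0. fls_nth P k = 0"
  have "fls_deriv f = fps_to_fls (fps_exp c) * (fls_const c * P + fls_deriv P)"
    unfolding P(1) by (simp add: fls_deriv_fps_to_fls fls_times_fps_to_fls algebra_simps)
  then show "\<exists>P. fls_deriv f = fps_to_fls (fps_exp c) * P \<and> (\<forall>k\<ge>0. fls_nth P k = 0)"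
    using P(2) by (intro exI[of _ "fls_const c * P + fls_deriv P"]) simp
qed

lemma exp_multiple_EF: "exp_multiple c (EF c l)"
proof (induction l)
  case 0
  show ?case unfolding exp_multiple_def by (intro exI[of _ fls_X_inv]) (simp add: mult.commute)
next
  case (Suc l)
  then show ?case unfolding EF.simps by (intro exp_multiple_const exp_multiple_deriv)
qed

lemma exp_multiple_deriv_pow: "exp_multiple c f \<Longrightarrow> exp_multiple c ((fls_deriv ^^ k) f)"
  by (induction k) (simp_all add: exp_multiple_deriv)

lemma exp_multiple_cancel:
  assumes "exp_multiple c f" "exp_multiple (- c) g" "s \<ge> 0"
  shows "fls_nth (f * g) s = 0"
proof -
  obtain P Q where P: "f = fps_to_fls (fps_exp c) * P" "\<And>k. k \<ge> 0 \<Longrightarrow> fls_nth P k = 0"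
    and Q: "g = fps_to_fls (fps_exp (- c)) * Q" "\<And>k. k \<ge> 0 \<Longrightarrow> fls_nth Q k = 0"
    using assms(1,2) by (auto simp: exp_multiple_def)
  have "f * g = fps_to_fls (fps_exp c * fps_exp (- c)) * (P * Q)"
    by (simp add: P(1) Q(1) fls_times_fps_to_fls mult_ac)
  also have "fps_exp c * fps_exp (- c) = 1" by (simp add: fps_exp_add_mult[symmetric])
  finally have "f * g = P * Q" by simp
  moreover have "fls_nth P i * fls_nth Q (s - i) = 0" for i
    using P(2)[of i] Q(2)[of "s - i"] assms(3) by (cases "i \<ge> 0") auto
  ultimately show ?thesis by (simp only: fls_times_nth(2) sum.neutral_const)
qed

lemma fls_deriv_pow_nth:
  fixes f :: "complex fls"
  shows "fls_nth ((fls_deriv ^^ L) f) k = (-1) ^ L * fact L * (of_int (- 1 - k) gchoose L) * fls_nth f (k + int L)"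
proof (induction L arbitrary: k)
  case (Suc L)
  have 1: "of_nat (Suc L) * ((of_int (- 1 - k) :: complex) gchoose Suc L)
      = of_int (- 1 - k) * (of_int (- 1 - (k + 1)) gchoose L)"
    using gbinomial_absorption[of L "of_int (- 1 - k) :: complex"] by simp
  have "fls_nth ((fls_deriv ^^ Suc L) f) k
      = - of_int (- 1 - k) * ((-1) ^ L * fact L * (of_int (- 1 - (k + 1)) gchoose L) * fls_nth f (k + 1 + int L))"
  proof -
    have "of_int (k + 1) = - (of_int (- 1 - k) :: complex)" by simp
    then show ?thesis by (simp only: funpow.simps o_apply fls_deriv_nth Suc.IH)
  qed
  also have "\<dots> = (-1) ^ Suc L * fact L * (of_int (- 1 - k) * (of_int (- 1 - (k + 1)) gchoose L)) * fls_nth f (k + 1 + int L)"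
  proof -
    have "- x * ((-1) ^ L * q * y * z) = (-1) ^ Suc L * q * (x * y) * z" for x q y z :: complex
      by (simp add: mult_ac)
    then show ?thesis .
  qed
  also have "\<dots> = (-1) ^ Suc L * fact (Suc L) * (of_int (- 1 - k) gchoose Suc L) * fls_nth f (k + 1 + int L)"
    unfolding 1[symmetric] by (simp only: fact_Suc of_nat_mult mult_ac)
  finally show ?case by (simp only: of_nat_Suc add.assoc add.commute[of 1])
qed simp

text \<open>The convolution written in the shape of \<open>qvec_mode\<close>, which pairs the
  indices \<open>j\<close> and \<open>- 1 - j\<close>.\<close>

lemma fls_times_nth_symmetric:
  fixes f g :: "complex fls"
  assumes "\<And>i. i < - int N \<Longrightarrow> fls_nth f i = 0" "\<And>i. i \<ge> int N \<Longrightarrow> fls_nth g (s - i) = 0"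
  shows "fls_nth (f * g) s = (\<Sum>j<N. fls_nth f (int j) * fls_nth g (s - int j)
    + fls_nth f (- 1 - int j) * fls_nth g (s + 1 + int j))"
proof -
  let ?h = "\<lambda>i. fls_nth f i * fls_nth g (s - i)"
  define a where "a = min (fls_subdegree f) (- int N)"
  define b where "b = max (s - fls_subdegree g) (int N)"
  have "fls_nth (f * g) s = (\<Sum>i=fls_subdegree f..s - fls_subdegree g. ?h i)" by (rule fls_times_nth(2))
  also have "\<dots> = (\<Sum>i=a..b. ?h i)"
    by (rule sum.mono_neutral_left) (auto simp: a_def b_def not_le)
  also have "\<dots> = (\<Sum>i\<in>{- int N..<int N}. ?h i)"
    by (rule sum.mono_neutral_right) (use assms in \<open>auto simp: a_def b_def not_le\<close>)
  also have "{- int N..<int N} = int ` {..<N} \<union> (\<lambda>j. - 1 - int j) ` {..<N}"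
  proof (intro equalityI subsetI)
    fix i assume i: "i \<in> {- int N..<int N}"
    show "i \<in> int ` {..<N} \<union> (\<lambda>j. - 1 - int j) ` {..<N}"
    proof (cases "i \<ge> 0")
      case True
      then show ?thesis using i by (intro UnI1 image_eqI[of _ _ "nat i"]) auto
    next
      case False
      then show ?thesis using i by (intro UnI2 image_eqI[of _ _ "nat (- 1 - i)"]) auto
    qed
  qed auto
  also have "(\<Sum>i\<in>int ` {..<N} \<union> (\<lambda>j. - 1 - int j) ` {..<N}. ?h i)
      = (\<Sum>i\<in>int ` {..<N}. ?h i) + (\<Sum>i\<in>(\<lambda>j. - 1 - int j) ` {..<N}. ?h i)"
    by (rule sum.union_disjoint) auto
  also have "\<dots> = (\<Sum>j<N. ?h (int j)) + (\<Sum>j<N. ?h (- 1 - int j))"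
    by (simp add: sum.reindex inj_on_def)
  finally show ?thesis by (simp add: sum.distrib algebra_simps)
qed

text \<open>The contribution of a pair of contractions: the exponentials cancel, so the product has no
  regular part.\<close>

lemma tw_convolution:
  assumes N: "N \<ge> s + l + l' + L + 2"
  shows "(\<Sum>j<N. tw c l (- 1 - int j) * (dcoeff L (- 1 - int s + int j) * tw (- c) l' (- 1 - int s + int j - int L))
    + tw c l (int j) * (dcoeff L (- 2 - int s - int j) * tw (- c) l' (- 2 - int s - int j - int L))) = 0"
proof -
  let ?f = "EF c l" and ?g = "(fls_deriv ^^ L) (EF (- c) l')"
  have g: "fls_nth ?g k = dcoeff L (- 1 - k) * tw (- c) l' (- 1 - k - int L)" for k
    unfolding fls_deriv_pow_nth EF_nth dcoeff_def by (simp add: algebra_simps)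
  have "fls_nth (?f * ?g) (int s) = 0"
    by (rule exp_multiple_cancel[of c]) (auto intro: exp_multiple_EF exp_multiple_deriv_pow)
  moreover have "fls_nth (?f * ?g) (int s) = (\<Sum>j<N. fls_nth ?f (int j) * fls_nth ?g (int s - int j)
    + fls_nth ?f (- 1 - int j) * fls_nth ?g (int s + 1 + int j))"
  proof (rule fls_times_nth_symmetric)
    show "fls_nth ?f i = 0" if "i < - int N" for i using that N by (auto simp: EF_nth tw_def)
    show "fls_nth ?g (int s - i) = 0" if "i \<ge> int N" for i using that N by (auto simp: g tw_def)
  qed
  moreover have "- 1 - (int s - int j) = - 1 - int s + int j" "- 1 - (- 1 - int j) = int j"
    "- 1 - (int s + 1 + int j) = - 2 - int s - int j" for j by simp_all
  ultimately show ?thesis by (simp only: g EF_nth)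
qed

text \<open>The contraction of the two factors of a quadratic field with each other. The constant is
  the L-th w-derivative at z = w of the regular part of the w-derivative of exp (c (z - w)) / (z -
  w). It does not depend on the position, so its higher Taylor coefficients vanish; here this
  appears as an alternating sum of binomial coefficients.\<close>

lemma tw_constant:
  assumes "N \<ge> s + 1"
  shows "(\<Sum>j<N. if j < L + s + 1 then dcoeff L (- 1 - int s + int j) * (of_nat (L + s + 1 - j) * tw c (L + s + 1 - j) (- 1 - int j)) else 0)
    = (if s = 0 then (-1) ^ (L + 1) * c ^ (L + 2) / of_nat (L + 2) else 0)"
proof -
  let ?F = "\<lambda>j. if j < L + s + 1 then dcoeff L (- 1 - int s + int j) * (of_nat (L + s + 1 - j) * tw c (L + s + 1 - j) (- 1 - int j)) else 0"
  have 0: "?F j = 0" if "j > s" for j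
    using that dcoeff_zero[of "- 1 - int s + int j" L] by auto
  have F: "?F j = ((-1) ^ (L + 1 + s) * c ^ (L + s + 2) / (of_nat (L + s + 2) * fact s)) * ((-1) ^ j * of_nat (s choose j))"
    if j: "j \<le> s" for j
  proof -
    define i where "i = s - j"
    have s: "s = i + j" using j by (simp add: i_def)
    have "- 1 - int s + int j = - 1 - int i" "L + s + 1 - j = Suc (L + i)" by (simp_all add: s)
    then have "?F j = fact (i + L) / fact i * (of_nat (Suc (L + i)) * ((-1) ^ Suc (L + i) * c ^ (j + Suc (L + i) + 1)
        / (of_nat (j + Suc (L + i) + 1) * fact j * fact (Suc (L + i)))))"
      using j by (simp only: dcoeff_neg tw_neg) simp
    also have "\<dots> = (-1) ^ Suc (L + i) * c ^ (L + s + 2) / (of_nat (L + s + 2) * fact j * fact i)"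
    proof -
      have "fact (Suc (L + i)) = of_nat (Suc (L + i)) * (fact (i + L) :: complex)" by (simp add: add.commute)
      moreover have "j + Suc (L + i) + 1 = L + s + 2" by (simp add: s)
      moreover have "(of_nat (Suc (L + i)) :: complex) \<noteq> 0" "(of_nat (L + s + 2) :: complex) \<noteq> 0"
        by (simp_all only: of_nat_eq_0_iff)
      ultimately show ?thesis by (simp only:) (simp add: divide_simps del: of_nat_Suc of_nat_add fact_Suc)
    qed
    also have "(-1) ^ Suc (L + i) = (-1) ^ (L + 1 + s) * (-1 :: complex) ^ j"
      by (simp add: s power_add)
    also have "of_nat (s choose j) = (fact s / (fact j * fact i) :: complex)"
      using binomial_fact[OF j, where ?'a = complex] by (simp add: i_def)
    then have "(-1) ^ (L + 1 + s) * (-1 :: complex) ^ j * c ^ (L + s + 2) / (of_nat (L + s + 2) * fact j * fact i)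
      = ((-1) ^ (L + 1 + s) * c ^ (L + s + 2) / (of_nat (L + s + 2) * fact s)) * ((-1) ^ j * of_nat (s choose j))"
      by (simp add: divide_simps del: of_nat_add)
    finally show ?thesis .
  qed
  have "(\<Sum>j<N. ?F j) = (\<Sum>j\<le>s. ?F j)"
    by (rule sum.mono_neutral_right) (use assms 0 in auto)
  also have "\<dots> = ((-1) ^ (L + 1 + s) * c ^ (L + s + 2) / (of_nat (L + s + 2) * fact s)) * (\<Sum>j\<le>s. (-1) ^ j * of_nat (s choose j))"
    unfolding sum_distrib_left by (rule sum.cong[OF refl]) (simp only: F atMost_iff)
  also have "(\<Sum>j\<le>s. (-1) ^ j * of_nat (s choose j)) = (if s = 0 then 1 else 0 :: complex)"
    using choose_alternating_sum[of s, where ?'a = complex] by auto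
  finally show ?thesis by (auto simp: numeral_2_eq_2)
qed

context symplectic_fermion_algebra
begin

section \<open>Twisted modes and their expectation values\<close>

lemma X_bound: "\<exists>N. \<forall>l\<ge>N. \<forall>a<2 * n. X a (int l) v = 0"
proof -
  obtain N where N: "N \<ge> 0" "\<forall>m\<ge>N. \<forall>(a, b)\<in>(\<lambda>a. (sf_gen n e f a, v)) ` {..<2 * n}. nprod V a m b = 0"
    using truncation_uniform[of "(\<lambda>a. (sf_gen n e f a, v)) ` {..<2 * n}"] by blast
  then show ?thesis by (intro exI[of _ "nat N"]) (auto simp: X_def)
qed

text \<open>The modes of the generators in the representation twisted by \<open>x\<^sub>a(z) \<mapsto> exp (\<lambda>\<^sub>a z) x\<^sub>a(z)\<close>:
  the creation operators acquire annihilation parts.\<close>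

definition AX :: "(nat \<Rightarrow> complex) \<Rightarrow> nat \<Rightarrow> nat \<Rightarrow> 'v \<Rightarrow> 'v" where
  "AX lam a q v = Sum_any (\<lambda>l. tw (lam a) l (- 1 - int q) *s X a (int l) v)"

definition XH :: "(nat \<Rightarrow> complex) \<Rightarrow> nat \<Rightarrow> int \<Rightarrow> 'v \<Rightarrow> 'v" where
  "XH lam a m v = X a m v + (if m < 0 then AX lam a (nat (- 1 - m)) v else 0)"

lemma AX_sum:
  assumes "\<And>l. l \<ge> N \<Longrightarrow> X a (int l) v = 0"
  shows "AX lam a q v = (\<Sum>l<N. tw (lam a) l (- 1 - int q) *s X a (int l) v)"
  unfolding AX_def by (rule Sum_any_lessThan) (simp add: assms)

lemma AX_linear:
  assumes a: "a < 2 * n"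
  shows "AX lam a q (u + v) = AX lam a q u + AX lam a q v" "AX lam a q (t *s v) = t *s AX lam a q v"
    "AX lam a q (vac V) = 0"
proof -
  obtain N N' where N: "\<forall>l\<ge>N. \<forall>a<2 * n. X a (int l) u = 0" "\<forall>l\<ge>N'. \<forall>a<2 * n. X a (int l) v = 0"
    using X_bound by metis
  note * = AX_sum[where N = "max N N'"]
  show "AX lam a q (u + v) = AX lam a q u + AX lam a q v"
    using N a by (subst (1 2 3) *) (auto simp: X_linear scale_right_distrib sum.distrib)
  show "AX lam a q (t *s v) = t *s AX lam a q v"
    using N a by (subst (1 2) *) (auto simp: X_linear scale_sum_right mult.commute)
  show "AX lam a q (vac V) = 0"
    by (subst AX_sum[where N = 0]) (simp_all add: X_vac)
qed

lemma AX_X: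
  assumes a: "a < 2 * n" "b < 2 * n"
  shows "AX lam a q (X b k v) + X b k (AX lam a q v)
    = (if b = partner n a \<and> k < 0 then tw (lam a) (nat (- k)) (- 1 - int q) * (sg n a * of_int (- k)) else 0) *s v"
proof -
  obtain N N' where N: "\<forall>l\<ge>N. \<forall>a<2 * n. X a (int l) (X b k v) = 0" "\<forall>l\<ge>N'. \<forall>a<2 * n. X a (int l) v = 0"
    using X_bound by metis
  define M where "M = max (max N N') (Suc (nat (- k)))"
  have "AX lam a q (X b k v) + X b k (AX lam a q v)
    = (\<Sum>l<M. tw (lam a) l (- 1 - int q) *s (X a (int l) (X b k v) + X b k (X a (int l) v)))"
    using N a by (subst (1 2) AX_sum[where N = M]) (auto simp: M_def X_linear scale_right_distrib sum.distrib)
  also have "\<dots> = (\<Sum>l<M. if l = nat (- k) then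
      (if b = partner n a \<and> k < 0 then tw (lam a) (nat (- k)) (- 1 - int q) * (sg n a * of_int (- k)) else 0) *s v else 0)"
  proof (rule sum.cong[OF refl])
    fix l
    have "int l + k = 0 \<and> l \<noteq> 0 \<longleftrightarrow> l = nat (- k) \<and> k < 0" by auto
    then show "tw (lam a) l (- 1 - int q) *s (X a (int l) (X b k v) + X b k (X a (int l) v)) = (if l = nat (- k) then
      (if b = partner n a \<and> k < 0 then tw (lam a) (nat (- k)) (- 1 - int q) * (sg n a * of_int (- k)) else 0) *s v else 0)"
      unfolding X_anticommute[OF a] by (cases "l = 0") auto
  qed
  also have "\<dots> = (if b = partner n a \<and> k < 0 then tw (lam a) (nat (- k)) (- 1 - int q) * (sg n a * of_int (- k)) else 0) *s v"
  proof -
    have "nat (- k) < M" by (simp add: M_def)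
    then show ?thesis by simp
  qed
  finally show ?thesis .
qed

lemma AX_AX:
  assumes a: "a < 2 * n" "b < 2 * n"
  shows "AX lam a q (AX lam b r v) + AX lam b r (AX lam a q v) = 0"
proof -
  obtain N where N: "\<forall>l\<ge>N. \<forall>c<2 * n. X c (int l) (AX lam a q v) = 0" using X_bound by blast
  obtain N' where N': "\<forall>l\<ge>N'. \<forall>c<2 * n. X c (int l) v = 0" using X_bound by blast
  define M where "M = max N N'"
  have XA: "AX lam a q (X b (int l) v) = - X b (int l) (AX lam a q v)" for l
    using AX_X[OF a, of lam q "int l" v] by (simp add: eq_neg_iff_add_eq_0)
  have sum: "AX lam a q (\<Sum>l\<in>A. G l) = (\<Sum>l\<in>A. AX lam a q (G l))" for A :: "nat set" and G
    using AX_linear(2)[OF a(1), of lam q 0 "vac V"]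
    by (induction A rule: infinite_finite_induct) (simp_all add: AX_linear[OF a(1)])
  have 1: "AX lam b r v = (\<Sum>l<M. tw (lam b) l (- 1 - int r) *s X b (int l) v)"
    by (rule AX_sum) (use N' a in \<open>auto simp: M_def\<close>)
  have 2: "AX lam b r (AX lam a q v) = (\<Sum>l<M. tw (lam b) l (- 1 - int r) *s X b (int l) (AX lam a q v))"
    by (rule AX_sum) (use N a in \<open>auto simp: M_def\<close>)
  show ?thesis unfolding 1 2 sum
    by (simp add: AX_linear(2)[OF a(1)] XA sum_negf)
qed

text \<open>The only new case is that of two creation modes, where the added annihilation parts
  produce two cross terms. They cancel because the kernel depends on z - w alone: exchanging partner
  fields exchanges z and w, which is compensated by the sign of \<open>lam\<close>.\<close>

lemma XH_anticommute:
  assumes lam: "\<And>a. a < 2 * n \<Longrightarrow> lam (partner n a) = - lam a" and a: "a < 2 * n" "b < 2 * n" and k: "k < 0"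
  shows "XH lam a m (XH lam b k v) + XH lam b k (XH lam a m v)
    = (if b = partner n a \<and> m + k = 0 then sg n a * of_int m else 0) *s v"
proof (cases "m < 0")
  case False
  have "X a m (AX lam b (nat (- 1 - k)) v) + AX lam b (nat (- 1 - k)) (X a m v) = 0"
    using AX_X[OF a(2,1), of lam "nat (- 1 - k)" m v] False by (simp add: add.commute)
  moreover have "XH lam a m (XH lam b k v) + XH lam b k (XH lam a m v)
     = X a m (X b k v) + X b k (X a m v) + (X a m (AX lam b (nat (- 1 - k)) v) + AX lam b (nat (- 1 - k)) (X a m v))"
    using False k by (simp add: XH_def X_linear)
  ultimately show ?thesis by (simp add: X_anticommute[OF a])
next
  case True
  define q where "q = nat (- 1 - m)"
  define r where "r = nat (- 1 - k)"
  have mk: "m = - 1 - int q" "k = - 1 - int r" using True k by (simp_all add: q_def r_def)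
  have nat: "nat (- k) = Suc r" "nat (- m) = Suc q" by (simp_all add: mk)
  have "XH lam a m (XH lam b k v) + XH lam b k (XH lam a m v)
     = (X a m (X b k v) + X b k (X a m v)) + (AX lam b r (X a m v) + X a m (AX lam b r v))
       + (AX lam a q (X b k v) + X b k (AX lam a q v)) + (AX lam a q (AX lam b r v) + AX lam b r (AX lam a q v))"
    using True k by (simp add: XH_def X_linear AX_linear[OF a(1)] AX_linear[OF a(2)] q_def r_def)
  also have "\<dots> = (if a = partner n b then tw (lam b) (Suc q) (- 1 - int r) * (sg n b * of_int (- m)) else 0) *s v
     + (if b = partner n a then tw (lam a) (Suc r) (- 1 - int q) * (sg n a * of_int (- k)) else 0) *s v"
    using True k by (simp add: X_anticommute[OF a] AX_X[OF a] AX_X[OF a(2,1)] AX_AX[OF a] nat)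
  also have "\<dots> = 0"
  proof (cases "b = partner n a")
    case True
    \<comment> \<open>This is the symmetry of the kernel, coefficient by coefficient; the opposite
      signs of \<open>sg\<close> then yield the cancellation.\<close>
    have "tw (- lam a) (Suc q) (- 1 - int r) * of_nat (Suc q) = tw (lam a) (Suc r) (- 1 - int q) * of_nat (Suc r)"
    proof -
      have e: "r + Suc q + 1 = q + Suc r + 1" by simp
      have nz: "(of_nat (Suc q) :: complex) \<noteq> 0" "(of_nat (Suc r) :: complex) \<noteq> 0"
        by (simp_all only: of_nat_eq_0_iff)
      have f: "fact (Suc q) = of_nat (Suc q) * (fact q :: complex)" "fact (Suc r) = of_nat (Suc r) * (fact r :: complex)"
        by simp_all
      have "tw (- lam a) (Suc q) (- 1 - int r) * of_nat (Suc q)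
          = (-1) ^ Suc q * (- lam a) ^ (q + Suc r + 1) / (of_nat (q + Suc r + 1) * fact r * fact q)"
        unfolding tw_neg f e using nz by (simp add: divide_simps del: of_nat_Suc of_nat_add)
      also have "(-1) ^ Suc q * (- lam a) ^ (q + Suc r + 1) = (-1) ^ Suc r * lam a ^ (q + Suc r + 1)"
        unfolding power_minus[of "lam a"] by (simp add: power_add)
      also have "(-1) ^ Suc r * lam a ^ (q + Suc r + 1) / (of_nat (q + Suc r + 1) * fact r * fact q)
          = tw (lam a) (Suc r) (- 1 - int q) * of_nat (Suc r)"
        unfolding tw_neg f using nz by (simp add: divide_simps del: of_nat_Suc of_nat_add)
      finally show ?thesis .
    qed
    moreover have "of_int (- m) = (of_nat (Suc q) :: complex)" "of_int (- k) = (of_nat (Suc r) :: complex)"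
      by (simp_all add: mk)
    ultimately show ?thesis using True a(1)
      by (simp add: lam sg_partner partner_partner scale_left_distrib[symmetric] mult.left_commute[of _ "sg n a"]
          del: of_nat_Suc)
  next
    case False
    then have "a \<noteq> partner n b" using a by (auto simp: partner_partner)
    then show ?thesis using False by simp
  qed
  finally show ?thesis using True k by simp
qed

lemma XH_linear: "a < 2 * n \<Longrightarrow> XH lam a m (u + v) = XH lam a m u + XH lam a m v"
  "a < 2 * n \<Longrightarrow> XH lam a m (t *s v) = t *s XH lam a m v"
  by (simp_all add: XH_def X_linear AX_linear scale_right_distrib)

lemma twisted_exists:
  assumes lam: "\<And>a. a < 2 * n \<Longrightarrow> lam (partner n a) = - lam a"
  shows "\<exists>h. Vector_Spaces.linear (scl V) (scl V) h \<and> h (vac V) = vac V \<and>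
    (\<forall>b<2 * n. \<forall>m u. h (X b m u) = XH lam b m (h u))"
  by (rule modes_extend) (simp_all add: XH_linear XH_anticommute lam, simp add: XH_def X_vac)

lemma coord_Nil_X: "a < 2 * n \<Longrightarrow> m < 0 \<Longrightarrow> coord [] (X a m v) = 0"
proof -
  assume *: "a < 2 * n" "m < 0"
  have "coord [] (X a (- 1 - int (nat (- 1 - m))) v) = 0"
    unfolding X_cr using * coord_cr[of "(a, nat (- 1 - m))" "[]" v] by (simp add: coord_linear I_def W_def)
  then show ?thesis using * by simp
qed

lemma coord_Nil_vac: "coord [] (vac V) = 1"
  using coord_mon[of "[]" "[]"] by (simp add: mon_def W_def)

text \<open>Creation parts have no vacuum coefficient, so only annihilation parts count. The values
  of \<open>tw\<close> at nonnegative modes are chosen to cover the untwisted modes by the same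
  formula.\<close>

lemma coord_Nil_XH:
  assumes a: "a < 2 * n" and N: "\<And>l. l \<ge> N \<Longrightarrow> X a (int l) v = 0"
  shows "coord [] (XH lam a m v) = (\<Sum>l<N. tw (lam a) l m * coord [] (X a (int l) v))"
proof (cases "m < 0")
  case True
  have "m = - 1 - int (nat (- 1 - m))" using True by simp
  then have "AX lam a (nat (- 1 - m)) v = (\<Sum>l<N. tw (lam a) l m *s X a (int l) v)"
    using AX_sum[of N a v lam "nat (- 1 - m)"] N by (simp only:)
  then show ?thesis using True a by (simp add: XH_def coord_linear coord_Nil_X coord_sum)
next
  case False
  then obtain k where k: "m = int k" using nonneg_int_cases by (metis not_less)
  have "(\<Sum>l<N. tw (lam a) l m * coord [] (X a (int l) v)) = (\<Sum>l<N. if l = k then coord [] (X a m v) else 0)"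
    by (intro sum.cong refl) (auto simp: tw_def k)
  also have "\<dots> = coord [] (X a m v)" using N[of k] by (auto simp: k coord_linear not_less)
  finally show ?thesis using False by (simp add: XH_def)
qed

text \<open>The expectation value in the twisted vacuum factors over Wick products, because by
  \<open>tw_convolution\<close> the connected part has no regular terms.\<close>

lemma twisted_expectation:
  assumes lam: "\<And>a. a < 2 * n \<Longrightarrow> lam (partner n a) = - lam a"
    and h: "Vector_Spaces.linear (scl V) (scl V) h" "\<And>b m u. b < 2 * n \<Longrightarrow> h (X b m u) = XH lam b m (h u)"
  shows "coord [] (h (nprod V (qvec 0 K) (- 1 - int s) v))
    = (if s = 0 then (-1) ^ (K + 1) * (\<Sum>a<2 * n. lam a ^ (K + 2)) / of_nat (K + 2) else 0) * coord [] (h v)"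
proof -
  have hom: "module_hom (scl V) (scl V) h" using h(1) by (simp add: linear_iff_module_hom)
  let ?u = "h v" and ?r = "- 1 - int s"
  obtain M where M: "\<And>l a. l \<ge> M \<Longrightarrow> a < 2 * n \<Longrightarrow> X a (int l) ?u = 0" using X_bound by blast
  obtain N0 where N0: "\<And>N. N \<ge> N0 \<Longrightarrow> nprod V (qvec 0 K) ?r v = (\<Sum>j<N.
      (dcoeff 0 (- 1 - int j) * dcoeff K (?r + int j)) *s B (- 1 - int j - int 0) (?r + int j - int K) v
    + (dcoeff K (?r - 1 - int j) * dcoeff 0 (int j)) *s B (?r - 1 - int j - int K) (int j - int 0) v)"
    using qvec_mode[of 0 K ?r v] by blast
  define N where "N = N0 + s + 2 * M + K + 2"
  define cc where "cc a l l' = coord [] (X (partner n a) (int l') (X a (int l) ?u))" for a l l'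
  have XX0: "X b (int l') (X a (int l) w) = - X a (int l) (X b (int l') w)"
    if "a < 2 * n" "b < 2 * n" for a b l l' w
  proof -
    have "(if a = partner n b \<and> int l' + int l = 0 then sg n b * of_int (int l') else 0) = (0 :: complex)"
      by auto
    then show ?thesis using X_swap[of b a "int l'" "int l" w] that by simp
  qed
  have anti: "X a (int l) (XH lam (partner n a) k w) + XH lam (partner n a) k (X a (int l) w)
        = (if k < 0 \<and> l = nat (- k) then sg n a * of_nat l else 0) *s w" if a: "a < 2 * n" for a l k w
  proof (cases "k < 0")
    case True
    have "X a (int l) = XH lam a (int l)" by (rule ext) (simp add: XH_def)
    moreover have "int l + k = 0 \<longleftrightarrow> l = nat (- k)" using True by auto
    moreover have "XH lam a (int l) (XH lam (partner n a) k w) + XH lam (partner n a) k (XH lam a (int l) w)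
      = (if partner n a = partner n a \<and> int l + k = 0 then sg n a * of_int (int l) else 0) *s w"
      by (rule XH_anticommute) (use lam a True partner_less in auto)
    ultimately show ?thesis using True by simp
  next
    case False
    have "(if partner n a = partner n a \<and> int l + k = 0 then sg n a * of_int (int l) else 0) = (0 :: complex)"
      using False by auto
    then show ?thesis using X_anticommute[OF a partner_less[OF a], of "int l" k w] False by (simp add: XH_def)
  qed
  have inner: "coord [] (X a (int l) (XH lam (partner n a) k ?u))
      = (if k < 0 \<and> l = nat (- k) then sg n a * of_nat l else 0) * coord [] ?u
        - (\<Sum>l'<M. tw (- lam a) l' k * cc a l l')" if a: "a < 2 * n" for a l k
  proof -
    have pa: "partner n a < 2 * n" using a by (rule partner_less)
    have X0: "X (partner n a) (int l') (X a (int l) ?u) = 0" if "l' \<ge> M" for l'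
      using M[OF that pa] by (simp add: XX0[OF a pa] X_linear)
    have "X a (int l) (XH lam (partner n a) k ?u)
        = (if k < 0 \<and> l = nat (- k) then sg n a * of_nat l else 0) *s ?u - XH lam (partner n a) k (X a (int l) ?u)"
      using anti[OF a, of l k ?u] by (simp only: eq_diff_eq)
    then show ?thesis using coord_Nil_XH[OF pa X0, of M lam k] a by (simp add: coord_linear lam cc_def)
  qed
  \<comment> \<open>The connected part, in which both modes contract with the vector;
    \<open>Bc\<close> is the contraction of the two modes with each other.\<close>
  define Bl where "Bl m k = (\<Sum>a<2 * n. \<Sum>l<M. \<Sum>l'<M. sg n a * (tw (lam a) l m * tw (- lam a) l' k * cc a l l'))" for m k
  define Bc where "Bc m k = (if k < 0 then \<Sum>a<2 * n. of_nat (nat (- k)) * tw (lam a) (nat (- k)) m else 0)" for m k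
  have pair: "coord [] (h (B m k v)) = Bc m k * coord [] ?u - Bl m k" for m k
  proof -
    have one: "sg n a * coord [] (XH lam a m (XH lam (partner n a) k ?u))
      = (if k < 0 then of_nat (nat (- k)) * tw (lam a) (nat (- k)) m else 0) * coord [] ?u
        - (\<Sum>l<M. \<Sum>l'<M. sg n a * (tw (lam a) l m * tw (- lam a) l' k * cc a l l'))" if a: "a < 2 * n" for a
    proof -
      \<comment> \<open>Besides the modes below \<open>M\<close>, mode \<open>- k\<close> contracts
        with the inner creation mode, so the cut-off must include it.\<close>
      define M' where "M' = max M (Suc (nat (- k)))"
      have pa: "partner n a < 2 * n" using a by (rule partner_less)
      have XH0: "XH lam (partner n a) k 0 = 0" using XH_linear(2)[OF pa, of lam k 0 0] by simp
      have "X a (int l) (XH lam (partner n a) k ?u) = 0" if "l \<ge> M'" for l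
        using anti[OF a, of l k ?u] M[OF _ a, of l] that XH0 by (auto simp: M'_def)
      then have "coord [] (XH lam a m (XH lam (partner n a) k ?u))
          = (\<Sum>l<M'. tw (lam a) l m * coord [] (X a (int l) (XH lam (partner n a) k ?u)))"
        by (rule coord_Nil_XH[OF a])
      also have "\<dots> = (\<Sum>l<M'. (if l = nat (- k) then if k < 0 then tw (lam a) (nat (- k)) m * (sg n a * of_nat (nat (- k))) * coord [] ?u else 0 else 0)
          - tw (lam a) l m * (\<Sum>l'<M. tw (- lam a) l' k * cc a l l'))"
        by (intro sum.cong refl) (simp add: inner[OF a] right_diff_distrib)
      also have "\<dots> = (if k < 0 then tw (lam a) (nat (- k)) m * (sg n a * of_nat (nat (- k))) * coord [] ?u else 0)
          - (\<Sum>l<M'. tw (lam a) l m * (\<Sum>l'<M. tw (- lam a) l' k * cc a l l'))"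
        by (simp add: sum_subtractf M'_def less_max_iff_disj)
      also have "(\<Sum>l<M'. tw (lam a) l m * (\<Sum>l'<M. tw (- lam a) l' k * cc a l l'))
          = (\<Sum>l<M. tw (lam a) l m * (\<Sum>l'<M. tw (- lam a) l' k * cc a l l'))"
        using M[OF _ a] by (intro sum.mono_neutral_right) (auto simp: M'_def cc_def X_linear coord_linear)
      finally have *: "coord [] (XH lam a m (XH lam (partner n a) k ?u))
          = (if k < 0 then tw (lam a) (nat (- k)) m * (sg n a * of_nat (nat (- k))) * coord [] ?u else 0)
          - (\<Sum>l<M. tw (lam a) l m * (\<Sum>l'<M. tw (- lam a) l' k * cc a l l'))" .
      have "sg n a * (x * (sg n a * y) * z) = y * x * z" for x y z
      proof -
        have "sg n a * (x * (sg n a * y) * z) = (sg n a * sg n a) * (y * x * z)" by (simp only: mult_ac)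
        then show ?thesis by (simp add: sg_sq)
      qed
      then show ?thesis
        unfolding * right_diff_distrib by (cases "k < 0") (simp_all add: sum_distrib_left mult.assoc sg_sq)
    qed
    have "h (B m k v) = (\<Sum>a<2 * n. sg n a *s XH lam a m (XH lam (partner n a) k ?u))"
      unfolding B_def by (simp add: module_hom.sum[OF hom] module_hom.scale[OF hom] h(2) partner_less)
    then have "coord [] (h (B m k v)) = (\<Sum>a<2 * n. sg n a * coord [] (XH lam a m (XH lam (partner n a) k ?u)))"
      by (simp add: coord_sum coord_linear)
    also have "\<dots> = (\<Sum>a<2 * n. (if k < 0 then of_nat (nat (- k)) * tw (lam a) (nat (- k)) m else 0) * coord [] ?u
        - (\<Sum>l<M. \<Sum>l'<M. sg n a * (tw (lam a) l m * tw (- lam a) l' k * cc a l l')))"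
      by (rule sum.cong[OF refl]) (rule one, simp)
    finally show ?thesis
      by (simp add: sum_subtractf Bl_def Bc_def sum_distrib_right)
  qed
  \<comment> \<open>Exchanging partners interchanges the roles of \<open>lam a\<close> and
    \<open>- lam a\<close>. This puts the second half of \<open>qvec_mode\<close> into the form
    required by \<open>tw_convolution\<close>.\<close>
  have Bl_swap: "Bl m k = (\<Sum>a<2 * n. \<Sum>l<M. \<Sum>l'<M. sg n a * (tw (- lam a) l' m * tw (lam a) l k * cc a l l'))" for m k
  proof -
    have "Bl m k = (\<Sum>a<2 * n. \<Sum>l<M. \<Sum>l'<M. sg n (partner n a)
        * (tw (lam (partner n a)) l m * tw (- lam (partner n a)) l' k * cc (partner n a) l l'))"
      unfolding Bl_def
      by (rule sum_partner[of "\<lambda>a. \<Sum>l<M. \<Sum>l'<M. sg n a * (tw (lam a) l m * tw (- lam a) l' k * cc a l l')", symmetric])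
    also have "\<dots> = (\<Sum>a<2 * n. \<Sum>l<M. \<Sum>l'<M. sg n a * (tw (- lam a) l m * tw (lam a) l' k * cc a l' l))"
      by (intro sum.cong refl)
        (simp add: lam sg_partner cc_def partner_partner XX0[of "partner n _"] partner_less coord_linear)
    also have "\<dots> = (\<Sum>a<2 * n. \<Sum>l<M. \<Sum>l'<M. sg n a * (tw (- lam a) l' m * tw (lam a) l k * cc a l l'))"
      by (rule sum.cong[OF refl]) (rule sum.swap)
    finally show ?thesis .
  qed
  have "nprod V (qvec 0 K) ?r v = (\<Sum>j<N.
      dcoeff K (?r + int j) *s B (- 1 - int j) (?r + int j - int K) v
    + dcoeff K (?r - 1 - int j) *s B (?r - 1 - int j - int K) (int j) v)"
    using N0[of N] by (simp add: N_def dcoeff_0)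
  then have "coord [] (h (nprod V (qvec 0 K) ?r v)) = (\<Sum>j<N.
      dcoeff K (?r + int j) * (Bc (- 1 - int j) (?r + int j - int K) * coord [] ?u - Bl (- 1 - int j) (?r + int j - int K))
    + dcoeff K (?r - 1 - int j) * (Bc (?r - 1 - int j - int K) (int j) * coord [] ?u - Bl (?r - 1 - int j - int K) (int j)))"
    by (simp only: module_hom.sum[OF hom] module_hom.scale[OF hom] module_hom.add[OF hom] coord_sum coord_linear pair)
  \<comment> \<open>In the second half the inner mode \<open>int j\<close> is nonnegative, so its
    \<open>Bc\<close> is 0 and only the first half contributes self-contractions.\<close>
  also have "\<dots> = (\<Sum>j<N. dcoeff K (?r + int j) * Bc (- 1 - int j) (?r + int j - int K)) * coord [] ?u
    - (\<Sum>j<N. dcoeff K (?r + int j) * Bl (- 1 - int j) (?r + int j - int K)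
       + dcoeff K (?r - 1 - int j) * Bl (?r - 1 - int j - int K) (int j))"
    unfolding sum_distrib_right sum_subtractf[symmetric]
    by (rule sum.cong[OF refl]) (simp add: Bc_def[of _ "int _"] right_diff_distrib mult.assoc)
  also have "(\<Sum>j<N. dcoeff K (?r + int j) * Bl (- 1 - int j) (?r + int j - int K)
       + dcoeff K (?r - 1 - int j) * Bl (?r - 1 - int j - int K) (int j)) = 0"
  proof -
    let ?t = "\<lambda>a l l' j. tw (lam a) l (- 1 - int j) * (dcoeff K (- 1 - int s + int j) * tw (- lam a) l' (- 1 - int s + int j - int K))
        + tw (lam a) l (int j) * (dcoeff K (- 2 - int s - int j) * tw (- lam a) l' (- 2 - int s - int j - int K))"
    have "dcoeff K (?r + int j) * Bl (- 1 - int j) (?r + int j - int K)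
       + dcoeff K (?r - 1 - int j) * Bl (?r - 1 - int j - int K) (int j)
      = (\<Sum>a<2 * n. \<Sum>l<M. \<Sum>l'<M. ?t a l l' j * (sg n a * cc a l l'))" for j
    proof -
      have r: "?r - 1 - int j = - 2 - int s - int j" by simp
      show ?thesis
        unfolding r Bl_def[of "- 1 - int j"] Bl_swap[of "- 2 - int s - int j - int K"] sum_distrib_left sum.distrib[symmetric]
        by (intro sum.cong refl) (simp only: distrib_left distrib_right mult_ac)
    qed
    then have "(\<Sum>j<N. dcoeff K (?r + int j) * Bl (- 1 - int j) (?r + int j - int K)
       + dcoeff K (?r - 1 - int j) * Bl (?r - 1 - int j - int K) (int j))
      = (\<Sum>j<N. \<Sum>a<2 * n. \<Sum>l<M. \<Sum>l'<M. ?t a l l' j * (sg n a * cc a l l'))" by (simp only:)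
    also have "\<dots> = (\<Sum>a<2 * n. \<Sum>l<M. \<Sum>l'<M. \<Sum>j<N. ?t a l l' j * (sg n a * cc a l l'))"
      by (subst sum.swap) (intro sum.cong refl sum_rotate)
    also have "\<dots> = (\<Sum>a<2 * n. \<Sum>l<M. \<Sum>l'<M. (\<Sum>j<N. ?t a l l' j) * (sg n a * cc a l l'))"
      unfolding sum_distrib_right by (rule refl)
    also have "\<dots> = 0"
      by (intro sum.neutral ballI, subst tw_convolution) (auto simp: N_def)
    finally show ?thesis .
  qed
  also have "(\<Sum>j<N. dcoeff K (?r + int j) * Bc (- 1 - int j) (?r + int j - int K))
      = (\<Sum>a<2 * n. \<Sum>j<N. if j < K + s + 1 then dcoeff K (?r + int j)
          * (of_nat (K + s + 1 - j) * tw (lam a) (K + s + 1 - j) (- 1 - int j)) else 0)"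
  proof -
    have "dcoeff K (?r + int j) * Bc (- 1 - int j) (?r + int j - int K)
      = (\<Sum>a<2 * n. if j < K + s + 1 then dcoeff K (?r + int j)
          * (of_nat (K + s + 1 - j) * tw (lam a) (K + s + 1 - j) (- 1 - int j)) else 0)" for j
    proof (cases "j < K + s + 1")
      case True
      then have "?r + int j - int K < 0" "nat (- (?r + int j - int K)) = K + s + 1 - j" by auto
      then show ?thesis using True unfolding Bc_def by (simp only: if_True sum_distrib_left)
    next
      case False
      then have "\<not> ?r + int j - int K < 0" by simp
      then show ?thesis using False unfolding Bc_def by simp
    qed
    then show ?thesis by (simp only:) (rule sum.swap)
  qed
  also have "\<dots> = (\<Sum>a<2 * n. if s = 0 then (-1) ^ (K + 1) * lam a ^ (K + 2) / of_nat (K + 2) else 0)"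
    by (intro sum.cong refl tw_constant) (simp add: N_def)
  also have "\<dots> = (if s = 0 then (-1) ^ (K + 1) * (\<Sum>a<2 * n. lam a ^ (K + 2)) / of_nat (K + 2) else 0)"
    by (simp add: sum_distrib_left sum_divide_distrib)
  finally show ?thesis by simp
qed

end

section \<open>Minimality\<close>

text \<open>The squares of the nonzero \<open>\<mu> i\<close> run through all roots of unity of
  order \<open>Suc m\<close>, so a power sum of degree 2k + 2 is a power sum of degree k + 1 of
  these roots. There is room for them because \<open>m < n\<close>.\<close>

lemma power_sums_roots_of_unity:
  fixes \<mu> :: "nat \<Rightarrow> complex"
  assumes "m < n" and \<mu>: "\<And>i. \<mu> i = (if i < Suc m then cis (2 * pi * real i / real (2 * Suc m)) else 0)"
  shows "k < m \<Longrightarrow> (\<Sum>i<n. \<mu> i ^ (2 * k + 2)) = 0" "(\<Sum>i<n. \<mu> i ^ (2 * m + 2)) = of_nat (Suc m)"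
proof -
  have *: "(\<Sum>i<n. \<mu> i ^ (2 * k + 2)) = (\<Sum>i<Suc m. cis (2 * pi * real (Suc k) / real (Suc m)) ^ i)" for k
  proof -
    have "(\<Sum>i<n. \<mu> i ^ (2 * k + 2)) = (\<Sum>i<Suc m. \<mu> i ^ (2 * k + 2))"
      using assms(1) by (intro sum.mono_neutral_right) (auto simp: \<mu>)
    also have "\<dots> = (\<Sum>i<Suc m. cis (2 * pi * real (Suc k) / real (Suc m)) ^ i)"
    proof (rule sum.cong[OF refl])
      fix i assume "i \<in> {..<Suc m}"
      moreover have "real (2 * k + 2) * (2 * pi * real i / real (2 * Suc m)) = real i * (2 * pi * real (Suc k) / real (Suc m))"
        by (simp add: divide_simps algebra_simps)
      ultimately show "\<mu> i ^ (2 * k + 2) = cis (2 * pi * real (Suc k) / real (Suc m)) ^ i"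
        by (simp only: \<mu> lessThan_iff if_True DeMoivre)
    qed
    finally show ?thesis .
  qed
  show "(\<Sum>i<n. \<mu> i ^ (2 * k + 2)) = 0" if "k < m"
  proof -
    let ?z = "cis (2 * pi * real (Suc k) / real (Suc m))"
    have "inj_on (\<lambda>k. cis (2 * pi * real k / real (Suc m))) {..<Suc m}"
      using bij_betw_roots_unity[of "Suc m"] by (simp add: bij_betw_def)
    then have "?z \<noteq> cis (2 * pi * real 0 / real (Suc m))"
      using that by (auto dest!: inj_onD[of _ _ "Suc k" 0])
    then have "?z \<noteq> 1" by simp
    moreover have "?z ^ Suc m = 1"
    proof -
      have "real (Suc m) * (2 * pi * real (Suc k) / real (Suc m)) = 2 * pi * real (Suc k)" by simp
      then show ?thesis by (simp only: DeMoivre) (simp add: cis_multiple_2pi)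
    qed
    ultimately show ?thesis unfolding * using geometric_sum[of ?z "Suc m"] by (simp only: diff_self div_0 simp_thms)
  qed
  show "(\<Sum>i<n. \<mu> i ^ (2 * m + 2)) = of_nat (Suc m)" unfolding * by simp
qed

context symplectic_fermion_algebra
begin

lemma separating_functional:
  assumes "m < n"
  shows "\<exists>\<psi>. (\<forall>u v. \<psi> (u + v) = \<psi> u + \<psi> v) \<and> (\<forall>t v. \<psi> (t *s v) = t * (\<psi> v :: complex)) \<and>
    \<psi> (qvec 0 (2 * m)) \<noteq> 0 \<and> (\<forall>k j v. k < m \<longrightarrow> \<psi> (nprod V ((D ^^ j) (qvec 0 (2 * k))) (-1) v) = 0)"
proof -
  define \<mu> where "\<mu> i = (if i < Suc m then cis (2 * pi * real i / real (2 * Suc m)) else 0)" for i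
  note sums = power_sums_roots_of_unity[OF assms \<mu>_def]
  \<comment> \<open>Partners must get opposite values; since only even powers occur, this merely
    doubles the power sums of \<open>\<mu>\<close>.\<close>
  define lam where "lam a = (if a < n then \<mu> a else - \<mu> (a - n))" for a
  have lam: "lam (partner n a) = - lam a" if "a < 2 * n" for a
    using that by (auto simp: lam_def partner_def)
  have pow: "(\<Sum>a<2 * n. lam a ^ (2 * k + 2)) = 2 * (\<Sum>i<n. \<mu> i ^ (2 * k + 2))" for k
    unfolding mult_2 sum_lessThan_add by (simp add: lam_def)
  obtain h where h: "Vector_Spaces.linear (scl V) (scl V) h" "h (vac V) = vac V"
    "\<And>b m u. b < 2 * n \<Longrightarrow> h (X b m u) = XH lam b m (h u)"
    using twisted_exists[of lam, OF lam] by blast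
  have hom: "module_hom (scl V) (scl V) h" using h(1) by (simp add: linear_iff_module_hom)
  have ev: "coord [] (h (nprod V (qvec 0 K) (- 1 - int s) v))
    = (if s = 0 then (-1) ^ (K + 1) * (\<Sum>a<2 * n. lam a ^ (K + 2)) / of_nat (K + 2) else 0) * coord [] (h v)" for K s v
    by (rule twisted_expectation) (use lam h in auto)
  show ?thesis
  proof (intro exI[of _ "\<lambda>v. coord [] (h v)"] conjI allI impI)
    show "coord [] (h (u + v)) = coord [] (h u) + coord [] (h v)" for u v
      by (simp add: module_hom.add[OF hom] coord_linear)
    show "coord [] (h (t *s v)) = t * coord [] (h v)" for t v
      by (simp add: module_hom.scale[OF hom] coord_linear)
    have "coord [] (h (nprod V (qvec 0 (2 * m)) (- 1 - int 0) (vac V))) = - (2 * of_nat (Suc m)) / of_nat (2 * m + 2)"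
      unfolding ev pow sums(2)
      by (simp add: h(2) coord_Nil_vac)
    moreover have "(of_nat (2 * m + 2) :: complex) \<noteq> 0" by (simp only: of_nat_eq_0_iff)
    ultimately show "coord [] (h (qvec 0 (2 * m))) \<noteq> 0" by (simp add: creation del: of_nat_Suc of_nat_add)
    show "coord [] (h (nprod V ((D ^^ j) (qvec 0 (2 * k))) (-1) v)) = 0" if "k < m" for k j v
      unfolding nprod_D_pow_neg1 module_hom.scale[OF hom] coord_linear ev pow
        sums(1)[OF that] by simp
  qed
qed

lemma has_wt_sf_j: "has_wt (int k + 2) (sf_j V n e f k)"
  unfolding sf_j_qvec using has_wt_qvec[of 0 k] by (intro has_wt_scale) simp

text \<open>Two of the generators have different weights and could coincide only by both being 0,
  which is excluded here.\<close>

lemma sf_j_nonzero: "m < n \<Longrightarrow> sf_j V n e f (2 * m) \<noteq> 0"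
proof
  assume m: "m < n" and 0: "sf_j V n e f (2 * m) = 0"
  obtain \<psi> where \<psi>: "\<forall>t v. \<psi> (t *s v) = t * (\<psi> v :: complex)" "\<psi> (qvec 0 (2 * m)) \<noteq> 0"
    using separating_functional[OF m] by blast
  have "\<psi> (0 *s 0) = 0" unfolding \<psi>(1)[rule_format] by simp
  moreover have "\<psi> (sf_j V n e f (2 * m)) = (1/2) * \<psi> (qvec 0 (2 * m))"
    unfolding sf_j_qvec \<psi>(1)[rule_format] ..
  ultimately show False using \<psi>(2) 0 by simp
qed

section \<open>Strong generation and minimality for the vectors \<open>sf_j\<close>\<close>

lemma wick_monomial_jmon:
  assumes "set (map fst w) \<subseteq> {sf_j V n e f (2 * m) | m. P m}"
  shows "\<exists>ws t. (\<forall>p\<in>set ws. P (fst p)) \<and> wick_monomial V w = t *s jmon ws"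
  using assms
proof (induction w)
  case Nil
  show ?case by (intro exI[of _ "[]"] exI[of _ 1]) (simp add: wick_monomial_def jmon_def)
next
  case (Cons p w)
  obtain x k where p: "p = (x, k)" by force
  obtain ws t where ws: "\<forall>p\<in>set ws. P (fst p)" "wick_monomial V w = t *s jmon ws" using Cons by auto
  obtain m where m: "x = (1/2) *s qvec 0 (2 * m)" "P m" using Cons.prems by (auto simp: p sf_j_qvec)
  have D_pow: "(D ^^ k) ((1/2) *s s) = (1/2) *s (D ^^ k) s" for s
    by (induction k) (simp_all only: funpow.simps o_apply D_scale id_apply)
  have "wick_monomial V (p # w) = nprod V ((D ^^ k) x) (-1) (wick_monomial V w)"
    by (simp add: wick_monomial_def p wick_def)
  also have "\<dots> = ((1/2) * t) *s jmon ((m, k) # ws)"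
    unfolding m(1) D_pow ws(2) jmon_Cons by (simp only: nprod_simps scale_scale mult.commute)
  finally show ?case using ws(1) m(2) by (intro exI[of _ "(m, k) # ws"] exI[of _ "(1/2) * t"]) auto
qed

lemma jmon_wick_monomial:
  assumes "\<forall>p\<in>set ws. P (fst p)"
  shows "\<exists>w t. set (map fst w) \<subseteq> {sf_j V n e f (2 * m) | m. P m} \<and> jmon ws = t *s wick_monomial V w"
  using assms
proof (induction ws)
  case Nil
  show ?case by (intro exI[of _ "[]"] exI[of _ 1]) (simp add: wick_monomial_def jmon_def)
next
  case (Cons p ws)
  obtain m k where p: "p = (m, k)" by force
  obtain w t where w: "set (map fst w) \<subseteq> {sf_j V n e f (2 * m) | m. P m}" "jmon ws = t *s wick_monomial V w"
    using Cons by auto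
  let ?x = "sf_j V n e f (2 * m)"
  have "qvec 0 (2 * m) = 2 *s ?x" by (simp add: sf_j_qvec)
  moreover have D_pow: "(D ^^ k) (2 *s s) = 2 *s (D ^^ k) s" for s
    by (induction k) (simp_all only: funpow.simps o_apply D_scale id_apply)
  ultimately have "jmon (p # ws) = (2 * t) *s wick_monomial V ((?x, k) # w)"
    by (simp add: p jmon_Cons w(2) nprod_simps wick_monomial_def wick_def mult.commute)
  then show ?case using w(1) Cons.prems
    by (intro exI[of _ "(?x, k) # w"] exI[of _ "2 * t"]) (auto simp: p)
qed

lemma strongly_generates_sf_j: "strongly_generates V orb {sf_j V n e f (2 * m) | m. m < n}"
proof -
  let ?G = "{sf_j V n e f (2 * m) | m. m < n}"
  have G: "?G \<subseteq> orb" using orb_closed(1) orb_qvec by (auto simp: sf_j_qvec subspace_scale)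
  let ?M = "{wick_monomial V w | w. fst ` set w \<subseteq> ?G}"
  have "span ?M \<subseteq> jspan"
  proof (rule span_minimal)
    show "?M \<subseteq> jspan"
    proof clarify
      fix w :: "('v \<times> nat) list" assume "fst ` set w \<subseteq> ?G"
      then obtain ws t where "\<forall>p\<in>set ws. fst p < n" "wick_monomial V w = t *s jmon ws"
        using wick_monomial_jmon[of w "\<lambda>m. m < n"] by auto
      moreover from this(1) have "jmon ws \<in> jspan" by (auto simp: jspan_def jword_def intro!: span_base)
      ultimately show "wick_monomial V w \<in> jspan" by (simp add: jspan_closed)
    qed
  qed (simp add: jspan_def)
  moreover have "jspan \<subseteq> span ?M" unfolding jspan_def
  proof (rule span_minimal)
    show "{jmon ws | ws. jword ws} \<subseteq> span ?M"
    proof clarify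
      fix ws assume "jword ws"
      then obtain w t where "set (map fst w) \<subseteq> ?G" "jmon ws = t *s wick_monomial V w"
        using jmon_wick_monomial[of ws "\<lambda>m. m < n"] by (auto simp: jword_def)
      moreover from this(1) have "wick_monomial V w \<in> ?M" by auto
      ultimately show "jmon ws \<in> span ?M" by (simp add: span_scale span_base)
    qed
  qed simp
  ultimately show ?thesis using G jspan_eq_orb unfolding strongly_generates_def by auto
qed

text \<open>In a word of weight 2m + 2 without the letter \<open>m\<close>, the first letter
  \<open>k\<close> satisfies 2k + 2 <= 2m + 2, hence \<open>k < m\<close>, and the separating
  functional kills the word. It does not kill the missing generator.\<close>

lemma sf_j_indispensable:
  assumes S': "S' \<subset> {sf_j V n e f (2 * m) | m. m < n}"
  shows "\<not> strongly_generates V orb S'"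
proof
  assume sg: "strongly_generates V orb S'"
  obtain m where m: "m < n" "sf_j V n e f (2 * m) \<notin> S'" using S' by blast
  let ?T = "{wick_monomial V w | w. fst ` set w \<subseteq> S'}" and ?j = "sf_j V n e f (2 * m)"
  have sub: "S' \<subseteq> {sf_j V n e f (2 * k) | k. k < n \<and> k \<noteq> m}" using S' m(2) by auto
  obtain \<psi> where \<psi>: "\<forall>u v. \<psi> (u + v) = \<psi> u + \<psi> v" "\<forall>t v. \<psi> (t *s v) = t * (\<psi> v :: complex)"
    "\<psi> (qvec 0 (2 * m)) \<noteq> 0" "\<forall>k j v. k < m \<longrightarrow> \<psi> (nprod V ((D ^^ j) (qvec 0 (2 * k))) (-1) v) = 0"
    using separating_functional[OF m(1)] by blast
  have \<psi>0: "\<psi> 0 = 0" using \<psi>(2)[rule_format, of 0 0] by simp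
  have word: "\<exists>ws t. (\<forall>p\<in>set ws. fst p < n \<and> fst p \<noteq> m) \<and> s = t *s jmon ws" if s: "s \<in> ?T" for s
  proof -
    obtain w where "s = wick_monomial V w" "fst ` set w \<subseteq> S'" using s by blast
    then show ?thesis using wick_monomial_jmon[of w "\<lambda>k. k < n \<and> k \<noteq> m"] sub by auto
  qed
  have "?j \<in> orb" using strongly_generates_sf_j m(1) by (auto simp: strongly_generates_def)
  then have "?j \<in> span ?T" using sg by (simp add: strongly_generates_def)
  then have "?j \<in> span {s \<in> ?T. has_wt (int (2 * m) + 2) s}"
  proof (rule has_wt_homogeneous_part[rotated])
    show "has_wt (int (2 * m) + 2) ?j" by (rule has_wt_sf_j)
    fix s assume "s \<in> ?T"
    then obtain ws t where "s = t *s jmon ws" using word by blast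
    then show "\<exists>d. has_wt d s" using has_wt_scale[OF has_wt_jmon] by blast
  qed
  moreover have "\<psi> s = 0" if s: "s \<in> ?T" "has_wt (int (2 * m) + 2) s" for s
  proof -
    obtain ws t where ws: "\<forall>p\<in>set ws. fst p < n \<and> fst p \<noteq> m" "s = t *s jmon ws" using word[OF s(1)] by blast
    show ?thesis
    proof (cases "int (jweight ws) = int (2 * m) + 2")
      case False
      then have "s = 0" using has_wt_distinct[OF s(2), of "int (jweight ws)"] has_wt_scale[OF has_wt_jmon] ws(2) by auto
      then show ?thesis by (simp add: \<psi>0)
    next
      case True
      then have "ws \<noteq> []" by (auto simp: jweight_def)
      then obtain k i ws' where Cons: "ws = (k, i) # ws'" by (cases ws) auto
      have "2 * k + 2 + i \<le> 2 * m + 2" using True by (simp add: Cons jweight_def)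
      then have "k < m" using ws(1) by (auto simp: Cons)
      then show ?thesis using \<psi>(2,4) by (simp add: ws(2) Cons jmon_Cons)
    qed
  qed
  then have "{s \<in> ?T. has_wt (int (2 * m) + 2) s} \<subseteq> {v. \<psi> v = 0}" by auto
  moreover have "subspace {v. \<psi> v = 0}" using \<psi>(1,2) \<psi>0 by (simp add: subspace_def)
  ultimately have "\<psi> ?j = 0" using span_minimal by blast
  then show False using \<psi>(2,3) by (simp add: sf_j_qvec)
qed

lemma minimal_sf_j: "minimal_strong_generating_set V orb {sf_j V n e f (2 * m) | m. m < n}"
  unfolding minimal_strong_generating_set_def
  using strongly_generates_sf_j sf_j_indispensable by blast

lemma sf_j_inj:
  assumes "a < n" "b < n" "sf_j V n e f (2 * a) = sf_j V n e f (2 * b)"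
  shows "a = b"
proof (rule ccontr)
  assume "a \<noteq> b"
  then have "sf_j V n e f (2 * a) = 0"
    using has_wt_distinct[OF has_wt_sf_j[of "2 * a"], of "int (2 * b) + 2"] has_wt_sf_j[of "2 * b"] assms(3) by simp
  then show False using sf_j_nonzero assms(1) by blast
qed

lemma type_W_sf_j: "of_type_W V L orb (map (\<lambda>m. 2 * m + 2) [0..<n])"
  unfolding of_type_W_def
proof (intro exI[of _ "map (\<lambda>m. sf_j V n e f (2 * m)) [0..<n]"] conjI allI impI)
  show "distinct (map (\<lambda>m. sf_j V n e f (2 * m)) [0..<n])"
    using sf_j_inj by (auto simp: distinct_map inj_on_def)
  have "set (map (\<lambda>m. sf_j V n e f (2 * m)) [0..<n]) = {sf_j V n e f (2 * m) | m. m < n}" by auto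
  then show "minimal_strong_generating_set V orb (set (map (\<lambda>m. sf_j V n e f (2 * m)) [0..<n]))"
    using minimal_sf_j by simp
  show "has_conformal_weight V L (map (\<lambda>m. 2 * m + 2) [0..<n] ! i)
      (map (\<lambda>m. sf_j V n e f (2 * m)) [0..<n] ! i)" if "i < length (map (\<lambda>m. 2 * m + 2) [0..<n])" for i
    using has_wt_sf_j[of "2 * i"] that by (simp add: has_conformal_weight_def has_wt_def)
qed simp

end

theorem theorem3p12:
  fixes V :: "('v::ab_group_add) vertex_data" and n :: nat and e f :: "nat \<Rightarrow> 'v"
  assumes "n \<ge> 1"
    and "symplectic_fermion_algebra V n e f"
  shows "minimal_strong_generating_set V (orbifold V (Sp_automorphisms V n e f))
           {sf_j V n e f (2 * m) | m. m < n}
       \<and> of_type_W V (sf_conformal V n e f) (orbifold V (Sp_automorphisms V n e f))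
           (map (\<lambda>m. 2 * m + 2) [0..<n])"
  using symplectic_fermion_algebra.minimal_sf_j[OF assms(2)]
    symplectic_fermion_algebra.type_W_sf_j[OF assms(2)] by blast

end
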